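(* Let $(X_n)_{n\in\mathbb{N}_0}$ be a transient random walk on a regular language which is weakly symmetric and suffix-irreducible. If $ab\in\mathcal{A}^2$ is unambiguous, i.e. $\partial C(ab)=\{ab\}$, then $$H(\mathbf{Y})=-\nu_{ab}\sum_{n\ge2}\ \sum_{\substack{x_2,\dots,x_{n-1}\in\mathcal{W}_0:\\ [x_i]\ne ab\text{ for }2\le i\le n-1}}\ \sum_{\substack{x_n\in\mathcal{W}_0:\\ [x_n]=ab}}w(ab,x_2,\dots,x_n)\,\log\tilde w(ab,x_2,\dots,x_n),$$ where $$w(ab,x_2,\dots,x_n)=\mathbb{P}\bigl[\mathbf{W}_2=x_2,\dots,\mathbf{W}_n=x_n,[\mathbf{W}_n]=ab\,\big|\,[\mathbf{W}_1]=ab\bigr],$$ $$\tilde w(ab,x_2,\dots,x_n)=\sum_{\substack{y_2,\dots,y_n\in\mathcal{W}_0:\\ y_i\in\partial C(x_i)\text{ for }2\le i\le n}}\mathbb{P}\bigl[\mathbf{W}_2=y_2,\dots,\mathbf{W}_n=y_n,[\mathbf{W}_n]=ab\,\big|\,[\mathbf{W}_1]=ab\bigr],$$ $\nu_{ab}=\sum_{(i_{m,n},x)\in\mathcal{W}:[x]=ab}\nu(i_{m,n},x)$, and $0\log0:=0$.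
   Context: Random walk. $\mathcal{A}$ is a finite alphabet, $\mathcal{A}^n$ the set of words with exactly $n$ letters, $\mathcal{A}^*$ the set of all finite words including the empty word $o$, $|w|$ the length of $w$, $\mathcal{A}^*_{\ge n}=\{w\in\mathcal{A}^*:|w|\ge n\}$, and $[w]$ denotes the last two letters of a word $w$ with $|w|\ge2$. A random walk on a regular language is a time-homogeneous Markov chain $(X_n)_{n\ge0}$ on $\mathcal{A}^*$ with $X_0=o$ whose only possible one-step transitions are (for $w\in\mathcal{A}^*$ and letters $a_i,b_i\in\mathcal{A}$): from $wa_1a_2$ to $wb_1$, $wb_1b_2$, $wb_1b_2b_3$ with probabilities $p(a_1a_2,b_1)$, $p(a_1a_2,b_1b_2)$, $p(a_1a_2,b_1b_2b_3)$ not depending on $w$; from $a_1$ to $o$, $b_1$, $b_1b_2$ with probabilities $p(a_1,o)$, $p(a_1,b_1)$, $p(a_1,b_1b_2)$; from $o$ to $o$, $b_1$ with probabilities $p(o,o)$, $p(o,b_1)$. Write $\mathbb{P}_w$ for the law started at $w$, $p(u,v)=\mathbb{P}_u[X_1=v]$, and $\mathcal{L}=\{w\in\mathcal{A}^*:\exists n\in\mathbb{N},\ \mathbb{P}[X_n=w]>0\}$. Weakly symmetric: for all $u,v\in\mathcal{A}^*$, $p(u,v)>0$ implies $p(v,u)>0$. Suffix-irreducible: for every $w=w_0a_0b_0\in\mathcal{L}$ ($w_0\in\mathcal{A}^*$, $a_0b_0\in\mathcal{A}^2$) and every $ab\in\mathcal{A}^2$ there are $n\in\mathbb{N}$, $w_1\in\mathcal{A}^*$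 with $\mathbb{P}_w[X_n=w_0w_1ab,\ \forall k\le n:|X_k|\ge|w|]>0$. Cones. A path is a sequence of words with $p>0$ for consecutive words. For $w_0\in\mathcal{A}^*_{\ge2}$ the cone $C(w_0)$ is the set of all $w$ that can be reached from $w_0$ by a path (possibly of length $0$) all of whose words have length $\ge|w_0|$. If $w_1\in C(w_0)$ then $C(w_1)\subseteq C(w_0)$ is called a subcone. Cones $C(w_1),C(w_2)$ are isomorphic (have the same type) if $C([w_1])=C([w_2])$; the finitely many types are identified with $\mathcal{I}=\{1,\dots,r\}$ and $\tau(C(w))$ is the type of $C(w)$. Boundary: $\partial C(w)=\{u\in C(w):|u|=|w|,\ \exists w'\in\mathcal{A}^*\setminus C(w):p(u,w')>0\}$. The walk is expanding if every cone $C(w)$, $w\in\mathcal{L}$, $|w|\ge 2$, contains two disjoint proper subcones. Coverings. Fix once and for all, for each cone type $i$, a finite list of words $v_1,\dots,v_k\in\mathcal{A}^*_{\ge3}$ such that for every $w=w_0ab$ ($ab\in\mathcal{A}^2$) with $\tau(C(w))=i$ the cones $C(w_0v_1),\dots,C(w_0v_k)$ are pairwise disjoint proper subcones of $C(w)$ whose union has finite complement in $C(w)$; they are called the covering of $C(w)$. If the walk is expanding, every type is required to occur in every covering; if it is not expanding, the covering consists of one subcone $C(w_1)$ with $w_1\in C(w)$, $|w_1|=|w|+1$. Similarly fix a covering $C^{(0)}_1,\dots,C^{(0)}_{n_0}$ of $\mathcal{L}$: pairwise disjoint cones with roots in $\mathcal{L}$ of length $\ge2$, whose union has finite complement in $\mathcal{L}$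 (containing all types in the expanding case). Let $n(i,j)$ be the number of subcones of type $j$ in the covering of a cone of type $i$; these are enumerated (with an enumeration depending only on relative position) as $j_{i,1},\dots,j_{i,n(i,j)}$, and $C_{j_{i,n}}(w)$ is the corresponding subcone of $C(w)$. $\mathcal{S}(w)$ is the union of the boundaries of the subcones in the covering of $C(w)$. Last entry process. $\mathbf{e}_0=\inf\{m:\exists i\,\forall n\ge m: X_n\in C^{(0)}_i\}$ and, if $C_1,\dots,C_{n(w)}$ is the covering of $C(w)$ with $w=X_{\mathbf{e}_k}$, $\mathbf{e}_{k+1}=\inf\{m>\mathbf{e}_k:\exists i\,\forall n\ge m:X_n\in C_i\}$. Set $\mathbf{W}_0=X_{\mathbf{e}_0}$, and for $k\ge1$: if $X_{\mathbf{e}_{k-1}}=ua'b'$ ($a'b'\in\mathcal A^2$) and $X_{\mathbf{e}_k}=uw_1cd$ ($cd\in\mathcal A^2$), then $\mathbf{W}_k=w_1cd$. Let $\mathcal{W}_0$ be the (finite) set of values taken by $\mathbf{W}_1$ with positive probability. Let $\xi(ab)=\mathbb{P}_{ab}[\forall n\ge0:|X_n|\ge2]$, and for $x\in\mathcal{A}^*_{\ge2}$, $y\in C(x)$ with $|y|>|x|$, $\mathbb{L}(x,y)=\sum_{n\ge1}\mathbb{P}_x[X_n=y,\ X_{n-1}\notin C(y),\ \forall m\le n:X_m\in C(x)]$. The process $(\mathbf{W}_k)_{k\ge1}$ is a positive recurrent Markov chain on $\mathcal{W}_0$ with transition probabilities $q(x,y)=\frac{\xi([y])}{\xi([x])}\mathbb{L}([x],y)$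 if $y\in\mathcal{S}([x])$ and $q(x,y)=0$ otherwise; these depend on $x$ only through $[x]$, so that conditioning on $[\mathbf{W}_1]=ab$ determines the law of $(\mathbf{W}_2,\mathbf{W}_3,\dots)$. Hidden Markov chain. For $k\ge1$ let $\mathbf{i}_k=j_{i,l}$ if $\tau(C(X_{\mathbf{e}_{k-1}}))=i$ and $X_{\mathbf{e}_k}\in\partial C_{j_{i,l}}(X_{\mathbf{e}_{k-1}})$. Then $((\mathbf{i}_k,\mathbf{W}_k))_{k\ge1}$ is a positive recurrent Markov chain on the finite set $\mathcal{W}$ of pairs $(j_{m,n},x)$ with $x\in\mathcal{W}_0$, $\tau(C([x]))=j$, $1\le n\le n(m,j)$, for which there is $w_0\in\mathcal{L}$ with $\mathbb{P}[\mathbf{W}_0=w_0,\mathbf{W}_1=x]>0$, $\tau(C([w_0]))=m$, $x\in\partial C_{j_{m,n}}([w_0])$; its transition probability from $(i_{m,n},w_1)$ to $(j_{s,t},w_2)$ is $q(w_1,w_2)$ if $s=i$ and $0$ if $s\ne i$. Let $\nu$ be its invariant probability measure and $((\mathbf{i}^{(\nu)}_k,\mathbf{W}^{(\nu)}_k))_{k\ge1}$ the chain with the same transitions and initial law $\nu$. When $(\mathbf{i}^{(\nu)}_k,\mathbf{W}^{(\nu)}_k)=(i_{m,n},w_1)$ and $(\mathbf{i}^{(\nu)}_{k+1},\mathbf{W}^{(\nu)}_{k+1})=(j_{i,t},w_2)$ set $\mathbf{Y}^{(\nu)}_k=(i,j_t)$. $H(\mathbf{Y})$ is the constant with $-\frac1k\log\mathbb{P}[\mathbf{Y}^{(\nu)}_1=y_1,\dots,\mathbf{Y}^{(\nu)}_k=y_k]\to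 H(\mathbf{Y})$ for almost every realization $(y_1,y_2,\dots)$ of $(\mathbf{Y}^{(\nu)}_k)_{k}$ (it exists by the Shannon–McMillan–Breiman theorem). *)

theory Defs
  imports "HOL-Probability.Probability"
begin

section \<open>Time-homogeneous Markov chains and entropy rates\<close>

definition markov_chain ::
    "'w measure \<Rightarrow> 's set \<Rightarrow> ('s \<Rightarrow> real) \<Rightarrow> ('s \<Rightarrow> 's \<Rightarrow> real) \<Rightarrow> (nat \<Rightarrow> 'w \<Rightarrow> 's) \<Rightarrow> bool" where
  "markov_chain M S \<mu> Q X \<longleftrightarrow>
     prob_space M \<and>
     (\<forall>n. X n \<in> M \<rightarrow>\<^sub>M count_space S) \<and>
     (\<forall>n x. (\<forall>i\<le>n. x i \<in> S) \<longrightarrow>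
        \<P>(\<omega> in M. \<forall>i\<le>n. X i \<omega> = x i) = \<mu> (x 0) * (\<Prod>i<n. Q (x i) (x (Suc i))))"

text \<open>
  The entropy rate of the process \<open>Y\<^sub>1, Y\<^sub>2, \<dots>\<close> (\<open>Y 0\<close> is ignored).  The event below consists of
  the sample points on which the first \<open>k\<close> observations agree with those made at \<open>\<omega>\<close>.
\<close>

definition entropy_rate :: "'w measure \<Rightarrow> (nat \<Rightarrow> 'w \<Rightarrow> 's) \<Rightarrow> real" where
  "entropy_rate M Y = (THE h. AE \<omega> in M.
     (\<lambda>k. - (1 / real k) * ln (\<P>(\<omega>' in M. \<forall>l\<in>{1..k}. Y l \<omega>' = Y l \<omega>))) \<longlonglongrightarrow> h)"


section \<open>Random walks on regular languages\<close>

definition suffix2 :: "'a list \<Rightarrow> 'a list" where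
  "suffix2 w = drop (length w - 2) w"

definition stem :: "'a list \<Rightarrow> 'a list" where
  "stem w = take (length w - 2) w"

text \<open>\<open>P w\<close> is the probability measure under which the walk \<open>X\<close> starts at the word \<open>w\<close>.\<close>

locale regular_language_walk =
  fixes K :: "'a::finite list \<Rightarrow> 'a list pmf"
    and P :: "'a list \<Rightarrow> 'w measure"
    and X :: "nat \<Rightarrow> 'w \<Rightarrow> 'a list"
  assumes step_long: "v \<in> set_pmf (K (w @ [a1, a2])) \<Longrightarrow>
      \<exists>u. v = w @ u \<and> length u \<in> {1, 2, 3}"
    and step_long_homogeneous: "length u \<in> {1, 2, 3} \<Longrightarrow>
      pmf (K (w @ [a1, a2])) (w @ u) = pmf (K [a1, a2]) u"
    and step_letter: "v \<in> set_pmf (K [a1]) \<Longrightarrow> length v \<le> 2"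
    and step_empty: "v \<in> set_pmf (K []) \<Longrightarrow> length v \<le> 1"
    and markov: "markov_chain (P w) UNIV (indicator {w}) (\<lambda>u v. pmf (K u) v) X"
begin

abbreviation p :: "'a list \<Rightarrow> 'a list \<Rightarrow> real" where
  "p u v \<equiv> pmf (K u) v"

definition language :: "'a list set" where
  "language = {w. \<exists>n. \<P>(\<omega> in P []. X n \<omega> = w) > 0}"

definition transient :: bool where
  "transient \<longleftrightarrow> (\<forall>w\<in>language. \<P>(\<omega> in P w. \<exists>n\<ge>1. X n \<omega> = w) < 1)"

definition weakly_symmetric :: bool where
  "weakly_symmetric \<longleftrightarrow> (\<forall>u v. p u v > 0 \<longrightarrow> p v u > 0)"

definition suffix_irreducible :: bool where
  "suffix_irreducible \<longleftrightarrow>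
     (\<forall>w0 a0 b0. w0 @ [a0, b0] \<in> language \<longrightarrow>
        (\<forall>a b. \<exists>n w1. \<P>(\<omega> in P (w0 @ [a0, b0]).
            X n \<omega> = w0 @ w1 @ [a, b] \<and>
            (\<forall>k\<le>n. length (X k \<omega>) \<ge> length (w0 @ [a0, b0]))) > 0))"


subsection \<open>Cones\<close>

definition cone :: "'a list \<Rightarrow> 'a list set" where
  "cone w0 = {w. (\<lambda>u v. length u \<ge> length w0 \<and> length v \<ge> length w0 \<and> p u v > 0)\<^sup>*\<^sup>* w0 w}"

text \<open>
  Instead of being numbered, the types are represented by the cones of the two-letter words:
  \<open>C(w)\<close> and \<open>C(w')\<close> have the same type iff \<open>C([w]) = C([w'])\<close>.
\<close>

definition cone_type :: "'a list \<Rightarrow> 'a list set" where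
  "cone_type w = cone (suffix2 w)"

definition cone_types :: "'a list set set" where
  "cone_types = {cone [a, b] | a b. True}"

definition boundary :: "'a list \<Rightarrow> 'a list set" where
  "boundary w = {u \<in> cone w. length u = length w \<and> (\<exists>w'. w' \<notin> cone w \<and> p u w' > 0)}"

definition expanding :: bool where
  "expanding \<longleftrightarrow>
     (\<forall>w\<in>language. length w \<ge> 2 \<longrightarrow>
        (\<exists>w1\<in>cone w. \<exists>w2\<in>cone w.
           cone w1 \<subset> cone w \<and> cone w2 \<subset> cone w \<and> cone w1 \<inter> cone w2 = {}))"

definition is_covering :: "'a list set \<Rightarrow> 'a list list \<Rightarrow> bool" where
  "is_covering i vs \<longleftrightarrow>
     (\<forall>v\<in>set vs. length v \<ge> 3) \<and>
     (\<forall>w0 a b. cone_type (w0 @ [a, b]) = i \<longrightarrow>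
        (\<forall>v\<in>set vs. w0 @ v \<in> cone (w0 @ [a, b]) \<and> cone (w0 @ v) \<subset> cone (w0 @ [a, b])) \<and>
        (\<forall>k<length vs. \<forall>l<length vs. k \<noteq> l \<longrightarrow>
            cone (w0 @ vs ! k) \<inter> cone (w0 @ vs ! l) = {}) \<and>
        finite (cone (w0 @ [a, b]) - (\<Union>v\<in>set vs. cone (w0 @ v)))) \<and>
     (if expanding then cone_types \<subseteq> cone_type ` set vs
      else length vs = 1 \<and> (\<forall>v\<in>set vs. length v = 3))"

definition is_initial_covering :: "'a list list \<Rightarrow> bool" where
  "is_initial_covering rs \<longleftrightarrow>
     (\<forall>r\<in>set rs. r \<in> language \<and> length r \<ge> 2) \<and>
     (\<forall>k<length rs. \<forall>l<length rs. k \<noteq> l \<longrightarrow> cone (rs ! k) \<inter> cone (rs ! l) = {}) \<and>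
     finite (language - (\<Union>r\<in>set rs. cone r)) \<and>
     (expanding \<longrightarrow> cone_types \<subseteq> cone_type ` set rs)"


subsection \<open>Staying in and entering cones\<close>

definition \<xi> :: "'a list \<Rightarrow> real" where
  "\<xi> ab = \<P>(\<omega> in P ab. \<forall>n. length (X n \<omega>) \<ge> 2)"

text \<open>The summation index is shifted by one: the paths have length \<open>Suc n\<close>.\<close>

definition \<LL> :: "'a list \<Rightarrow> 'a list \<Rightarrow> real" where
  "\<LL> x y = (\<Sum>n. \<P>(\<omega> in P x.
      X (Suc n) \<omega> = y \<and> X n \<omega> \<notin> cone y \<and> (\<forall>m\<le>Suc n. X m \<omega> \<in> cone x)))"

end


section \<open>Coverings and the last entry process\<close>

type_synonym 'a cone_label = "'a list set \<times> 'a list set \<times> nat"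

text \<open>
  \<open>cov i\<close> lists the words \<open>v\<^sub>1, \<dots>, v\<^sub>k\<close> of the covering of a cone of type \<open>i\<close>, and \<open>C0\<close> lists
  roots of the cones covering the language.
\<close>

locale covered_walk = regular_language_walk K P X
  for K :: "'a::finite list \<Rightarrow> 'a list pmf"
    and P :: "'a list \<Rightarrow> 'w measure"
    and X :: "nat \<Rightarrow> 'w \<Rightarrow> 'a list" +
  fixes cov :: "'a list set \<Rightarrow> 'a list list"
    and C0 :: "'a list list"
  assumes covering: "i \<in> cone_types \<Longrightarrow> is_covering i (cov i)"
    and initial_covering: "is_initial_covering C0"
begin

text \<open>
  The subcones of type \<open>j\<close> in the covering of a cone of type \<open>i\<close> are enumerated in the order in
  which they occur in the (arbitrary) list \<open>cov i\<close>.  The label \<open>j\<^bsub>i,n\<^esub>\<close> is encoded as \<open>(j, i, n)\<close>,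
  with \<open>n\<close> counted from 1, and \<open>subcone_root w j n\<close> is a root of the subcone of \<open>C(w)\<close> labelled
  \<open>(j, \<tau>(C(w)), n)\<close>.
\<close>

definition subcones :: "'a list set \<Rightarrow> 'a list set \<Rightarrow> 'a list list" where
  "subcones i j = filter (\<lambda>v. cone_type v = j) (cov i)"

definition num_subcones :: "'a list set \<Rightarrow> 'a list set \<Rightarrow> nat" where
  "num_subcones i j = length (subcones i j)"

definition subcone_root :: "'a list \<Rightarrow> 'a list set \<Rightarrow> nat \<Rightarrow> 'a list" where
  "subcone_root w j n = stem w @ subcones (cone_type w) j ! (n - 1)"

definition \<S> :: "'a list \<Rightarrow> 'a list set" where
  "\<S> w = (\<Union>v\<in>set (cov (cone_type w)). boundary (stem w @ v))"

text \<open>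
  For a transient walk the sets below are almost surely nonempty, so the convention
  \<open>Inf {} = 0\<close> on the natural numbers only matters on a null set.
\<close>

primrec last_entry :: "nat \<Rightarrow> 'w \<Rightarrow> nat" where
  "last_entry 0 \<omega> = Inf {m. \<exists>r\<in>set C0. \<forall>n\<ge>m. X n \<omega> \<in> cone r}"
| "last_entry (Suc k) \<omega> =
     (let w = X (last_entry k \<omega>) \<omega> in
      Inf {m. m > last_entry k \<omega> \<and>
              (\<exists>v\<in>set (cov (cone_type w)). \<forall>n\<ge>m. X n \<omega> \<in> cone (stem w @ v))})"

primrec W :: "nat \<Rightarrow> 'w \<Rightarrow> 'a list" where
  "W 0 \<omega> = X (last_entry 0 \<omega>) \<omega>"
| "W (Suc k) \<omega> =
     drop (length (X (last_entry k \<omega>) \<omega>) - 2) (X (last_entry (Suc k) \<omega>) \<omega>)"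

definition W_values :: "'a list set" where
  "W_values = {x. \<P>(\<omega> in P []. W 1 \<omega> = x) > 0}"

definition q :: "'a list \<Rightarrow> 'a list \<Rightarrow> real" where
  "q x y = (if y \<in> \<S> (suffix2 x)
            then \<xi> (suffix2 y) / \<xi> (suffix2 x) * \<LL> (suffix2 x) y else 0)"


subsection \<open>The hidden Markov chain\<close>

definition hidden_states :: "('a cone_label \<times> 'a list) set" where
  "hidden_states = {((j, m, n), x) | j m n x.
     x \<in> W_values \<and> cone_type (suffix2 x) = j \<and> n \<in> {1..num_subcones m j} \<and>
     (\<exists>w0\<in>language. \<P>(\<omega> in P []. W 0 \<omega> = w0 \<and> W 1 \<omega> = x) > 0 \<and>
        cone_type (suffix2 w0) = m \<and> x \<in> boundary (subcone_root (suffix2 w0) j n))}"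

fun hidden_trans :: "'a cone_label \<times> 'a list \<Rightarrow> 'a cone_label \<times> 'a list \<Rightarrow> real" where
  "hidden_trans ((i, m, n), w1) ((j, s, t), w2) = (if s = i then q w1 w2 else 0)"

definition hidden_invariant :: "('a cone_label \<times> 'a list) pmf \<Rightarrow> bool" where
  "hidden_invariant \<nu> \<longleftrightarrow>
     set_pmf \<nu> \<subseteq> hidden_states \<and>
     (\<forall>z\<in>hidden_states. pmf \<nu> z = (\<Sum>z'\<in>hidden_states. pmf \<nu> z' * hidden_trans z' z))"

definition \<nu>_mass :: "('a cone_label \<times> 'a list) pmf \<Rightarrow> 'a list \<Rightarrow> real" where
  "\<nu>_mass \<nu> ab = (\<Sum>z\<in>{z \<in> hidden_states. suffix2 (snd z) = ab}. pmf \<nu> z)"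


subsection \<open>Path weights\<close>

text \<open>
  The list \<open>xs\<close> stands for \<open>x\<^sub>2, \<dots>, x\<^sub>n\<close>, so that \<open>n = length xs + 1\<close> and \<open>x\<^sub>i = xs ! (i - 2)\<close>.
\<close>

definition path_weight :: "'a list \<Rightarrow> 'a list list \<Rightarrow> real" where
  "path_weight ab xs =
     \<P>(\<omega> in P []. (\<forall>i\<in>{2..length xs + 1}. W i \<omega> = xs ! (i - 2)) \<and>
                    suffix2 (W (length xs + 1) \<omega>) = ab
        \<bar> suffix2 (W 1 \<omega>) = ab)"

definition path_weight_tilde :: "'a list \<Rightarrow> 'a list list \<Rightarrow> real" where
  "path_weight_tilde ab xs =
     (\<Sum>ys\<in>{ys. length ys = length xs \<and> set ys \<subseteq> W_values \<and>
                 (\<forall>i<length xs. ys ! i \<in> boundary (xs ! i))}. path_weight ab ys)"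

definition first_return_paths :: "'a list \<Rightarrow> nat \<Rightarrow> 'a list list set" where
  "first_return_paths ab n =
     {xs. length xs = n - 1 \<and> set xs \<subseteq> W_values \<and>
          (\<forall>x\<in>set (butlast xs). suffix2 x \<noteq> ab) \<and> suffix2 (last xs) = ab}"

end

text \<open>
  The observed process of a path \<open>Z\<close> of labelled words: if \<open>Z k\<close> has label \<open>i\<^bsub>m,n\<^esub>\<close> and
  \<open>Z (k + 1)\<close> has label \<open>j\<^bsub>i,t\<^esub>\<close>, the value is \<open>(i, j\<^sub>t)\<close>, encoded as \<open>(i, (j, t))\<close>.
\<close>

definition hidden_Y ::
    "(nat \<Rightarrow> 'b \<Rightarrow> 'a cone_label \<times> 'a list) \<Rightarrow>
     nat \<Rightarrow> 'b \<Rightarrow> 'a list set \<times> ('a list set \<times> nat)" where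
  "hidden_Y Z k \<omega> =
     (case (Z k \<omega>, Z (Suc k) \<omega>) of
        (((i, m, n), w1), ((j, s, t), w2)) \<Rightarrow> (i, (j, t)))"

end

theory Submission
  imports Defs "HOL-Library.Discrete_Functions"
begin

text \<open>
  An unambiguous pair \<open>ab\<close> makes the hidden process regenerate: once the observed cone type is that
  of \<open>C(ab)\<close>, the hidden word must end in \<open>ab\<close>, and its future is independent of its past.  Hence
  between two visits to \<open>ab\<close> the probability of the observations is multiplied by the weight \<open>w~\<close> of
  the block.  The increments of minus its logarithm are bounded, because the positivity of a
  transition depends on the type only; a corrector with values in a bounded set turns the centred
  increments into orthogonal bounded variables, for which a strong law holds.  The limit is the
  expected information of a block divided by its expected length, and by Kac's formula the latter is
  \<open>1 / \<nu>\<^sub>a\<^sub>b\<close>.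

  That the values of the last entry process form a Markov chain with transition probabilities \<open>q\<close>
  comes from splitting the trajectory at the last entry times: the events
  \<open>X\<^bsub>e\<^sub>0\<^esub> = x\<^sub>0, \<dots>, X\<^bsub>e\<^sub>n\<^esub> = x\<^sub>n\<close> say that the cones are entered at some times and that the last
  one is never left, and the sum over these times is a product of the \<open>\<LL>\<close> with a final \<open>\<xi>\<close>.
\<close>

text \<open>Two points shape the argument. The entropy limit runs over deterministic times, which
  cut through a block, so a law of large numbers for whole blocks would leave a random number of
  blocks and an unfinished one to control. Corrected increments per step handle both at once: the
  corrector is the expected information still to come in the current block minus the rate times the
  expected time still to come.

  The second point is the state space. A label is determined by the type of the preceding word and
  by the word that carries it, so the words alone form a Markov chain, and equality of observations
  means equality of the first type and of all later cones. The chain is restricted to the words in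
  the support of \<nu>: this set is closed under possible transitions, all its words have positive
  mass, and the type of \<open>[a, b]\<close> is reached from each of them. That last fact is
  immediate for an expanding walk and needs the geometry of nested cones otherwise.\<close>

lemma floor_sqrt_at_top: "filterlim floor_sqrt at_top at_top"
  unfolding filterlim_at_top
proof
  fix Z
  have "Z \<le> floor_sqrt m" if "Z\<^sup>2 \<le> m" for m
    using that by (metis floor_sqrt_inverse_power2 mono_floor_sqrt')
  then show "eventually (\<lambda>m. Z \<le> floor_sqrt m) at_top"
    by (meson eventually_at_top_linorder)
qed

section \<open>A strong law for bounded orthogonal variables\<close>

context prob_space
begin

text \<open>Orthogonality removes the cross terms, so the second moment grows linearly in
  \<open>n\<close> and not quadratically.\<close>

lemma orthogonal_sum_second_moment:
  fixes D :: "nat \<Rightarrow> 'a \<Rightarrow> real"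
  assumes [measurable]: "\<And>k. D k \<in> borel_measurable M"
    and bound: "\<And>k. AE \<omega> in M. \<bar>D k \<omega>\<bar> \<le> C"
    and orth: "\<And>j k. j < k \<Longrightarrow> expectation (\<lambda>\<omega>. D j \<omega> * D k \<omega>) = 0"
  shows "integrable M (\<lambda>\<omega>. (\<Sum>k<n. D k \<omega>)\<^sup>2)"
    and "expectation (\<lambda>\<omega>. (\<Sum>k<n. D k \<omega>)\<^sup>2) \<le> real n * C\<^sup>2"
proof -
  have int: "integrable M (\<lambda>\<omega>. D j \<omega> * D k \<omega>)" for j k
  proof (rule integrable_const_bound[where B = "C * C"])
    show "AE \<omega> in M. norm (D j \<omega> * D k \<omega>) \<le> C * C"
      using bound[of j] bound[of k]
    proof eventually_elim
      case (elim \<omega>)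
      then have "\<bar>D j \<omega>\<bar> * \<bar>D k \<omega>\<bar> \<le> C * C" by (intro mult_mono) auto
      then show ?case by (simp add: abs_mult)
    qed
  qed simp
  have sq: "(\<Sum>k<Suc n. D k \<omega>)\<^sup>2 = (\<Sum>k<n. D k \<omega>)\<^sup>2 + (\<Sum>j<n. 2 * (D j \<omega> * D n \<omega>)) + D n \<omega> * D n \<omega>" for n \<omega>
    by (simp add: power2_eq_square algebra_simps sum_distrib_left sum_distrib_right)
  have "integrable M (\<lambda>\<omega>. (\<Sum>k<n. D k \<omega>)\<^sup>2) \<and>
     expectation (\<lambda>\<omega>. (\<Sum>k<n. D k \<omega>)\<^sup>2) \<le> real n * C\<^sup>2"
  proof (induction n)
    case (Suc n)
    have 1: "expectation (\<lambda>\<omega>. D n \<omega> * D n \<omega>) \<le> C\<^sup>2"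
    proof -
      have "expectation (\<lambda>\<omega>. D n \<omega> * D n \<omega>) \<le> expectation (\<lambda>\<omega>. C\<^sup>2)"
      proof (rule integral_mono_AE)
        show "AE \<omega> in M. D n \<omega> * D n \<omega> \<le> C\<^sup>2"
          using bound[of n]
          by eventually_elim (metis abs_ge_zero abs_mult_self_eq power2_eq_square power_mono)
      qed (use int in auto)
      then show ?thesis by (simp add: prob_space)
    qed
    have "expectation (\<lambda>\<omega>. (\<Sum>k<Suc n. D k \<omega>)\<^sup>2) = expectation (\<lambda>\<omega>. (\<Sum>k<n. D k \<omega>)\<^sup>2)
        + (\<Sum>j<n. 2 * expectation (\<lambda>\<omega>. D j \<omega> * D n \<omega>)) + expectation (\<lambda>\<omega>. D n \<omega> * D n \<omega>)"
      unfolding sq using Suc int by (simp add: Bochner_Integration.integral_sum)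
    also have "\<dots> \<le> real (Suc n) * C\<^sup>2"
      using Suc 1 orth by (simp add: algebra_simps)
    finally show ?case
      unfolding sq using Suc int by simp
  qed simp
  then show "integrable M (\<lambda>\<omega>. (\<Sum>k<n. D k \<omega>)\<^sup>2)"
    and "expectation (\<lambda>\<omega>. (\<Sum>k<n. D k \<omega>)\<^sup>2) \<le> real n * C\<^sup>2" by auto
qed

text \<open>Along the squares the second moments of the averages are summable, which gives almost
  sure convergence there. Boundedness of the variables then fills the gaps between consecutive
  squares.\<close>

lemma orthogonal_bounded_strong_law:
  fixes D :: "nat \<Rightarrow> 'a \<Rightarrow> real"
  assumes meas[measurable]: "\<And>k. D k \<in> borel_measurable M"
    and bound: "\<And>k. AE \<omega> in M. \<bar>D k \<omega>\<bar> \<le> C"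
    and orth: "\<And>j k. j < k \<Longrightarrow> expectation (\<lambda>\<omega>. D j \<omega> * D k \<omega>) = 0"
  shows "AE \<omega> in M. (\<lambda>n. (\<Sum>k<n. D k \<omega>) / real n) \<longlonglongrightarrow> 0"
proof -
  \<comment> \<open>The squared average at the time \<open>(Suc n)\<^sup>2\<close>; the shift avoids
    a division by 0.\<close>
  define T where "T n \<omega> = ((\<Sum>k<(Suc n)\<^sup>2. D k \<omega>) / real ((Suc n)\<^sup>2))\<^sup>2" for n \<omega>
  have [measurable]: "T n \<in> borel_measurable M" for n unfolding T_def by measurable
  have T_int: "(\<integral>\<^sup>+\<omega>. ennreal (T n \<omega>) \<partial>M) \<le> ennreal (C\<^sup>2 * (1 / real ((Suc n)\<^sup>2)))" for n
  proof -
    note * = orthogonal_sum_second_moment[where n = "(Suc n)\<^sup>2", OF meas bound orth]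
    have T: "T n \<omega> = (\<Sum>k<(Suc n)\<^sup>2. D k \<omega>)\<^sup>2 / (real ((Suc n)\<^sup>2))\<^sup>2" for \<omega>
      by (simp add: T_def power_divide)
    have pos: "0 \<le> T n \<omega>" for \<omega> by (simp add: T_def)
    have "integrable M (\<lambda>\<omega>. T n \<omega>)"
      unfolding T by (intro integrable_divide *(1))
    then have "(\<integral>\<^sup>+\<omega>. ennreal (T n \<omega>) \<partial>M) = ennreal (expectation (T n))"
      by (intro nn_integral_eq_integral) (simp_all add: pos)
    also have "expectation (T n) = expectation (\<lambda>\<omega>. (\<Sum>k<(Suc n)\<^sup>2. D k \<omega>)\<^sup>2) / (real ((Suc n)\<^sup>2))\<^sup>2"
      unfolding T by simp
    also have "\<dots> \<le> (real ((Suc n)\<^sup>2) * C\<^sup>2) / (real ((Suc n)\<^sup>2))\<^sup>2"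
      by (intro divide_right_mono *(2) zero_le_power2)
    also have "\<dots> = C\<^sup>2 * (1 / real ((Suc n)\<^sup>2))"
      by (simp add: power2_eq_square)
    finally show ?thesis by (simp add: ennreal_leI)
  qed
  have sm: "summable (\<lambda>n. C\<^sup>2 * (1 / real ((Suc n)\<^sup>2)))"
    by (intro summable_mult) (use inverse_squares_sums in \<open>simp add: sums_iff add_ac\<close>)
  have "(\<integral>\<^sup>+\<omega>. (\<Sum>n. ennreal (T n \<omega>)) \<partial>M) = (\<Sum>n. \<integral>\<^sup>+\<omega>. ennreal (T n \<omega>) \<partial>M)"
    by (intro nn_integral_suminf) simp
  also have "\<dots> \<le> (\<Sum>n. ennreal (C\<^sup>2 * (1 / real ((Suc n)\<^sup>2))))"
    by (intro suminf_le T_int) auto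
  also have "\<dots> = ennreal (\<Sum>n. C\<^sup>2 * (1 / real ((Suc n)\<^sup>2)))"
    by (intro suminf_ennreal2 sm) simp
  finally have "(\<integral>\<^sup>+\<omega>. (\<Sum>n. ennreal (T n \<omega>)) \<partial>M) \<noteq> \<infinity>"
    by (auto simp: top_unique)
  then have fin: "AE \<omega> in M. (\<Sum>n. ennreal (T n \<omega>)) \<noteq> \<infinity>"
    by (intro nn_integral_PInf_AE) auto
  have bound': "AE \<omega> in M. \<forall>k. \<bar>D k \<omega>\<bar> \<le> C"
    using bound by (simp add: AE_all_countable)
  show ?thesis
    using fin bound'
  proof eventually_elim
    case (elim \<omega>)
    define S where "S n = (\<Sum>k<n. D k \<omega>)" for n
    have "summable (\<lambda>n. T n \<omega>)"
      using elim(1) by (intro summable_suminf_not_top) (auto simp: T_def)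
    then have "(\<lambda>n. T n \<omega>) \<longlonglongrightarrow> 0" by (rule summable_LIMSEQ_zero)
    then have "(\<lambda>n. sqrt (T n \<omega>)) \<longlonglongrightarrow> sqrt 0" by (rule tendsto_real_sqrt)
    then have "(\<lambda>n. \<bar>S ((Suc n)\<^sup>2)\<bar> / real ((Suc n)\<^sup>2)) \<longlonglongrightarrow> 0"
      by (simp add: T_def S_def)
    then have sub: "(\<lambda>n. \<bar>S (n\<^sup>2)\<bar> / real (n\<^sup>2)) \<longlonglongrightarrow> 0"
      by (subst (asm) filterlim_sequentially_Suc)
    have lim: "(\<lambda>n. \<bar>S (n\<^sup>2)\<bar> / real (n\<^sup>2) + 2 * C / real n) \<longlonglongrightarrow> 0"
      using tendsto_add[OF sub lim_const_over_n[of "2 * C"]] by simp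
    have C0: "C \<ge> 0" using elim(2)[rule_format, of 0] by linarith
    \<comment> \<open>From the largest square below \<open>m\<close> up to \<open>m\<close> there
      are at most \<open>2 * floor_sqrt m\<close> further terms, each bounded by
      \<open>C\<close>.\<close>
    have est: "norm (S m / real m) \<le> \<bar>S ((floor_sqrt m)\<^sup>2)\<bar> / real ((floor_sqrt m)\<^sup>2) + 2 * C / real (floor_sqrt m)"
      if "m > 0" for m
    proof -
      define r where "r = floor_sqrt m"
      have r: "r\<^sup>2 \<le> m" "m < (Suc r)\<^sup>2" "r > 0"
        using that by (auto simp: r_def Suc_floor_sqrt_power2_gt)
      have "S m = S (r\<^sup>2) + (\<Sum>k\<in>{r\<^sup>2..<m}. D k \<omega>)"
        unfolding S_def using r(1)
        by (simp add: lessThan_atLeast0 sum.atLeastLessThan_concat)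
      moreover have "\<bar>\<Sum>k\<in>{r\<^sup>2..<m}. D k \<omega>\<bar> \<le> (\<Sum>k\<in>{r\<^sup>2..<m}. C)"
        by (rule order_trans[OF sum_abs sum_mono]) (use elim(2) in auto)
      moreover have "real (m - r\<^sup>2) \<le> 2 * real r"
      proof -
        have "m - r\<^sup>2 \<le> 2 * r" using r(2) by (auto simp: power2_eq_square)
        then show ?thesis by linarith
      qed
      ultimately have "\<bar>S m\<bar> \<le> \<bar>S (r\<^sup>2)\<bar> + 2 * real r * C"
        using C0 mult_right_mono[of "real (m - r\<^sup>2)" "2 * real r" C] by simp
      then have "\<bar>S m\<bar> / real m \<le> (\<bar>S (r\<^sup>2)\<bar> + 2 * real r * C) / real m"
        by (intro divide_right_mono) auto
      also have "\<dots> \<le> (\<bar>S (r\<^sup>2)\<bar> + 2 * real r * C) / real (r\<^sup>2)"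
        using r C0 by (intro divide_left_mono mult_pos_pos) (auto simp: that)
      also have "\<dots> = \<bar>S (r\<^sup>2)\<bar> / real (r\<^sup>2) + 2 * C / real r"
        using r(3) by (simp add: add_divide_distrib power2_eq_square)
      finally show ?thesis by (simp add: r_def abs_divide)
    qed
    have "(\<lambda>m. S m / real m) \<longlonglongrightarrow> 0"
    proof (rule Lim_null_comparison)
      show "\<forall>\<^sub>F m in sequentially. norm (S m / real m) \<le>
          \<bar>S ((floor_sqrt m)\<^sup>2)\<bar> / real ((floor_sqrt m)\<^sup>2) + 2 * C / real (floor_sqrt m)"
        using est by (auto intro: eventually_mono[OF eventually_gt_at_top[of 0]])
      show "(\<lambda>m. \<bar>S ((floor_sqrt m)\<^sup>2)\<bar> / real ((floor_sqrt m)\<^sup>2) + 2 * C / real (floor_sqrt m)) \<longlonglongrightarrow> 0"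
        by (rule filterlim_compose[OF lim floor_sqrt_at_top])
    qed
    then show ?case by (simp add: S_def)
  qed
qed

end

lemma measurable_map_upt:
  fixes V :: "nat \<Rightarrow> 'w \<Rightarrow> 's::countable"
  assumes [measurable]: "\<And>i. V i \<in> M \<rightarrow>\<^sub>M count_space UNIV"
  shows "(\<lambda>\<omega>. map (\<lambda>i. V i \<omega>) [0..<k]) \<in> M \<rightarrow>\<^sub>M count_space UNIV"
proof -
  have "{\<omega> \<in> space M. map (\<lambda>i. V i \<omega>) [0..<k] = l} \<in> sets M" for l
  proof -
    have "{\<omega> \<in> space M. map (\<lambda>i. V i \<omega>) [0..<k] = l} =
        {\<omega> \<in> space M. length l = k \<and> (\<forall>i<k. V i \<omega> = l ! i)}"
      by (auto simp: list_eq_iff_nth_eq)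
    then show ?thesis by simp
  qed
  then show ?thesis
    by (subst measurable_count_space_eq2_countable) (auto simp: vimage_def Int_def conj_commute)
qed

section \<open>Finite chains with an observable regeneration class\<close>

primrec path_prod :: "('s \<Rightarrow> 's \<Rightarrow> real) \<Rightarrow> 's \<Rightarrow> 's list \<Rightarrow> real" where
  "path_prod q x [] = 1"
| "path_prod q x (y # ys) = q x y * path_prod q y ys"

lemma path_prod_append:
  "path_prod q x (ys @ zs) = path_prod q x ys * path_prod q (last (x # ys)) zs"
  by (induction ys arbitrary: x) auto

lemma path_prod_eq_prod:
  "path_prod q x xs = (\<Prod>i<length xs. q ((x # xs) ! i) ((x # xs) ! Suc i))"
  by (induction xs arbitrary: x) (simp_all add: prod.lessThan_Suc_shift del: prod.lessThan_Suc)

text \<open>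
  \<open>A\<close> is a regeneration class: it is recognised from the type \<open>\<tau>\<close>, which is part of the
  observation \<open>\<kappa>\<close>, and all its states have the transition probabilities of \<open>c\<close>, which need not
  itself be a state of the chain.
\<close>

locale regenerative_chain = prob_space N
  for N :: "'w measure" +
  fixes S A :: "'s::countable set" and V :: "nat \<Rightarrow> 'w \<Rightarrow> 's" and \<mu> :: "'s \<Rightarrow> real"
    and q :: "'s \<Rightarrow> 's \<Rightarrow> real" and \<kappa> :: "'s \<Rightarrow> 'l" and \<tau> :: "'s \<Rightarrow> 't" and t0 :: 't and c :: 's
  assumes finite_S: "finite S"
    and V_meas[measurable]: "\<And>n. V n \<in> N \<rightarrow>\<^sub>M count_space UNIV"
    and V_in_S: "\<And>n. AE \<omega> in N. V n \<omega> \<in> S"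
    and cylinder: "\<And>n x. (\<forall>i\<le>n. x i \<in> S) \<Longrightarrow>
      \<P>(\<omega> in N. \<forall>i\<le>n. V i \<omega> = x i) = \<mu> (x 0) * (\<Prod>i<n. q (x i) (x (Suc i)))"
    and \<mu>_pos: "\<And>x. x \<in> S \<Longrightarrow> \<mu> x > 0"
    and q_nonneg: "\<And>x y. q x y \<ge> 0"
    and invariant: "\<And>y. y \<in> S \<Longrightarrow> (\<Sum>x\<in>S. \<mu> x * q x y) = \<mu> y"
    and A_def: "A = {x \<in> S. \<tau> x = t0}"
    and \<kappa>_\<tau>: "\<And>x y. x \<in> S \<Longrightarrow> y \<in> S \<Longrightarrow> \<kappa> x = \<kappa> y \<Longrightarrow> \<tau> x = \<tau> y"
    and q_pos_type: "\<And>x y z. x \<in> S \<Longrightarrow> y \<in> S \<Longrightarrow> z \<in> S \<Longrightarrow> \<tau> x = \<tau> y \<Longrightarrow> q x z > 0 \<Longrightarrow> q y z > 0"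
    and regeneration: "\<And>x y. x \<in> A \<Longrightarrow> y \<in> S \<Longrightarrow> q x y = q c y"
    and reach: "\<And>x. x \<in> S \<Longrightarrow> \<exists>y\<in>A. (\<lambda>u v. u \<in> S \<and> v \<in> S \<and> q u v > 0)\<^sup>+\<^sup>+ x y"
begin

abbreviation pw :: "'s \<Rightarrow> 's list \<Rightarrow> real" where "pw \<equiv> path_prod q"

definition state_lists :: "nat \<Rightarrow> 's list set" where "state_lists n = {l. set l \<subseteq> S \<and> length l = n}"

definition law :: "'s list \<Rightarrow> real" where
  "law l = (case l of [] \<Rightarrow> 1 | x # xs \<Rightarrow> \<mu> x * pw x xs)"

definition path :: "nat \<Rightarrow> 'w \<Rightarrow> 's list" where
  "path k \<omega> = map (\<lambda>i. V i \<omega>) [0..<k]"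

lemma path_meas[measurable]: "path k \<in> N \<rightarrow>\<^sub>M count_space UNIV"
  unfolding path_def by (rule measurable_map_upt) simp

lemma length_path[simp]: "length (path k \<omega>) = k" by (simp add: path_def)

lemma path_Suc: "path (Suc k) \<omega> = path k \<omega> @ [V k \<omega>]" by (simp add: path_def)

lemma take_path: "j \<le> k \<Longrightarrow> take j (path k \<omega>) = path j \<omega>"
  by (simp add: path_def take_map)

lemma finite_state_lists[simp]: "finite (state_lists n)" unfolding state_lists_def using finite_lists_length_eq[OF finite_S] .

lemma A_subset: "A \<subseteq> S" by (auto simp: A_def)

lemma finite_A[simp]: "finite A" using finite_subset[OF A_subset finite_S] .

lemma state_lists_Suc_snoc: "state_lists (Suc n) = (\<lambda>(l, x). l @ [x]) ` (state_lists n \<times> S)"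
proof -
  have "l \<in> (\<lambda>(l, x). l @ [x]) ` (state_lists n \<times> S)" if "l \<in> state_lists (Suc n)" for l
    using that by (cases l rule: rev_cases) (auto simp: state_lists_def)
  then show ?thesis by (auto simp: state_lists_def)
qed

lemma state_lists_0: "state_lists 0 = {[]}" by (auto simp: state_lists_def)

lemma sum_state_lists_Suc_snoc: "(\<Sum>l\<in>state_lists (Suc n). g l) = (\<Sum>l\<in>state_lists n. \<Sum>x\<in>S. g (l @ [x]))"
  unfolding state_lists_Suc_snoc
  by (subst sum.reindex) (auto simp: inj_on_def sum.cartesian_product split_beta)

lemma pw_nonneg: "pw x xs \<ge> 0"
  by (induction xs arbitrary: x) (auto simp: q_nonneg)

lemma pw_snoc: "pw x (xs @ [y]) = pw x xs * q (last (x # xs)) y"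
  by (simp add: path_prod_append)

lemma law_snoc: "l \<noteq> [] \<Longrightarrow> law (l @ [y]) = law l * q (last l) y"
  by (cases l) (auto simp: law_def path_prod_append)

lemma prob_path: "l \<in> state_lists n \<Longrightarrow> prob {\<omega> \<in> space N. path n \<omega> = l} = law l"
proof (cases l)
  case Nil
  then show "l \<in> state_lists n \<Longrightarrow> ?thesis" by (auto simp: state_lists_def law_def path_def prob_space)
next
  case (Cons x xs)
  assume l: "l \<in> state_lists n"
  have "{\<omega> \<in> space N. path n \<omega> = l} = {\<omega> \<in> space N. \<forall>i\<le>length xs. V i \<omega> = l ! i}"
    using l Cons by (auto simp: list_eq_iff_nth_eq path_def state_lists_def less_Suc_eq_le)
  moreover have "prob \<dots> = \<mu> (l ! 0) * (\<Prod>i<length xs. q (l ! i) (l ! Suc i))"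
  proof (intro cylinder allI impI)
    fix i assume "i \<le> length xs"
    then have "l ! i \<in> set l" using Cons by (intro nth_mem) simp
    then show "l ! i \<in> S" using l by (auto simp: state_lists_def)
  qed
  ultimately show ?thesis
    using Cons by (simp add: law_def path_prod_eq_prod)
qed

lemma law_nonneg: "l \<in> state_lists n \<Longrightarrow> law l \<ge> 0"
  using prob_path[of l n, symmetric] by simp

lemma path_in_state_lists: "AE \<omega> in N. path n \<omega> \<in> state_lists n"
proof -
  have "AE \<omega> in N. \<forall>n. V n \<omega> \<in> S" using V_in_S by (simp add: AE_all_countable)
  then show ?thesis by eventually_elim (auto simp: state_lists_def path_def)
qed

text \<open>Up to a null set the path takes finitely many values. Every later expectation is
  computed through this finite sum, which takes the place of conditional expectations.\<close>

lemma expectation_path: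
  fixes g :: "'s list \<Rightarrow> real"
  shows "integrable N (\<lambda>\<omega>. g (path n \<omega>))"
    and "expectation (\<lambda>\<omega>. g (path n \<omega>)) = (\<Sum>l\<in>state_lists n. law l * g l)"
proof -
  define k where "k \<omega> = (\<Sum>l\<in>state_lists n. g l * indicator {\<omega> \<in> space N. path n \<omega> = l} \<omega>)" for \<omega>
  have ae: "AE \<omega> in N. g (path n \<omega>) = k \<omega>"
    using path_in_state_lists[of n] AE_space
  proof eventually_elim
    case (elim \<omega>)
    have "k \<omega> = (\<Sum>l\<in>state_lists n. if l = path n \<omega> then g l else 0)"
      unfolding k_def using elim by (intro sum.cong) auto
    then show ?case using elim by simp
  qed
  have int: "integrable N k" unfolding k_def
    by (intro Bochner_Integration.integrable_sum integrable_mult_right integrable_real_indicator)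
      (auto simp: emeasure_eq_measure)
  have "expectation k = (\<Sum>l\<in>state_lists n. g l * prob {\<omega> \<in> space N. path n \<omega> = l})"
    unfolding k_def
    by (subst Bochner_Integration.integral_sum)
      (auto intro!: integrable_real_indicator simp: emeasure_eq_measure)
  also have "\<dots> = (\<Sum>l\<in>state_lists n. law l * g l)" by (intro sum.cong) (auto simp: prob_path)
  finally have k: "expectation k = (\<Sum>l\<in>state_lists n. law l * g l)" .
  show "integrable N (\<lambda>\<omega>. g (path n \<omega>))"
    by (rule integrable_cong_AE_imp[OF int]) (use ae in auto)
  show "expectation (\<lambda>\<omega>. g (path n \<omega>)) = (\<Sum>l\<in>state_lists n. law l * g l)"
    unfolding k[symmetric] by (rule integral_cong_AE) (use ae int in \<open>auto simp: k_def\<close>)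
qed

lemma sum_law: "(\<Sum>l\<in>state_lists n. law l) = 1"
  using expectation_path(2)[of "\<lambda>_. 1" n] by (simp add: prob_space)

lemma sum_\<mu>: "(\<Sum>x\<in>S. \<mu> x) = 1"
  using sum_law[of 1] sum_state_lists_Suc_snoc[of law 0] by (simp add: state_lists_0 law_def)

text \<open>Stochasticity is extracted from the cylinder probabilities: the law of the first state
  is computed once from paths of length 1 and once from paths of length 2, and
  \<open>\<mu> x > 0\<close> allows to divide.\<close>

lemma row_sum_S: assumes x: "x \<in> S" shows "(\<Sum>y\<in>S. q x y) = 1"
proof -
  have "expectation (\<lambda>\<omega>. of_bool (hd (path 1 \<omega>) = x) :: real) = expectation (\<lambda>\<omega>. of_bool (hd (path 2 \<omega>) = x))"
    by (simp add: path_def upt_rec)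
  then have "(\<Sum>l\<in>state_lists 1. law l * of_bool (hd l = x)) = (\<Sum>l\<in>state_lists 2. law l * of_bool (hd l = x))"
    by (simp only: expectation_path(2)[of "\<lambda>l. of_bool (hd l = x)"])
  moreover have "(\<Sum>l\<in>state_lists 1. law l * of_bool (hd l = x)) = \<mu> x"
  proof -
    have "(\<Sum>l\<in>state_lists 1. law l * of_bool (hd l = x)) = (\<Sum>z\<in>S. law [z] * of_bool (z = x))"
      unfolding One_nat_def sum_state_lists_Suc_snoc state_lists_0 by simp
    also have "\<dots> = (\<Sum>z\<in>S. if z = x then \<mu> z else 0)"
      by (intro sum.cong) (auto simp: law_def)
    finally show ?thesis using x finite_S by simp
  qed
  moreover have "(\<Sum>l\<in>state_lists 2. law l * of_bool (hd l = x)) = \<mu> x * (\<Sum>y\<in>S. q x y)"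
  proof -
    have "(\<Sum>l\<in>state_lists 2. law l * of_bool (hd l = x)) = (\<Sum>z\<in>S. (\<Sum>y\<in>S. \<mu> z * q z y * of_bool (z = x)))"
      unfolding numeral_2_eq_2 sum_state_lists_Suc_snoc state_lists_0 by (simp add: law_def)
    also have "\<dots> = (\<Sum>z\<in>S. if z = x then (\<Sum>y\<in>S. \<mu> z * q z y) else 0)"
      by (intro sum.cong) auto
    finally show ?thesis using x finite_S by (simp add: sum_distrib_left)
  qed
  ultimately show ?thesis using \<mu>_pos[OF x] by simp
qed

lemma A_nonempty: "A \<noteq> {}"
  using sum_\<mu> reach by (metis empty_iff ex_in_conv sum.empty zero_neq_one)

text \<open>For \<open>c\<close>, which may lie outside \<open>S\<close>, the row is borrowed from
  any state of \<open>A\<close>.\<close>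

lemma row_sum: assumes "x \<in> insert c S" shows "(\<Sum>y\<in>S. q x y) = 1"
proof -
  obtain a where "a \<in> A" using A_nonempty by blast
  then have "(\<Sum>y\<in>S. q c y) = 1"
    using row_sum_S[of a] regeneration[of a] A_subset by (auto cong: sum.cong)
  then show ?thesis using assms row_sum_S by auto
qed

lemma last_in: "set xs \<subseteq> S \<Longrightarrow> last (c # xs) \<in> insert c S"
  by (cases xs rule: rev_cases) auto

subsection \<open>Return times\<close>

text \<open>The probability that the next \<open>k\<close> states avoid \<open>A\<close>; the
  starting state itself is not tested.\<close>

primrec survival :: "nat \<Rightarrow> 's \<Rightarrow> real" where
  "survival 0 x = 1"
| "survival (Suc k) x = (\<Sum>y\<in>S - A. q x y * survival k y)"

lemma survival_nonneg: "survival k x \<ge> 0"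
  by (induction k arbitrary: x) (auto intro!: sum_nonneg mult_nonneg_nonneg q_nonneg)

lemma sum_split_A: "(\<Sum>y\<in>S. g y) = (\<Sum>y\<in>A. g y) + (\<Sum>y\<in>S - A. g y)"
  using sum.subset_diff[OF A_subset finite_S, of g] by (simp add: add.commute)

lemma survival_le_1: "x \<in> insert c S \<Longrightarrow> survival k x \<le> 1"
proof (induction k arbitrary: x)
  case (Suc k)
  have "survival (Suc k) x \<le> (\<Sum>y\<in>S - A. q x y * 1)"
    unfolding survival.simps by (intro sum_mono mult_left_mono Suc.IH q_nonneg) auto
  also have "\<dots> \<le> (\<Sum>y\<in>S. q x y)"
    using sum_split_A[of "q x"] by (simp add: sum_nonneg q_nonneg)
  finally show ?case using row_sum[OF Suc.prems] by simp
qed simp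

lemma survival_Suc_le: "x \<in> insert c S \<Longrightarrow> survival (Suc k) x \<le> survival k x"
proof (induction k arbitrary: x)
  case 0
  then show ?case using survival_le_1[of x 1] by simp
next
  case (Suc k)
  show ?case
    unfolding survival.simps(2)[of "Suc k"] survival.simps(2)[of k x]
    by (intro sum_mono mult_left_mono Suc.IH q_nonneg) auto
qed

lemma survival_antimono: "x \<in> insert c S \<Longrightarrow> j \<le> k \<Longrightarrow> survival k x \<le> survival j x"
  using lift_Suc_antimono_le[of "\<lambda>k. survival k x" j k] survival_Suc_le by blast

lemma survival_Suc_less_1:
  assumes x: "x \<in> S" and y: "y \<in> S" and q: "q x y > 0" and less: "y \<in> A \<or> survival k y < 1"
  shows "survival (Suc k) x < 1"
proof (cases "y \<in> A")
  case True
  have "0 < (\<Sum>z\<in>A. q x z)"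
    using True q by (intro sum_pos2[where i = y] q_nonneg) auto
  moreover have "survival (Suc k) x \<le> (\<Sum>z\<in>S - A. q x z * 1)"
    unfolding survival.simps by (intro sum_mono mult_left_mono survival_le_1 q_nonneg) auto
  ultimately show ?thesis using sum_split_A[of "q x"] row_sum_S[OF x] by simp
next
  case False
  have "survival (Suc k) x < (\<Sum>z\<in>S - A. q x z * 1)"
    unfolding survival.simps
  proof (rule sum_strict_mono_ex1)
    show "\<forall>z\<in>S - A. q x z * survival k z \<le> q x z * 1"
      by (auto intro!: mult_left_mono survival_le_1 q_nonneg simp del: mult_1_right)
    show "\<exists>z\<in>S - A. q x z * survival k z < q x z * 1"
      using False less y q by (intro bexI[of _ y]) auto
  qed (use finite_S in auto)
  also have "\<dots> \<le> 1"
    using sum_split_A[of "q x"] row_sum_S[OF x] sum_nonneg[of A "q x"] q_nonneg by simp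
  finally show ?thesis .
qed

text \<open>Backward induction along a path of positive probability into \<open>A\<close>: each step
  of the path costs one more unit of \<open>k\<close>.\<close>

lemma survival_eventually_less_1: assumes "x \<in> S" shows "\<exists>k. survival k x < 1"
proof -
  obtain y where y: "y \<in> A" "(\<lambda>u v. u \<in> S \<and> v \<in> S \<and> q u v > 0)\<^sup>+\<^sup>+ x y"
    using reach[OF assms] by blast
  from y(2) show ?thesis
  proof (induction rule: converse_tranclp_induct)
    case (base z)
    then show ?case using survival_Suc_less_1[of z y 0] y(1) by blast
  next
    case (step z w)
    then show ?case using survival_Suc_less_1[of z w] by blast
  qed
qed

text \<open>The Markov property after \<open>m\<close> steps, with a uniform bound on what
  follows.\<close>

lemma survival_add_le:
  assumes "\<And>y. y \<in> insert c S \<Longrightarrow> survival k y \<le> \<rho>" and "x \<in> insert c S"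
  shows "survival (m + k) x \<le> survival m x * \<rho>"
  using assms(2)
proof (induction m arbitrary: x)
  case (Suc m)
  have "survival (Suc m + k) x \<le> (\<Sum>y\<in>S - A. q x y * (survival m y * \<rho>))"
    unfolding add_Suc survival.simps by (intro sum_mono mult_left_mono Suc.IH q_nonneg) auto
  then show ?case by (simp add: sum_distrib_right mult.assoc)
qed (use assms in simp)

lemma survival_c: "a \<in> A \<Longrightarrow> survival k c = survival k a"
  by (cases k) (auto intro!: sum.cong simp: regeneration)

text \<open>By finiteness of \<open>S\<close> there is one horizon \<open>K\<close> within which
  every state hits \<open>A\<close> with probability bounded away from 0. Iterating over blocks of
  \<open>K\<close> steps gives geometric decay.\<close>

lemma survival_geometric:
  obtains B r where "0 < r" "r < 1" "\<And>k x. x \<in> insert c S \<Longrightarrow> survival k x \<le> B * r ^ k"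
proof -
  obtain f where f: "\<And>x. x \<in> S \<Longrightarrow> survival (f x) x < 1"
    using survival_eventually_less_1 by metis
  define K where "K = Suc (Max (f ` S))"
  have K: "survival K x < 1" if "x \<in> S" for x
  proof -
    have "f x \<le> K" using that finite_S by (simp add: K_def le_SucI)
    then show ?thesis using f[OF that] survival_antimono[of x "f x" K] that by simp
  qed
  \<comment> \<open>The maximum with \<open>1/2\<close> keeps \<rho> positive, so that its
    \<open>K\<close>-th root is positive and \<open>1 / \<rho>\<close> makes sense.\<close>
  define \<rho> where "\<rho> = max (1/2) (Max (survival K ` S))"
  have S: "S \<noteq> {}" using A_nonempty A_subset by auto
  have \<rho>: "0 < \<rho>" "\<rho> < 1" using S finite_S K by (auto simp: \<rho>_def)
  have le: "survival K x \<le> \<rho>" if "x \<in> insert c S" for x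
  proof -
    obtain a where a: "a \<in> A" using A_nonempty by blast
    have "survival K y \<le> \<rho>" if "y \<in> S" for y
      unfolding \<rho>_def using finite_S that by (intro max.coboundedI2 Max_ge) auto
    then show ?thesis using that survival_c[OF a, of K] a A_subset by auto
  qed
  have pow: "survival (K * n) x \<le> \<rho> ^ n" if "x \<in> insert c S" for n x
  proof (induction n)
    case (Suc n)
    have "survival (K * n + K) x \<le> survival (K * n) x * \<rho>" using le that by (rule survival_add_le)
    also have "\<dots> \<le> \<rho> ^ n * \<rho>" using Suc \<rho> by (intro mult_right_mono) auto
    finally show ?case by (simp add: add.commute mult.commute)
  qed simp
  \<comment> \<open>The \<open>K\<close>-th root spreads the factor per block over single steps;
    rounding \<open>k\<close> down to a multiple of \<open>K\<close> costs the constant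
    \<open>1 / \<rho>\<close>.\<close>
  define r where "r = \<rho> powr (1 / real K)"
  have Kpos: "K > 0" by (simp add: K_def)
  have r: "0 < r" "r < 1"
    using \<rho> Kpos powr_less_mono'[of \<rho> 0 "1 / real K"] by (auto simp: r_def)
  have "survival k x \<le> (1 / \<rho>) * r ^ k" if "x \<in> insert c S" for k x
  proof -
    have "survival k x \<le> survival (K * (k div K)) x" using that by (intro survival_antimono) auto
    also have "\<dots> \<le> \<rho> ^ (k div K)" by (rule pow[OF that])
    also have "\<dots> = \<rho> powr real (k div K)" using \<rho> by (simp add: powr_realpow)
    also have "\<dots> \<le> \<rho> powr (real k / real K - 1)"
    proof (rule powr_mono')
      have "k \<le> (k div K + 1) * K"
        using Kpos dividend_less_div_times[of K k] by simp
      then have "real k \<le> real ((k div K + 1) * K)" by (rule of_nat_mono)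
      then have "real k \<le> (real (k div K) + 1) * real K"
        by (simp add: algebra_simps)
      then show "real k / real K - 1 \<le> real (k div K)"
        using Kpos by (simp add: field_simps)
    qed (use \<rho> in auto)
    also have "\<dots> = (1 / \<rho>) * r ^ k"
      using \<rho> Kpos by (simp add: powr_diff r_def powr_powr flip: powr_realpow)
    finally show ?thesis .
  qed
  with r show ?thesis by (rule that)
qed

lemma summable_survival: assumes "x \<in> insert c S" shows "summable (\<lambda>k. survival k x)"
proof -
  obtain B r where r: "0 < r" "r < 1" "\<And>k x. x \<in> insert c S \<Longrightarrow> survival k x \<le> B * r ^ k"
    by (rule survival_geometric) blast
  show ?thesis
  proof (rule summable_comparison_test'[where g = "\<lambda>k. B * r ^ k" and N = 0])
    show "summable (\<lambda>k. B * r ^ k)" using r by (intro summable_mult) simp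
    show "norm (survival k x) \<le> B * r ^ k" for k using r(3)[OF assms, of k] survival_nonneg[of k x] by simp
  qed
qed

lemma n_survival_tendsto_0: assumes "x \<in> insert c S" shows "(\<lambda>k. real k * survival k x) \<longlonglongrightarrow> 0"
proof -
  obtain B r where r: "0 < r" "r < 1" "\<And>k x. x \<in> insert c S \<Longrightarrow> survival k x \<le> B * r ^ k"
    by (rule survival_geometric) blast
  have "(\<lambda>k. real k * r ^ k) \<longlonglongrightarrow> 0" using r by (intro powser_times_n_limit_0) auto
  then have "(\<lambda>k. B * (real k * r ^ k)) \<longlonglongrightarrow> B * 0" by (rule tendsto_mult_left)
  then have l: "(\<lambda>k. B * (real k * r ^ k)) \<longlonglongrightarrow> 0" by simp
  show ?thesis
  proof (rule Lim_null_comparison[OF _ l], rule always_eventually, rule allI)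
    fix k
    have "real k * survival k x \<le> real k * (B * r ^ k)"
      using r(3)[OF assms] by (intro mult_left_mono) auto
    then show "norm (real k * survival k x) \<le> B * (real k * r ^ k)"
      using survival_nonneg[of k x] by (simp add: algebra_simps)
  qed
qed

text \<open>The expected time of the next visit to \<open>A\<close>, written as the sum of its tail
  probabilities.\<close>

definition cycle_time :: "'s \<Rightarrow> real" where "cycle_time x = (\<Sum>k. survival k x)"

lemma cycle_time_eq: assumes "x \<in> insert c S" shows "cycle_time x = 1 + (\<Sum>y\<in>S - A. q x y * cycle_time y)"
proof -
  have "(\<Sum>k. survival (Suc k) x) = (\<Sum>y\<in>S - A. \<Sum>k. q x y * survival k y)"
    unfolding survival.simps by (intro suminf_sum summable_mult summable_survival) auto
  also have "\<dots> = (\<Sum>y\<in>S - A. q x y * cycle_time y)"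
    unfolding cycle_time_def by (intro sum.cong refl suminf_mult summable_survival) auto
  finally show ?thesis
    using suminf_split_head[OF summable_survival[OF assms]] by (simp add: cycle_time_def)
qed

lemma cycle_time_ge: "x \<in> insert c S \<Longrightarrow> (\<Sum>k<n. survival k x) \<le> cycle_time x"
  unfolding cycle_time_def by (intro sum_le_suminf summable_survival) (auto simp: survival_nonneg)

lemma cycle_time_ge_1: "x \<in> insert c S \<Longrightarrow> 1 \<le> cycle_time x"
  using cycle_time_ge[of x 1] by simp

text \<open>Integrate the first-step equation of \<open>cycle_time\<close> against \<mu>. By
  invariance the states outside \<open>A\<close> contribute the same finite amount on both sides,
  and what remains is the sum over \<open>A\<close>.\<close>

lemma kac: "(\<Sum>x\<in>A. \<mu> x) * cycle_time c = 1"
proof -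
  have "(\<Sum>x\<in>S. \<mu> x * cycle_time x) = (\<Sum>x\<in>S. \<mu> x + (\<Sum>y\<in>S - A. \<mu> x * q x y * cycle_time y))"
    by (intro sum.cong refl, subst cycle_time_eq) (simp_all add: algebra_simps sum_distrib_left)
  also have "\<dots> = 1 + (\<Sum>y\<in>S - A. \<Sum>x\<in>S. \<mu> x * q x y * cycle_time y)"
    unfolding sum.distrib sum_\<mu> by (subst sum.swap) (rule refl)
  also have "(\<Sum>y\<in>S - A. \<Sum>x\<in>S. \<mu> x * q x y * cycle_time y) = (\<Sum>y\<in>S - A. \<mu> y * cycle_time y)"
    by (intro sum.cong refl) (simp add: invariant flip: sum_distrib_right)
  finally have "(\<Sum>x\<in>A. \<mu> x * cycle_time x) = 1"
    using sum_split_A[of "\<lambda>x. \<mu> x * cycle_time x"] by simp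
  moreover have "(\<Sum>x\<in>A. \<mu> x * cycle_time x) = (\<Sum>x\<in>A. \<mu> x * cycle_time c)"
    by (intro sum.cong refl) (simp only: cycle_time_def survival_c)
  ultimately show ?thesis by (simp add: sum_distrib_right)
qed

subsection \<open>Weights of observed blocks\<close>

definition matches :: "'s list \<Rightarrow> 's list set" where
  "matches xs = {ys. set ys \<subseteq> S \<and> map \<kappa> ys = map \<kappa> xs}"

text \<open>The abstract form of the weight w~: the probability of seeing the observations of
  \<open>xs\<close> when starting from \<open>c\<close>.\<close>

definition block_weight :: "'s list \<Rightarrow> real" where "block_weight xs = (\<Sum>ys\<in>matches xs. pw c ys)"

definition info :: "'s list \<Rightarrow> real" where "info xs = - ln (block_weight xs)"

lemma matches_subset: "matches xs \<subseteq> state_lists (length xs)"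
  by (auto simp: matches_def state_lists_def dest: map_eq_imp_length_eq)

lemma finite_matches[simp]: "finite (matches xs)"
  using finite_subset[OF matches_subset] by simp

lemma matches_Nil[simp]: "matches [] = {[]}" by (auto simp: matches_def)

lemma matches_self: "set xs \<subseteq> S \<Longrightarrow> xs \<in> matches xs" by (simp add: matches_def)

lemma matches_append: "matches (xs @ zs) = (\<lambda>(a, b). a @ b) ` (matches xs \<times> matches zs)"
proof
  show "matches (xs @ zs) \<subseteq> (\<lambda>(a, b). a @ b) ` (matches xs \<times> matches zs)"
    by (fastforce simp: matches_def map_eq_append_conv)
  show "(\<lambda>(a, b). a @ b) ` (matches xs \<times> matches zs) \<subseteq> matches (xs @ zs)"
    by (auto simp: matches_def)
qed

lemma matches_length: "ys \<in> matches xs \<Longrightarrow> length ys = length xs"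
  by (auto simp: matches_def dest: map_eq_imp_length_eq)

lemma sum_matches_append: "(\<Sum>ys\<in>matches (xs @ zs). g ys) = (\<Sum>ys\<in>matches xs. \<Sum>us\<in>matches zs. g (ys @ us))"
proof -
  have "inj_on (\<lambda>(a, b). a @ b) (matches xs \<times> matches zs)"
    by (auto simp: inj_on_def dest!: matches_length)
  then show ?thesis
    unfolding matches_append by (subst sum.reindex) (auto simp: sum.cartesian_product split_beta)
qed

lemma matches_single: "matches [x] = (\<lambda>y. [y]) ` {y \<in> S. \<kappa> y = \<kappa> x}"
  by (auto simp: matches_def map_eq_Cons_conv)

lemma sum_matches_snoc:
  "(\<Sum>ys\<in>matches (xs @ [x]). g ys) = (\<Sum>ys\<in>matches xs. \<Sum>y\<in>{y \<in> S. \<kappa> y = \<kappa> x}. g (ys @ [y]))"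
  unfolding sum_matches_append matches_single by (subst sum.reindex) (auto simp: inj_on_def)

lemma block_weight_Nil[simp]: "block_weight [] = 1" by (simp add: block_weight_def)

lemma block_weight_ge_pw: "set xs \<subseteq> S \<Longrightarrow> pw c xs \<le> block_weight xs"
  unfolding block_weight_def using matches_self by (intro member_le_sum) (auto simp: pw_nonneg)

lemma block_weight_snoc:
  "block_weight (xs @ [x]) = (\<Sum>ys\<in>matches xs. pw c ys * (\<Sum>y\<in>{y \<in> S. \<kappa> y = \<kappa> x}. q (last (c # ys)) y))"
  unfolding block_weight_def sum_matches_snoc by (simp add: pw_snoc sum_distrib_left del: last.simps)

lemma block_weight_snoc_le: "block_weight (xs @ [x]) \<le> block_weight xs"
proof -
  have "(\<Sum>y\<in>{y \<in> S. \<kappa> y = \<kappa> x}. q (last (c # ys)) y) \<le> 1" if "ys \<in> matches xs" for ys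
  proof -
    have "last (c # ys) \<in> insert c S" using that by (intro last_in) (auto simp: matches_def)
    then have "(\<Sum>y\<in>S. q (last (c # ys)) y) = 1" by (rule row_sum)
    then show ?thesis
      using sum_mono2[OF finite_S, of "{y \<in> S. \<kappa> y = \<kappa> x}" "q (last (c # ys))"] q_nonneg
      by (simp del: last.simps)
  qed
  then show ?thesis
    unfolding block_weight_snoc block_weight_def[of xs] by (intro sum_mono mult_left_le) (auto simp: pw_nonneg)
qed

text \<open>The smallest positive transition probability. Inserting \<open>1\<close> makes the set
  nonempty and forces \<epsilon> \<le> 1, so that \<open>max_info\<close> is nonnegative.\<close>

definition \<epsilon> :: real where
  "\<epsilon> = Min (insert 1 {q x y | x y. x \<in> insert c S \<and> y \<in> S \<and> q x y > 0})"

lemma finite_positive_q: "finite {q x y | x y. x \<in> insert c S \<and> y \<in> S \<and> q x y > 0}"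
  by (rule finite_subset[of _ "(\<lambda>(x, y). q x y) ` (insert c S \<times> S)"]) (use finite_S in auto)

lemma \<epsilon>_pos: "0 < \<epsilon>"
  unfolding \<epsilon>_def using finite_positive_q by (subst Min_gr_iff) auto

lemma \<epsilon>_le: "x \<in> insert c S \<Longrightarrow> y \<in> S \<Longrightarrow> q x y > 0 \<Longrightarrow> \<epsilon> \<le> q x y"
  unfolding \<epsilon>_def using finite_positive_q by (intro Min_le) auto

definition max_info :: real where "max_info = - ln \<epsilon>"

text \<open>On these lists the block weight is positive, so \<open>info\<close> is a genuine
  logarithm there.\<close>

definition feasible :: "'s list \<Rightarrow> bool" where "feasible xs \<longleftrightarrow> set xs \<subseteq> S \<and> pw c xs > 0"

lemma feasible_Nil[simp]: "feasible []" by (simp add: feasible_def)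

lemma feasible_snocI: "feasible xs \<Longrightarrow> x \<in> S \<Longrightarrow> q (last (c # xs)) x > 0 \<Longrightarrow> feasible (xs @ [x])"
  by (simp add: feasible_def pw_snoc del: last.simps)

lemma feasible_snocD:
  assumes "feasible (xs @ [x])" shows "feasible xs" "x \<in> S" "q (last (c # xs)) x > 0"
  using assms pw_nonneg[of c xs] q_nonneg[of "last (c # xs)" x]
  by (auto simp: feasible_def pw_snoc zero_less_mult_iff simp del: last.simps)

lemma feasible_last: "feasible xs \<Longrightarrow> last (c # xs) \<in> insert c S"
  by (simp only: feasible_def last_in)

lemma block_weight_pos: "feasible xs \<Longrightarrow> block_weight xs > 0"
  using block_weight_ge_pw[of xs] by (auto simp: feasible_def)

text \<open>A list matching \<open>xs\<close> ends in a state of the same type as the last state of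
  \<open>xs\<close>, so by \<open>q_pos_type\<close> it can be continued by \<open>x\<close> as
  well, with probability at least \<epsilon>. Hence a single observation carries at most
  \<open>max_info\<close> of information, whatever the length of the block.\<close>

lemma block_weight_snoc_ge: assumes feasible: "feasible (xs @ [x])" shows "\<epsilon> * block_weight xs \<le> block_weight (xs @ [x])"
proof -
  have "pw c ys * \<epsilon> \<le> pw c ys * (\<Sum>y\<in>{y \<in> S. \<kappa> y = \<kappa> x}. q (last (c # ys)) y)" if mt: "ys \<in> matches xs" for ys
  proof (intro mult_left_mono pw_nonneg)
    note x = feasible_snocD[OF feasible]
    have ysS: "set ys \<subseteq> S" using that by (simp add: matches_def)
    have "q (last (c # ys)) x > 0"
    proof (cases xs rule: rev_cases)
      case Nil
      then show ?thesis using that x by simp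
    next
      case (snoc xs' y)
      then obtain ys' v where ys: "ys = ys' @ [v]" "v \<in> S" "\<kappa> v = \<kappa> y"
        using mt by (cases ys rule: rev_cases) (auto simp: matches_def)
      have "y \<in> S" using x snoc by (auto simp: feasible_def)
      then show ?thesis
        using q_pos_type[of y v x] \<kappa>_\<tau>[of y v] ys x snoc by simp
    qed
    then have "\<epsilon> \<le> q (last (c # ys)) x" using last_in[OF ysS] x by (intro \<epsilon>_le) auto
    also have "\<dots> \<le> (\<Sum>y\<in>{y \<in> S. \<kappa> y = \<kappa> x}. q (last (c # ys)) y)"
      using finite_S x by (intro member_le_sum) (auto simp: q_nonneg)
    finally show "\<epsilon> \<le> (\<Sum>y\<in>{y \<in> S. \<kappa> y = \<kappa> x}. q (last (c # ys)) y)" .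
  qed
  then show ?thesis
    unfolding block_weight_snoc block_weight_def[of xs] sum_distrib_left by (intro sum_mono) (simp add: mult.commute)
qed

lemma info_snoc:
  assumes feasible: "feasible (xs @ [x])"
  shows "info xs \<le> info (xs @ [x])" "info (xs @ [x]) \<le> info xs + max_info"
proof -
  have p: "block_weight xs > 0" "block_weight (xs @ [x]) > 0" using block_weight_pos[OF feasible] block_weight_pos[OF feasible_snocD(1)[OF feasible]] by auto
  show "info xs \<le> info (xs @ [x])" using block_weight_snoc_le[of xs x] p by (simp add: info_def)
  have "ln (\<epsilon> * block_weight xs) \<le> ln (block_weight (xs @ [x]))"
    using block_weight_snoc_ge[OF feasible] p \<epsilon>_pos by (subst ln_le_cancel_iff) auto
  then show "info (xs @ [x]) \<le> info xs + max_info" using p \<epsilon>_pos by (simp add: info_def max_info_def ln_mult)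
qed

lemma info_Nil[simp]: "info [] = 0" by (simp add: info_def)

lemma max_info_nonneg: "max_info \<ge> 0"
proof -
  have "\<epsilon> \<le> 1" unfolding \<epsilon>_def using finite_positive_q by (intro Min_le) auto
  then show ?thesis using \<epsilon>_pos by (simp add: max_info_def)
qed

lemma info_bounds: "feasible xs \<Longrightarrow> 0 \<le> info xs \<and> info xs \<le> real (length xs) * max_info"
proof (induction xs rule: rev_induct)
  case (snoc x xs)
  then show ?case using info_snoc[OF snoc.prems] feasible_snocD(1)[OF snoc.prems]
    by (auto simp: algebra_simps)
qed simp

subsection \<open>The entropy of a cycle\<close>

text \<open>
  \<open>\<Phi> n xs\<close> is the expected information content of the current block, of which \<open>xs\<close> has been seen,
  after at most \<open>n\<close> further steps and stopped at the regeneration.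
\<close>

primrec \<Phi> :: "nat \<Rightarrow> 's list \<Rightarrow> real" where
  "\<Phi> 0 xs = info xs"
| "\<Phi> (Suc n) xs =
     (\<Sum>x\<in>S. q (last (c # xs)) x * (if x \<in> A then info (xs @ [x]) else \<Phi> n (xs @ [x])))"

text \<open>Each step taken before the regeneration adds between 0 and \<open>max_info\<close>, and
  the expected number of such steps among the next \<open>n\<close> is the sum of the survival
  probabilities.\<close>

lemma \<Phi>_bounds:
  "feasible xs \<Longrightarrow> info xs \<le> \<Phi> n xs \<and> \<Phi> n xs \<le> info xs + max_info * (\<Sum>k<n. survival k (last (c # xs)))"
proof (induction n arbitrary: xs)
  case (Suc n)
  define y where "y = last (c # xs)"
  have y: "y \<in> insert c S" using feasible_last[OF Suc.prems] by (simp add: y_def)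
  have term_bounds: "q y x * info xs \<le> q y x * (if x \<in> A then info (xs @ [x]) else \<Phi> n (xs @ [x]))"
      "q y x * (if x \<in> A then info (xs @ [x]) else \<Phi> n (xs @ [x]))
        \<le> q y x * (info xs + max_info + (if x \<in> A then 0 else max_info * (\<Sum>k<n. survival k x)))" if x: "x \<in> S" for x
  proof -
    consider "q y x = 0" | "q y x > 0" using q_nonneg[of y x] by linarith
    then have "q y x * info xs \<le> q y x * (if x \<in> A then info (xs @ [x]) else \<Phi> n (xs @ [x])) \<and>
      q y x * (if x \<in> A then info (xs @ [x]) else \<Phi> n (xs @ [x]))
        \<le> q y x * (info xs + max_info + (if x \<in> A then 0 else max_info * (\<Sum>k<n. survival k x)))"
    proof cases
      case 2
      then have feasible: "feasible (xs @ [x])" using Suc.prems x by (auto intro!: feasible_snocI simp: y_def)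
      show ?thesis using info_snoc[OF feasible] Suc.IH[OF feasible] 2 by auto
    qed simp
    then show "q y x * info xs \<le> q y x * (if x \<in> A then info (xs @ [x]) else \<Phi> n (xs @ [x]))"
      "q y x * (if x \<in> A then info (xs @ [x]) else \<Phi> n (xs @ [x]))
        \<le> q y x * (info xs + max_info + (if x \<in> A then 0 else max_info * (\<Sum>k<n. survival k x)))" by auto
  qed
  have "(\<Sum>x\<in>S. q y x * info xs) \<le> \<Phi> (Suc n) xs"
    unfolding \<Phi>.simps y_def[symmetric] by (intro sum_mono term_bounds)
  then have 1: "info xs \<le> \<Phi> (Suc n) xs" using row_sum[OF y] by (simp flip: sum_distrib_right)
  have "\<Phi> (Suc n) xs \<le> (\<Sum>x\<in>S. q y x * (info xs + max_info + (if x \<in> A then 0 else max_info * (\<Sum>k<n. survival k x))))"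
    unfolding \<Phi>.simps y_def[symmetric] by (intro sum_mono term_bounds)
  also have "\<dots> = (\<Sum>x\<in>S. q y x * (info xs + max_info)) + (\<Sum>x\<in>S. q y x * (if x \<in> A then 0 else max_info * (\<Sum>k<n. survival k x)))"
    by (simp add: distrib_left sum.distrib)
  also have "(\<Sum>x\<in>S. q y x * (info xs + max_info)) = info xs + max_info" using row_sum[OF y] by (simp flip: sum_distrib_right)
  also have "(\<Sum>x\<in>S. q y x * (if x \<in> A then 0 else max_info * (\<Sum>k<n. survival k x)))
      = (\<Sum>x\<in>S - A. q y x * (max_info * (\<Sum>k<n. survival k x)))"
    unfolding sum_split_A by simp
  also have "\<dots> = max_info * (\<Sum>k<n. survival (Suc k) y)"
  proof -
    have "(\<Sum>k<n. survival (Suc k) y) = (\<Sum>x\<in>S - A. \<Sum>k<n. q y x * survival k x)"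
      unfolding survival.simps by (rule sum.swap)
    then show ?thesis by (simp add: sum_distrib_left mult_ac)
  qed
  finally have "\<Phi> (Suc n) xs \<le> info xs + max_info * (\<Sum>k<Suc n. survival k y)"
    by (simp add: sum.lessThan_Suc_shift distrib_left del: sum.lessThan_Suc survival.simps(2))
  with 1 show ?case by (simp add: y_def)
qed simp

lemma \<Phi>_mono: "feasible xs \<Longrightarrow> \<Phi> n xs \<le> \<Phi> (Suc n) xs"
proof (induction n arbitrary: xs)
  case 0
  then show ?case using \<Phi>_bounds[of xs 1] by simp
next
  case (Suc n)
  have "q (last (c # xs)) x * (if x \<in> A then info (xs @ [x]) else \<Phi> n (xs @ [x]))
      \<le> q (last (c # xs)) x * (if x \<in> A then info (xs @ [x]) else \<Phi> (Suc n) (xs @ [x]))" if "x \<in> S" for x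
  proof (cases "q (last (c # xs)) x > 0")
    case True
    then show ?thesis using Suc.IH[OF feasible_snocI[OF Suc.prems that True]]
      by (intro mult_left_mono q_nonneg) (auto simp del: \<Phi>.simps)
  next
    case False
    then show ?thesis using q_nonneg[of "last (c # xs)" x] by simp
  qed
  then show ?case unfolding \<Phi>.simps(2)[of "Suc n"] \<Phi>.simps(2)[of n xs] by (intro sum_mono) blast
qed

text \<open>The limit is meaningful for feasible \<open>xs\<close>, where the sequence is increasing
  and bounded.\<close>

definition \<Psi> :: "'s list \<Rightarrow> real" where "\<Psi> xs = lim (\<lambda>n. \<Phi> n xs)"

lemma \<Psi>_limit: assumes feasible: "feasible xs" shows "(\<lambda>n. \<Phi> n xs) \<longlonglongrightarrow> \<Psi> xs"
    and \<Psi>_bounds: "info xs \<le> \<Psi> xs" "\<Psi> xs \<le> info xs + max_info * cycle_time (last (c # xs))"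
proof -
  have ub: "\<Phi> n xs \<le> info xs + max_info * cycle_time (last (c # xs))" for n
    using \<Phi>_bounds[OF feasible, of n] mult_left_mono[OF cycle_time_ge[OF feasible_last[OF feasible], of n] max_info_nonneg] by linarith
  have "incseq (\<lambda>n. \<Phi> n xs)" using \<Phi>_mono[OF feasible] by (rule incseq_SucI)
  then have "convergent (\<lambda>n. \<Phi> n xs)"
    using ub by (metis incseq_convergent convergent_def)
  then show l: "(\<lambda>n. \<Phi> n xs) \<longlonglongrightarrow> \<Psi> xs" unfolding \<Psi>_def by (simp add: convergent_LIMSEQ_iff)
  show "info xs \<le> \<Psi> xs" using l by (rule LIMSEQ_le_const) (use \<Phi>_bounds[OF feasible] in auto)
  show "\<Psi> xs \<le> info xs + max_info * cycle_time (last (c # xs))" using l by (rule LIMSEQ_le_const2) (use ub in auto)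
qed

lemma \<Psi>_eq: assumes feasible: "feasible xs"
  shows "\<Psi> xs = (\<Sum>x\<in>S. q (last (c # xs)) x * (if x \<in> A then info (xs @ [x]) else \<Psi> (xs @ [x])))"
proof (rule LIMSEQ_unique)
  show "(\<lambda>n. \<Phi> (Suc n) xs) \<longlonglongrightarrow> \<Psi> xs" by (rule LIMSEQ_Suc[OF \<Psi>_limit(1)[OF feasible]])
  show "(\<lambda>n. \<Phi> (Suc n) xs) \<longlonglongrightarrow>
      (\<Sum>x\<in>S. q (last (c # xs)) x * (if x \<in> A then info (xs @ [x]) else \<Psi> (xs @ [x])))"
    unfolding \<Phi>.simps
  proof (rule tendsto_sum)
    fix x assume x: "x \<in> S"
    show "(\<lambda>n. q (last (c # xs)) x * (if x \<in> A then info (xs @ [x]) else \<Phi> n (xs @ [x]))) \<longlonglongrightarrow>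
      q (last (c # xs)) x * (if x \<in> A then info (xs @ [x]) else \<Psi> (xs @ [x]))"
    \<comment> \<open>A transition of probability 0 may lead to a list that is not feasible, where
      no limit of \<Phi> is known; the factor 0 makes the term constant.\<close>
    proof (cases "q (last (c # xs)) x > 0")
      case True
      then show ?thesis using \<Psi>_limit(1)[OF feasible_snocI[OF feasible x True]] by (auto intro!: tendsto_mult_left)
    next
      case False
      then show ?thesis using q_nonneg[of "last (c # xs)" x] by simp
    qed
  qed
qed

definition rate :: real where "rate = \<Psi> [] / cycle_time c"

text \<open>
  The corrector solves a Poisson equation: adding its increments turns the centred increments of
  information into martingale differences.
\<close>

definition corrector :: "'s list \<Rightarrow> real" where "corrector xs = \<Psi> xs - info xs - rate * cycle_time (last (c # xs))"

lemma cycle_time_c_pos: "cycle_time c > 0" using cycle_time_ge_1[of c] by simp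

lemma corrector_Nil: "corrector [] = 0"
  using cycle_time_c_pos by (simp add: corrector_def rate_def)

text \<open>The first-step equations of \<Psi> and of \<open>cycle_time\<close> are combined.
  Entering \<open>A\<close> empties the history, which is why the new corrector is replaced by 0
  there; this agrees with \<open>corrector_Nil\<close>, the identity that fixes the value of
  \<open>rate\<close>.\<close>

lemma poisson: assumes feasible: "feasible xs"
  shows "(\<Sum>x\<in>S. q (last (c # xs)) x * (info (xs @ [x]) - info xs - rate + (if x \<in> A then 0 else corrector (xs @ [x])) - corrector xs)) = 0"
proof -
  define y where "y = last (c # xs)"
  have y: "y \<in> insert c S" using feasible_last[OF feasible] by (simp add: y_def)
  have "(\<Sum>x\<in>S. q y x * (info (xs @ [x]) - info xs - rate + (if x \<in> A then 0 else corrector (xs @ [x])) - corrector xs))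
    = (\<Sum>x\<in>S. q y x * (if x \<in> A then info (xs @ [x]) else \<Psi> (xs @ [x])) - q y x * (info xs + rate + corrector xs)
        - rate * (if x \<in> A then 0 else q y x * cycle_time x))"
    by (intro sum.cong refl) (auto simp: corrector_def algebra_simps)
  also have "\<dots> = \<Psi> xs - (info xs + rate + corrector xs) - rate * (\<Sum>x\<in>S. if x \<in> A then 0 else q y x * cycle_time x)"
    using row_sum[OF y] \<Psi>_eq[OF feasible]
    by (simp add: sum_subtractf sum_distrib_left y_def del: last.simps flip: sum_distrib_right)
  also have "(\<Sum>x\<in>S. if x \<in> A then 0 else q y x * cycle_time x) = cycle_time y - 1"
    unfolding sum_split_A using cycle_time_eq[OF y] by simp
  finally show ?thesis by (simp add: corrector_def y_def algebra_simps)
qed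

definition corrector_bound :: real where "corrector_bound = (max_info + \<bar>rate\<bar>) * Max (cycle_time ` insert c S)"

text \<open>Subtracting \<open>info xs\<close> from \<open>\<Psi> xs\<close> leaves only the
  information still to come, which is at most \<open>max_info\<close> times the expected remaining
  time. The bound is therefore uniform in the length of the block.\<close>

lemma corrector_bounded: assumes feasible: "feasible xs" shows "\<bar>corrector xs\<bar> \<le> corrector_bound"
proof -
  define y where "y = last (c # xs)"
  have y: "y \<in> insert c S" using feasible_last[OF feasible] by (simp add: y_def)
  have V: "1 \<le> cycle_time y" "cycle_time y \<le> Max (cycle_time ` insert c S)" using cycle_time_ge_1[OF y] y finite_S by auto
  have "\<bar>corrector xs\<bar> \<le> \<bar>\<Psi> xs - info xs\<bar> + \<bar>rate * cycle_time y\<bar>" unfolding corrector_def y_def by linarith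
  also have "\<dots> \<le> max_info * cycle_time y + \<bar>rate\<bar> * cycle_time y" using \<Psi>_bounds[OF feasible] V by (simp add: abs_mult y_def)
  also have "\<dots> = (max_info + \<bar>rate\<bar>) * cycle_time y" by (simp add: algebra_simps)
  also have "\<dots> \<le> corrector_bound" unfolding corrector_bound_def using V max_info_nonneg by (intro mult_left_mono) auto
  finally show ?thesis .
qed

lemma rate_eq: "rate = (\<Sum>x\<in>A. \<mu> x) * \<Psi> []"
  using kac cycle_time_c_pos by (simp add: rate_def field_simps)

definition first_returns :: "nat \<Rightarrow> 's list set" where
  "first_returns n = {xs \<in> state_lists (Suc n). set (butlast xs) \<inter> A = {} \<and> last xs \<in> A}"

definition avoiding :: "nat \<Rightarrow> 's list set" where
  "avoiding n = {xs \<in> state_lists n. set xs \<inter> A = {}}"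

lemma finite_first_returns[simp]: "finite (first_returns n)" and finite_avoiding[simp]: "finite (avoiding n)"
  by (simp_all add: first_returns_def avoiding_def)

lemma first_returns_0: "first_returns 0 = (\<lambda>x. [x]) ` A"
  using A_subset by (auto simp: first_returns_def state_lists_def length_Suc_conv)

lemma avoiding_0: "avoiding 0 = {[]}" by (auto simp: avoiding_def state_lists_def)

lemma first_returns_Suc: "first_returns (Suc n) = (\<lambda>(x, xs). x # xs) ` ((S - A) \<times> first_returns n)"
  by (fastforce simp: first_returns_def state_lists_def length_Suc_conv)

lemma avoiding_Suc: "avoiding (Suc n) = (\<lambda>(x, xs). x # xs) ` ((S - A) \<times> avoiding n)"
  by (fastforce simp: avoiding_def state_lists_def length_Suc_conv)

lemma sum_first_returns_Suc: "(\<Sum>xs\<in>first_returns (Suc n). g xs) = (\<Sum>x\<in>S - A. \<Sum>xs\<in>first_returns n. g (x # xs))"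
  unfolding first_returns_Suc by (subst sum.reindex) (auto simp: inj_on_def sum.cartesian_product split_beta)

lemma sum_avoiding_Suc: "(\<Sum>xs\<in>avoiding (Suc n). g xs) = (\<Sum>x\<in>S - A. \<Sum>xs\<in>avoiding n. g (x # xs))"
  unfolding avoiding_Suc by (subst sum.reindex) (auto simp: inj_on_def sum.cartesian_product split_beta)

text \<open>Split according to whether the block is completed within \<open>n\<close> steps, and if
  so after how many.\<close>

lemma \<Phi>_expand:
  "\<Phi> n xs = (\<Sum>k<n. \<Sum>ys\<in>first_returns k. pw (last (c # xs)) ys * info (xs @ ys))
     + (\<Sum>ys\<in>avoiding n. pw (last (c # xs)) ys * info (xs @ ys))"
proof (induction n arbitrary: xs)
  case 0
  then show ?case by (simp add: avoiding_0)
next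
  case (Suc n)
  define y where "y = last (c # xs)"
  have "\<Phi> (Suc n) xs = (\<Sum>x\<in>A. q y x * info (xs @ [x])) + (\<Sum>x\<in>S - A. q y x * \<Phi> n (xs @ [x]))"
    unfolding \<Phi>.simps sum_split_A by (simp add: y_def)
  also have "(\<Sum>x\<in>A. q y x * info (xs @ [x])) = (\<Sum>ys\<in>first_returns 0. pw y ys * info (xs @ ys))"
    unfolding first_returns_0 by (subst sum.reindex) (auto simp: inj_on_def)
  also have "(\<Sum>x\<in>S - A. q y x * \<Phi> n (xs @ [x]))
     = (\<Sum>x\<in>S - A. (\<Sum>k<n. \<Sum>ys\<in>first_returns k. q y x * (pw x ys * info (xs @ x # ys)))
         + (\<Sum>ys\<in>avoiding n. q y x * (pw x ys * info (xs @ x # ys))))"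
    unfolding Suc.IH by (simp add: distrib_left sum_distrib_left)
  also have "\<dots> = (\<Sum>k<n. \<Sum>ys\<in>first_returns (Suc k). pw y ys * info (xs @ ys)) + (\<Sum>ys\<in>avoiding (Suc n). pw y ys * info (xs @ ys))"
    unfolding sum.distrib sum_first_returns_Suc sum_avoiding_Suc
    by (subst sum.swap) (simp add: mult.assoc)
  finally show ?case
    by (simp add: sum.lessThan_Suc_shift y_def del: sum.lessThan_Suc)
qed

lemma sum_avoiding_pw: "(\<Sum>ys\<in>avoiding n. pw x ys) = survival n x"
  by (induction n arbitrary: x) (simp_all add: avoiding_0 sum_avoiding_Suc flip: sum_distrib_left)

text \<open>A block unfinished after \<open>n\<close> steps carries at most
  \<open>n * max_info\<close>, so the unfinished blocks contribute at most
  \<open>real n * survival n c * max_info\<close>. This tends to 0 by the geometric decay of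
  \<open>survival\<close>.\<close>

lemma \<Psi>_Nil_sums: "(\<lambda>k. \<Sum>ys\<in>first_returns k. pw c ys * info ys) sums \<Psi> []"
proof -
  define J where "J n = (\<Sum>ys\<in>avoiding n. pw c ys * info ys)" for n
  have "0 \<le> pw c ys * info ys \<and> pw c ys * info ys \<le> pw c ys * (real n * max_info)" if "ys \<in> avoiding n" for ys n
  proof (cases "pw c ys > 0")
    case True
    then have "feasible ys" using that by (auto simp: feasible_def avoiding_def state_lists_def)
    then show ?thesis using info_bounds[of ys] that pw_nonneg[of c ys]
      by (auto simp: avoiding_def state_lists_def intro!: mult_left_mono)
  next
    case False
    then show ?thesis using pw_nonneg[of c ys] by simp
  qed
  then have J: "0 \<le> J n" "J n \<le> real n * survival n c * max_info" for n
    unfolding J_def sum_avoiding_pw[symmetric] sum_distrib_left sum_distrib_right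
    by (auto intro!: sum_nonneg sum_mono simp: mult_ac)
  have "(\<lambda>n. real n * survival n c * max_info) \<longlonglongrightarrow> 0"
    using tendsto_mult_right[OF n_survival_tendsto_0[of c], of max_info] by simp
  then have "J \<longlonglongrightarrow> 0"
    by (rule Lim_null_comparison[rotated]) (use J in auto)
  moreover have "(\<lambda>n. \<Phi> n []) \<longlonglongrightarrow> \<Psi> []" by (rule \<Psi>_limit(1)) simp
  ultimately have "(\<lambda>n. \<Phi> n [] - J n) \<longlonglongrightarrow> \<Psi> [] - 0" by (rule tendsto_diff[rotated])
  then show ?thesis by (simp add: sums_def \<Phi>_expand J_def)
qed

lemma first_returns_term_nonneg: "ys \<in> first_returns k \<Longrightarrow> pw c ys * info ys \<ge> 0"
  using info_bounds[of ys] pw_nonneg[of c ys]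
  by (cases "pw c ys = 0") (auto simp: feasible_def first_returns_def state_lists_def)

subsection \<open>Probabilities of observations\<close>

text \<open>The first state enters only through its type and the later ones through \<kappa>. This
  mirrors the hidden process, whose first value shows the type of the first word but not the word's
  cone.\<close>

definition observation_prob :: "'s \<Rightarrow> 's list \<Rightarrow> real" where
  "observation_prob x xs = (\<Sum>y\<in>{y \<in> S. \<tau> y = \<tau> x}. \<Sum>ys\<in>matches xs. \<mu> y * pw y ys)"

lemma pw_regeneration: "a \<in> A \<Longrightarrow> set xs \<subseteq> S \<Longrightarrow> pw a xs = pw c xs"
  by (cases xs) (auto simp: regeneration)

lemma last_matches_in_A:
  assumes x: "x \<in> S" "set xs \<subseteq> S" "last (x # xs) \<in> A" and y: "y \<in> S" "\<tau> y = \<tau> x" and ys: "ys \<in> matches xs"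
  shows "last (y # ys) \<in> A"
proof (cases xs rule: rev_cases)
  case Nil
  then show ?thesis using assms by (auto simp: A_def)
next
  case (snoc xs' v)
  then obtain ys' w where w: "ys = ys' @ [w]" "w \<in> S" "\<kappa> w = \<kappa> v"
    using ys by (cases ys rule: rev_cases) (auto simp: matches_def)
  then show ?thesis using snoc x \<kappa>_\<tau>[of w v] by (auto simp: A_def)
qed

text \<open>Since \<open>A\<close> is recognised from the type, all state lists with the given
  observations are in \<open>A\<close> at the same time, and from there they continue with the
  weights of \<open>c\<close>. This is the regeneration at the level of observations.\<close>

lemma observation_prob_append:
  assumes "x \<in> S" "set xs \<subseteq> S" "last (x # xs) \<in> A"
  shows "observation_prob x (xs @ zs) = observation_prob x xs * block_weight zs"
proof -
  have "\<mu> y * pw y (ys @ us) = \<mu> y * pw y ys * pw c us"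
    if "y \<in> S" "\<tau> y = \<tau> x" "ys \<in> matches xs" "us \<in> matches zs" for y ys us
  proof -
    have "pw (last (y # ys)) us = pw c us"
      using last_matches_in_A[OF assms that(1-3)] that(4) by (intro pw_regeneration) (auto simp: matches_def)
    then show ?thesis by (simp add: path_prod_append)
  qed
  then show ?thesis
    unfolding observation_prob_def sum_distrib_right unfolding block_weight_def sum_distrib_left sum_matches_append
    by (intro sum.cong refl) auto
qed

lemma observation_prob_pos: assumes "x \<in> S" "set xs \<subseteq> S" "pw x xs > 0" shows "observation_prob x xs > 0"
proof -
  have "0 < \<mu> x * pw x xs" using assms \<mu>_pos by simp
  also have "\<dots> \<le> (\<Sum>ys\<in>matches xs. \<mu> x * pw x ys)"
    using assms \<mu>_pos by (intro member_le_sum matches_self) (auto simp: pw_nonneg less_imp_le)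
  also have "\<dots> \<le> observation_prob x xs"
    unfolding observation_prob_def using assms finite_S \<mu>_pos
    by (intro member_le_sum[where f = "\<lambda>y. \<Sum>ys\<in>matches xs. \<mu> y * pw y ys"])
      (auto intro!: sum_nonneg simp: pw_nonneg less_imp_le)
  finally show ?thesis .
qed

lemma sum_state_lists_Suc_Cons: "(\<Sum>l\<in>state_lists (Suc n). g l) = (\<Sum>x\<in>S. \<Sum>l\<in>state_lists n. g (x # l))"
proof -
  have "state_lists (Suc n) = (\<lambda>(x, l). x # l) ` (S \<times> state_lists n)"
    by (auto simp: state_lists_def length_Suc_conv image_iff)
  then show ?thesis
    by (simp add: sum.cartesian_product split_beta) (subst sum.reindex, auto simp: inj_on_def split_beta)
qed

lemma prob_observation:
  assumes "length xs = k"
  shows "\<P>(\<omega> in N. \<tau> (V 0 \<omega>) = \<tau> x \<and> (\<forall>i<k. \<kappa> (V (Suc i) \<omega>) = \<kappa> (xs ! i))) = observation_prob x xs"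
proof -
  let ?E = "\<lambda>l. \<tau> (hd l) = \<tau> x \<and> map \<kappa> (tl l) = map \<kappa> xs"
  have E: "?E (path (Suc k) \<omega>) \<longleftrightarrow> \<tau> (V 0 \<omega>) = \<tau> x \<and> (\<forall>i<k. \<kappa> (V (Suc i) \<omega>) = \<kappa> (xs ! i))" for \<omega>
  proof -
    have p: "path (Suc k) \<omega> = V 0 \<omega> # map (\<lambda>i. V (Suc i) \<omega>) [0..<k]"
      by (simp add: path_def upt_conv_Cons map_Suc_upt[symmetric] comp_def del: upt_Suc map_Suc_upt)
    show ?thesis unfolding p using assms by (simp add: list_eq_iff_nth_eq)
  qed
  have [measurable]: "Measurable.pred N (\<lambda>\<omega>. ?E (path (Suc k) \<omega>))"
    by (rule measurable_compose[OF path_meas]) simp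
  have "\<P>(\<omega> in N. ?E (path (Suc k) \<omega>)) = expectation (\<lambda>\<omega>. of_bool (?E (path (Suc k) \<omega>)))"
  proof -
    have "expectation (\<lambda>\<omega>. of_bool (?E (path (Suc k) \<omega>)) :: real) = expectation (indicator {\<omega> \<in> space N. ?E (path (Suc k) \<omega>)})"
      by (intro Bochner_Integration.integral_cong) auto
    then show ?thesis by simp
  qed
  also have "\<dots> = (\<Sum>l\<in>state_lists (Suc k). law l * of_bool (?E l))" by (rule expectation_path(2))
  also have "\<dots> = (\<Sum>y\<in>S. \<Sum>ys\<in>state_lists k. if \<tau> y = \<tau> x \<and> map \<kappa> ys = map \<kappa> xs then \<mu> y * pw y ys else 0)"
    unfolding sum_state_lists_Suc_Cons by (intro sum.cong refl) (auto simp: law_def)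
  also have "\<dots> = (\<Sum>y\<in>S. if \<tau> y = \<tau> x then \<Sum>ys\<in>{ys \<in> state_lists k. map \<kappa> ys = map \<kappa> xs}. \<mu> y * pw y ys else 0)"
    unfolding sum.inter_filter[OF finite_state_lists] by (intro sum.cong refl) auto
  also have "{ys \<in> state_lists k. map \<kappa> ys = map \<kappa> xs} = matches xs"
    using assms by (auto simp: matches_def state_lists_def dest: map_eq_imp_length_eq)
  finally show ?thesis unfolding E observation_prob_def sum.inter_filter[OF finite_S] .
qed

section \<open>The block in progress and the martingale increments\<close>

definition hist :: "'s list \<Rightarrow> 's list" where
  "hist xs = foldl (\<lambda>l x. if x \<in> A then [] else l @ [x]) [] xs"

lemma hist_snoc: "hist (xs @ [x]) = (if x \<in> A then [] else hist xs @ [x])"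
  by (simp add: hist_def)

text \<open>Cuts the path at its last visit to \<open>A\<close>; the visit may be the first state
  \<open>x\<close>, in which case \<open>xs1\<close> is empty.\<close>

lemma hist_split:
  assumes "set (x # xs) \<inter> A \<noteq> {}"
  shows "\<exists>xs1. xs = xs1 @ hist (x # xs) \<and> last (x # xs1) \<in> A"
  using assms
proof (induction xs rule: rev_induct)
  case Nil
  then show ?case by (simp add: hist_def)
next
  case (snoc y xs)
  have eq: "hist (x # xs @ [y]) = (if y \<in> A then [] else hist (x # xs) @ [y])"
    using hist_snoc[of "x # xs" y] by simp
  show ?case
  proof (cases "y \<in> A")
    case True
    then show ?thesis using eq by (intro exI[of _ "xs @ [y]"]) simp
  next
    case False
    then obtain xs1 where "xs = xs1 @ hist (x # xs)" "last (x # xs1) \<in> A" using snoc by auto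
    then show ?thesis using False eq by (intro exI[of _ xs1]) simp
  qed
qed

definition step :: "'s list \<Rightarrow> 's \<Rightarrow> real" where
  "step l x = (if set l \<inter> A = {} then 0
     else info (hist l @ [x]) - info (hist l) - rate + corrector (hist (l @ [x])) - corrector (hist l))"

context
  fixes x xs
  assumes law: "law (x # xs) > 0" and S: "set (x # xs) \<subseteq> S" and visited: "set (x # xs) \<inter> A \<noteq> {}"
begin

lemma pw_pos: "pw x xs > 0"
  using law \<mu>_pos[of x] S by (auto simp: law_def zero_less_mult_iff)

lemma visited_split:
  obtains xs1 where "xs = xs1 @ hist (x # xs)" "last (x # xs1) \<in> A"
    "pw (last (x # xs1)) (hist (x # xs)) = pw c (hist (x # xs))" "set (hist (x # xs)) \<subseteq> S" "set xs1 \<subseteq> S"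
proof -
  obtain xs1 where xs1: "xs = xs1 @ hist (x # xs)" "last (x # xs1) \<in> A" using hist_split[OF visited] by blast
  have "set xs = set xs1 \<union> set (hist (x # xs))" using arg_cong[OF xs1(1), of set] by simp
  then have "set (hist (x # xs)) \<subseteq> S" "set xs1 \<subseteq> S" using S by auto
  then show ?thesis using xs1 pw_regeneration[OF xs1(2)] that by blast
qed

lemma feasible_hist: "feasible (hist (x # xs))"
proof -
  obtain xs1 where xs1: "xs = xs1 @ hist (x # xs)" 
    "pw (last (x # xs1)) (hist (x # xs)) = pw c (hist (x # xs))" "set (hist (x # xs)) \<subseteq> S"
    using visited_split by metis
  have "pw x xs = pw x xs1 * pw c (hist (x # xs))"
    by (subst xs1(1)) (simp only: path_prod_append xs1(2))
  then show ?thesis using pw_pos xs1(3) pw_nonneg[of x xs1] by (auto simp: feasible_def zero_less_mult_iff)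
qed

text \<open>If the history is empty, the last state lies in \<open>A\<close> and moves like
  \<open>c\<close>; otherwise it is the last entry of the history.\<close>

lemma last_hist:
  assumes "y \<in> S" shows "q (last (c # hist (x # xs))) y = q (last (x # xs)) y"
proof -
  obtain xs1 where xs1: "xs = xs1 @ hist (x # xs)" "last (x # xs1) \<in> A"
    using visited_split by metis
  show ?thesis
  proof (cases "hist (x # xs) = []")
    case True
    then have "xs = xs1" using xs1(1) by simp
    then show ?thesis using True regeneration[OF xs1(2) assms] by simp
  next
    case False
    then have "last (x # xs) = last (hist (x # xs))" by (subst xs1(1)) auto
    then show ?thesis using False by simp
  qed
qed

text \<open>Both probabilities contain the same factor for the part before the last regeneration,
  and it cancels. The new state is appended to the old history even if it lies in \<open>A\<close>:
  the closing observation still belongs to the block.\<close>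

lemma ln_observation_prob_increment:
  assumes y: "y \<in> S" "q (last (x # xs)) y > 0"
  shows "- ln (observation_prob x (xs @ [y])) + ln (observation_prob x xs) = info (hist (x # xs) @ [y]) - info (hist (x # xs))"
proof -
  obtain xs1 where xs1: "xs = xs1 @ hist (x # xs)" "last (x # xs1) \<in> A" "set xs1 \<subseteq> S"
    using visited_split by metis
  have xS: "x \<in> S" using S by simp
  have 1: "observation_prob x xs = observation_prob x xs1 * block_weight (hist (x # xs))"
    using observation_prob_append[OF xS xs1(3,2), of "hist (x # xs)"] xs1(1) by simp
  have 2: "observation_prob x (xs @ [y]) = observation_prob x xs1 * block_weight (hist (x # xs) @ [y])"
    using observation_prob_append[OF xS xs1(3,2), of "hist (x # xs) @ [y]"] xs1(1) by (metis append_assoc)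
  have pos: "observation_prob x xs > 0" "observation_prob x (xs @ [y]) > 0"
    using S y pw_pos by (auto intro!: observation_prob_pos simp: path_prod_append simp del: last.simps)
  have "feasible (hist (x # xs) @ [y])"
    using feasible_hist y last_hist[of y] by (intro feasible_snocI) auto
  then have w: "block_weight (hist (x # xs)) > 0" "block_weight (hist (x # xs) @ [y]) > 0"
    using block_weight_pos feasible_hist by auto
  have "observation_prob x xs1 > 0" using 1 pos(1) w(1) by (simp add: zero_less_mult_iff)
  then show ?thesis using w unfolding 1 2 by (simp add: ln_mult info_def)
qed

lemma step_eq:
  assumes y: "y \<in> S" "q (last (x # xs)) y > 0"
  shows "step (x # xs) y = - ln (observation_prob x (xs @ [y])) + ln (observation_prob x xs) - rate + corrector (hist (x # xs @ [y])) - corrector (hist (x # xs))"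
  using ln_observation_prob_increment[OF y] visited unfolding step_def append_Cons by auto

lemma feasible_hist_snoc:
  assumes y: "y \<in> S" "q (last (x # xs)) y > 0" 
  shows "feasible (hist (x # xs @ [y]))"
  using hist_snoc[of "x # xs" y] feasible_hist y last_hist[of y] by (auto intro!: feasible_snocI)

lemma step_bounded:
  assumes y: "y \<in> S" "q (last (x # xs)) y > 0"
  shows "\<bar>step (x # xs) y\<bar> \<le> max_info + \<bar>rate\<bar> + 2 * corrector_bound"
proof -
  have a: "feasible (hist (x # xs) @ [y])" using feasible_hist y last_hist[of y] by (intro feasible_snocI) auto
  show ?thesis
    using info_snoc[OF a] corrector_bounded[OF feasible_hist] corrector_bounded[OF feasible_hist_snoc[OF y]] visited
    by (auto simp: step_def)
qed

lemma step_mean: "(\<Sum>y\<in>S. q (last (x # xs)) y * step (x # xs) y) = 0"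
proof -
  have "q (last (x # xs)) y * step (x # xs) y =
    q (last (c # hist (x # xs))) y * (info (hist (x # xs) @ [y]) - info (hist (x # xs)) - rate
      + (if y \<in> A then 0 else corrector (hist (x # xs) @ [y])) - corrector (hist (x # xs)))" if "y \<in> S" for y
    unfolding last_hist[OF that] using visited hist_snoc[of "x # xs" y] by (auto simp: step_def corrector_Nil)
  then show ?thesis using poisson[OF feasible_hist] by (simp del: last.simps)
qed

end

lemma step_mean': 
  assumes "l \<in> state_lists (Suc n)" "law l > 0" shows "(\<Sum>y\<in>S. q (last l) y * step l y) = 0"
proof (cases "set l \<inter> A = {}")
  case False
  then show ?thesis using assms step_mean[of "hd l" "tl l"] by (cases l) (auto simp: state_lists_def)
qed (simp add: step_def)

definition increment :: "nat \<Rightarrow> 'w \<Rightarrow> real" where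
  "increment k \<omega> = step (path (Suc k) \<omega>) (V (Suc k) \<omega>)"

lemma increment_alt: "increment k \<omega> = (\<lambda>l. step (butlast l) (last l)) (path (Suc (Suc k)) \<omega>)"
  by (simp add: increment_def path_Suc[of "Suc k"])

lemma increment_meas[measurable]: "increment k \<in> borel_measurable N"
  unfolding increment_alt by measurable

text \<open>The earlier increment is a function of the first \<open>Suc k\<close> states, given
  which the later one has mean 0.\<close>

lemma increment_orthogonal: assumes jk: "j < k" shows "expectation (\<lambda>\<omega>. increment j \<omega> * increment k \<omega>) = 0"
proof -
  \<comment> \<open>Reads the increment of index \<open>j\<close> off a longer path.\<close>
  define g where "g l = step (butlast (take (Suc (Suc j)) l)) (last (take (Suc (Suc j)) l))" for l
  have g: "g (l @ [x]) = g l" if "length l = Suc k" for l x using that jk by (simp add: g_def)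
  have "increment j \<omega> * increment k \<omega> = (\<lambda>l. g l * step (butlast l) (last l)) (path (Suc (Suc k)) \<omega>)" for \<omega>
    using jk by (simp add: increment_alt g_def take_path)
  then have "expectation (\<lambda>\<omega>. increment j \<omega> * increment k \<omega>)
      = (\<Sum>l\<in>state_lists (Suc (Suc k)). law l * (g l * step (butlast l) (last l)))"
    using expectation_path(2)[of "\<lambda>l. g l * step (butlast l) (last l)" "Suc (Suc k)"] by simp
  also have "\<dots> = (\<Sum>l\<in>state_lists (Suc k). \<Sum>x\<in>S. (law l * g l) * (q (last l) x * step l x))"
    unfolding sum_state_lists_Suc_snoc[of _ "Suc k"]
  proof (intro sum.cong refl)
    fix l x assume "l \<in> state_lists (Suc k)"
    then have l: "length l = Suc k" "l \<noteq> []" by (auto simp: state_lists_def)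
    show "law (l @ [x]) * (g (l @ [x]) * step (butlast (l @ [x])) (last (l @ [x])))
        = (law l * g l) * (q (last l) x * step l x)"
      using l by (simp add: law_snoc g)
  qed
  also have "\<dots> = (\<Sum>l\<in>state_lists (Suc k). (law l * g l) * (\<Sum>x\<in>S. q (last l) x * step l x))"
    by (simp add: sum_distrib_left)
  also have "\<dots> = 0"
  proof (rule sum.neutral, rule ballI)
    fix l assume l: "l \<in> state_lists (Suc k)"
    \<comment> \<open>The mean vanishes only for lists of positive probability; for the others the
      factor \<open>law l\<close> is 0.\<close>
    show "(law l * g l) * (\<Sum>x\<in>S. q (last l) x * step l x) = 0"
      using law_nonneg[OF l] step_mean'[OF l] by (cases "law l = 0") auto
  qed
  finally show ?thesis .
qed

section \<open>Almost sure convergence of the normalised information\<close>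

definition good :: "'w \<Rightarrow> bool" where
  "good \<omega> \<longleftrightarrow> (\<forall>n. path n \<omega> \<in> state_lists n \<and> law (path n \<omega>) > 0)"

lemma AE_good: "AE \<omega> in N. good \<omega>"
proof -
  have "AE \<omega> in N. path n \<omega> \<in> state_lists n \<and> law (path n \<omega>) > 0" for n
  proof -
    have "AE \<omega> in N. \<forall>l\<in>state_lists n. law l = 0 \<longrightarrow> path n \<omega> \<noteq> l"
    proof (rule AE_finite_allI[OF finite_state_lists])
      fix l assume l: "l \<in> state_lists n"
      show "AE \<omega> in N. law l = 0 \<longrightarrow> path n \<omega> \<noteq> l"
      proof (cases "law l = 0")
        case True
        then have "prob {\<omega> \<in> space N. path n \<omega> = l} = 0" using prob_path[OF l] by simp
        then have "AE \<omega> in N. \<not> path n \<omega> = l" by (subst (asm) prob_eq_0) auto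
        then show ?thesis by eventually_elim simp
      qed simp
    qed
    with path_in_state_lists[of n] show ?thesis
      by eventually_elim (use law_nonneg in \<open>force simp: less_le\<close>)
  qed
  then show ?thesis unfolding good_def by (simp add: AE_all_countable)
qed

lemma goodD:
  assumes "good \<omega>"
  shows "V n \<omega> \<in> S" "q (last (path (Suc n) \<omega>)) (V (Suc n) \<omega>) > 0"
proof -
  have "path (Suc n) \<omega> \<in> state_lists (Suc n)" using assms by (auto simp: good_def)
  then show "V n \<omega> \<in> S" by (simp add: path_Suc state_lists_def)
  have "law (path (Suc (Suc n)) \<omega>) > 0" "law (path (Suc n) \<omega>) > 0" using assms by (auto simp: good_def)
  moreover have "path (Suc n) \<omega> \<noteq> []" by (simp add: path_Suc)
  ultimately show "q (last (path (Suc n) \<omega>)) (V (Suc n) \<omega>) > 0"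
    by (simp add: path_Suc[of "Suc n"] law_snoc zero_less_mult_iff)
qed

lemma increment_bounded: "AE \<omega> in N. \<bar>increment k \<omega>\<bar> \<le> max_info + \<bar>rate\<bar> + 2 * corrector_bound"
  using AE_good
proof eventually_elim
  case (elim \<omega>)
  let ?l = "path (Suc k) \<omega>"
  obtain x xs where l: "?l = x # xs" by (metis length_path length_Suc_conv)
  show ?case
  proof (cases "set ?l \<inter> A = {}")
    case True
    have "corrector_bound \<ge> 0" using corrector_bounded[of "[]"] by simp
    then show ?thesis using True max_info_nonneg by (simp add: increment_def step_def)
  next
    case False
    have "law ?l > 0" "set ?l \<subseteq> S" using elim by (auto simp: good_def state_lists_def)
    then show ?thesis
      unfolding increment_def using step_bounded[of x xs "V (Suc k) \<omega>"] goodD[OF elim] False l by metis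
  qed
qed

text \<open>The probability of avoiding \<open>A\<close> for \<open>Suc n\<close> states is at most
  a finite mixture of survival probabilities, each of which tends to 0.\<close>

lemma AE_visits: "AE \<omega> in N. \<exists>n. V n \<omega> \<in> A"
proof -
  have sum_law_avoiding: "(\<Sum>l\<in>avoiding (Suc n). law l) \<le> (\<Sum>x\<in>S. \<mu> x * survival n x)" for n
  proof -
    have "(\<Sum>l\<in>avoiding (Suc n). law l) = (\<Sum>x\<in>S - A. \<mu> x * survival n x)"
      unfolding sum_avoiding_Suc by (simp add: law_def sum_avoiding_pw flip: sum_distrib_left)
    also have "\<dots> \<le> (\<Sum>x\<in>S. \<mu> x * survival n x)"
      using finite_S \<mu>_pos by (intro sum_mono2) (auto simp: less_imp_le survival_nonneg)
    finally show ?thesis .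
  qed
  have bound: "prob {\<omega> \<in> space N. \<forall>n. V n \<omega> \<notin> A} \<le> (\<Sum>x\<in>S. \<mu> x * survival n x)" for n
  proof -
    have "prob {\<omega> \<in> space N. \<forall>n. V n \<omega> \<notin> A} \<le> prob {\<omega> \<in> space N. set (path (Suc n) \<omega>) \<inter> A = {}}"
    proof (rule finite_measure_mono)
      have [measurable]: "Measurable.pred N (\<lambda>\<omega>. set (path (Suc n) \<omega>) \<inter> A = {})"
        by (rule measurable_compose[OF path_meas]) simp
      show "{\<omega> \<in> space N. set (path (Suc n) \<omega>) \<inter> A = {}} \<in> events" by measurable
    qed (auto simp: path_def)
    also have "\<dots> = expectation (\<lambda>\<omega>. of_bool (set (path (Suc n) \<omega>) \<inter> A = {}))"
    proof -
      have "expectation (\<lambda>\<omega>. of_bool (set (path (Suc n) \<omega>) \<inter> A = {}) :: real)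
        = expectation (indicator {\<omega> \<in> space N. set (path (Suc n) \<omega>) \<inter> A = {}})"
        by (intro Bochner_Integration.integral_cong) auto
      then show ?thesis by simp
    qed
    also have "\<dots> = (\<Sum>l\<in>state_lists (Suc n). law l * of_bool (set l \<inter> A = {}))"
      by (rule expectation_path(2))
    also have "\<dots> = (\<Sum>l\<in>avoiding (Suc n). law l)"
      unfolding avoiding_def sum.inter_filter[OF finite_state_lists] by (intro sum.cong) auto
    finally show ?thesis using sum_law_avoiding[of n] by linarith
  qed
  have "(\<lambda>n. \<Sum>x\<in>S. \<mu> x * survival n x) \<longlonglongrightarrow> (\<Sum>x\<in>S. \<mu> x * 0)"
    by (intro tendsto_sum tendsto_mult_left summable_LIMSEQ_zero summable_survival) auto
  then have "prob {\<omega> \<in> space N. \<forall>n. V n \<omega> \<notin> A} \<le> 0"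
    using bound by (intro LIMSEQ_le_const[of _ 0]) auto
  then have "prob {\<omega> \<in> space N. \<forall>n. V n \<omega> \<notin> A} = 0" by (simp add: measure_le_0_iff)
  then have "AE \<omega> in N. \<not> (\<forall>n. V n \<omega> \<notin> A)" by (subst (asm) prob_eq_0) auto
  then show ?thesis by simp
qed

text \<open>From the first visit to \<open>A\<close> on, the increments telescope to the information
  minus \<open>rate\<close> times the elapsed time plus a bounded corrector. Division by
  \<open>n\<close> leaves the information per step.\<close>

theorem observation_entropy:
  "AE \<omega> in N. (\<lambda>k. - (1 / real k) * ln (observation_prob (V 0 \<omega>) (map (\<lambda>i. V i \<omega>) [1..<Suc k])))
     \<longlonglongrightarrow> (\<Sum>x\<in>A. \<mu> x) * \<Psi> []"
proof -
  have "AE \<omega> in N. (\<lambda>n. (\<Sum>k<n. increment k \<omega>) / real n) \<longlonglongrightarrow> 0"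
    by (rule orthogonal_bounded_strong_law[OF increment_meas increment_bounded]) (rule increment_orthogonal)
  then show ?thesis
    using AE_good AE_visits
  proof eventually_elim
    case (elim \<omega>)
    then obtain T where T: "V T \<omega> \<in> A" by blast
    define l where "l k = - ln (observation_prob (V 0 \<omega>) (map (\<lambda>i. V i \<omega>) [1..<Suc k]))" for k
    define v where "v k = corrector (hist (path (Suc k) \<omega>))" for k
    have path_Cons: "path (Suc k) \<omega> = V 0 \<omega> # map (\<lambda>i. V i \<omega>) [1..<Suc k]" for k
      by (simp add: path_def upt_conv_Cons del: upt_Suc)
    have lpS: "law (path (Suc k) \<omega>) > 0" "set (path (Suc k) \<omega>) \<subseteq> S" for k
      using elim by (auto simp: good_def state_lists_def)
    have vis: "set (path (Suc k) \<omega>) \<inter> A \<noteq> {}" if "k \<ge> T" for k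
    proof -
      have "V T \<omega> \<in> set (path (Suc k) \<omega>)" using that by (auto simp: path_def simp del: upt_Suc)
      then show ?thesis using T by blast
    qed
    have increment: "increment k \<omega> = l (Suc k) - l k - rate + v (Suc k) - v k" if "k \<ge> T" for k
      unfolding increment_def path_Cons
      using step_eq[of "V 0 \<omega>" "map (\<lambda>i. V i \<omega>) [1..<Suc k]" "V (Suc k) \<omega>"]
        lpS[of k, unfolded path_Cons] vis[OF that, unfolded path_Cons] goodD[OF elim(2)]
      by (simp add: l_def v_def path_Cons path_Suc[of "Suc k", unfolded path_Cons[of k], symmetric])
    have v: "\<bar>v k\<bar> \<le> corrector_bound" if "k \<ge> T" for k
      unfolding v_def using corrector_bounded[OF feasible_hist] lpS[of k] vis[OF that] unfolding path_Cons by blast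
    \<comment> \<open>Collects everything that happened up to the visit at time \<open>T\<close>;
      for fixed \<omega> it is a constant and disappears after division by \<open>n\<close>.\<close>
    define c0 where "c0 = (\<Sum>k<T. increment k \<omega>) + rate * real T - l T - v T"
    have sumD: "(\<Sum>k<n. increment k \<omega>) = c0 + l n + v n - rate * real n" if "n \<ge> T" for n
      using that
    proof (induction n rule: dec_induct)
      case (step n)
      then show ?case using increment[of n] by (simp add: algebra_simps)
    qed (simp add: c0_def)
    have "(\<lambda>n. (\<Sum>k<n. increment k \<omega>) / real n - c0 / real n - v n / real n + rate) \<longlonglongrightarrow> 0 - 0 - 0 + rate"
    proof (intro tendsto_add tendsto_diff tendsto_const elim(1) lim_const_over_n)
      show "(\<lambda>n. v n / real n) \<longlonglongrightarrow> 0"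
      proof (rule Lim_null_comparison[OF _ lim_const_over_n[of corrector_bound]])
        show "\<forall>\<^sub>F n in sequentially. norm (v n / real n) \<le> corrector_bound / real n"
          using eventually_ge_at_top[of T] by eventually_elim (auto intro!: divide_right_mono v)
      qed
    qed
    moreover have "\<forall>\<^sub>F n in sequentially. (\<Sum>k<n. increment k \<omega>) / real n - c0 / real n - v n / real n + rate = 1 / real n * l n"
      using eventually_ge_at_top[of "max 1 T"]
      by eventually_elim (simp add: sumD field_simps)
    ultimately have "(\<lambda>n. 1 / real n * l n) \<longlonglongrightarrow> 0 - 0 - 0 + rate"
      by (rule Lim_transform_eventually)
    then show ?case by (simp add: l_def rate_eq)
  qed
qed

end

section \<open>The Markov property of the walk\<close>

abbreviation seqM :: "(nat \<Rightarrow> 's) measure" where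
  "seqM \<equiv> PiM UNIV (\<lambda>_. count_space UNIV)"

context regular_language_walk
begin

lemma prob_space_P: "prob_space (P w)"
  using markov[of w] by (simp add: markov_chain_def)

sublocale P: prob_space "P w" for w by (rule prob_space_P)

lemma X_meas[measurable]: "X n \<in> P w \<rightarrow>\<^sub>M count_space UNIV"
  using markov[of w] by (simp add: markov_chain_def)

definition trace :: "nat \<Rightarrow> 'w \<Rightarrow> 'a list list" where
  "trace n \<omega> = map (\<lambda>i. X i \<omega>) [0..<Suc n]"

lemma trace_meas[measurable]: "trace n \<in> P w \<rightarrow>\<^sub>M count_space UNIV"
  unfolding trace_def by (rule measurable_map_upt) simp

lemma seq_meas[measurable]: "(\<lambda>\<omega> k. X (m + k) \<omega>) \<in> P w \<rightarrow>\<^sub>M seqM"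
  by (rule measurable_PiM_single') auto

lemma seq_meas0[measurable]: "(\<lambda>\<omega> k. X k \<omega>) \<in> P w \<rightarrow>\<^sub>M seqM"
  using seq_meas[of 0] by simp

lemma pred_seq:
  assumes [measurable]: "Measurable.pred seqM \<Phi>"
  shows "Measurable.pred (P w) (\<lambda>\<omega>. \<Phi> (\<lambda>k. X (m + k) \<omega>))" "Measurable.pred (P w) (\<lambda>\<omega>. \<Phi> (\<lambda>k. X k \<omega>))"
  using measurable_compose[OF seq_meas assms] measurable_compose[OF seq_meas0 assms] by auto

lemma length_trace[simp]: "length (trace n \<omega>) = Suc n" by (simp add: trace_def)

lemma nth_trace[simp]: "i \<le> n \<Longrightarrow> trace n \<omega> ! i = X i \<omega>"
  by (simp add: trace_def del: upt_Suc)

lemma last_trace[simp]: "last (trace n \<omega>) = X n \<omega>" by (simp add: trace_def)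

lemma hd_trace[simp]: "hd (trace n \<omega>) = X 0 \<omega>" by (simp add: trace_def upt_conv_Cons del: upt_Suc)

lemma trace_eq_iff: "length l = Suc n \<Longrightarrow> trace n \<omega> = l \<longleftrightarrow> (\<forall>i\<le>n. X i \<omega> = l ! i)"
  by (auto simp: list_eq_iff_nth_eq less_Suc_eq_le)

lemma prob_trace:
  assumes "length l = n"
  shows "\<P>(\<omega> in P w. trace n \<omega> = v # l) = (if v = w then path_prod p w l else 0)"
proof -
  have "\<P>(\<omega> in P w. trace n \<omega> = v # l) = \<P>(\<omega> in P w. \<forall>i\<le>n. X i \<omega> = (v # l) ! i)"
    using assms by (simp add: trace_eq_iff)
  also have "\<dots> = indicator {w} v * (\<Prod>i<n. p ((v # l) ! i) ((v # l) ! Suc i))"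
    using markov[of w] unfolding markov_chain_def
    by (elim conjE allE[of _ n] allE[of _ "\<lambda>i. (v # l) ! i"]) simp
  finally show ?thesis using assms by (auto simp: path_prod_eq_prod)
qed

definition strace :: "nat \<Rightarrow> nat \<Rightarrow> 'w \<Rightarrow> 'a list list" where
  "strace m n \<omega> = map (\<lambda>i. X (m + i) \<omega>) [0..<Suc n]"

lemma strace_meas[measurable]: "strace m n \<in> P w \<rightarrow>\<^sub>M count_space UNIV"
  unfolding strace_def by (rule measurable_map_upt) simp

lemma trace_add: "trace (m + n) \<omega> = trace m \<omega> @ tl (strace m n \<omega>)"
proof -
  have "strace m n \<omega> = X m \<omega> # map (\<lambda>i. X (m + i) \<omega>) [1..<Suc n]"
    by (simp add: strace_def upt_conv_Cons del: upt_Suc)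
  moreover have "trace (m + n) \<omega> = trace m \<omega> @ map (\<lambda>i. X i \<omega>) [Suc m..<Suc (m + n)]"
    using upt_add_eq_append[of 0 "Suc m" n] by (simp add: trace_def del: upt_Suc)
  moreover have "map (\<lambda>i. X i \<omega>) [Suc m..<Suc (m + n)] = map (\<lambda>i. X (m + i) \<omega>) [1..<Suc n]"
    by (rule nth_equalityI) (simp_all del: upt_Suc)
  ultimately show ?thesis by simp
qed

lemma strace_eq_Cons:
  assumes l: "length l = m" and l': "length l' = n"
  shows "trace m \<omega> = w # l \<and> strace m n \<omega> = v # l' \<longleftrightarrow> v = last (w # l) \<and> trace (m + n) \<omega> = w # l @ l'"
proof -
  have hd: "hd (strace m n \<omega>) = X m \<omega>" by (simp add: strace_def upt_conv_Cons del: upt_Suc)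
  have ne: "strace m n \<omega> \<noteq> []" by (simp add: strace_def)
  show ?thesis
  proof
    assume a: "trace m \<omega> = w # l \<and> strace m n \<omega> = v # l'"
    then have "X m \<omega> = last (w # l)" by (metis last_trace)
    with a hd show "v = last (w # l) \<and> trace (m + n) \<omega> = w # l @ l'" by (simp add: trace_add)
  next
    assume a: "v = last (w # l) \<and> trace (m + n) \<omega> = w # l @ l'"
    then have 1: "trace m \<omega> = w # l" "tl (strace m n \<omega>) = l'"
      using append_eq_append_conv[of "trace m \<omega>" "w # l" "tl (strace m n \<omega>)" l'] l
      by (auto simp: trace_add)
    then have "X m \<omega> = v" using a by (metis last_trace)
    then show "trace m \<omega> = w # l \<and> strace m n \<omega> = v # l'"
      using 1 hd ne by (metis list.collapse)
  qed
qed

lemma emeasure_distr_restrict: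
  assumes E[measurable]: "Measurable.pred (P w) E" and f[measurable]: "f \<in> P w \<rightarrow>\<^sub>M M" and A[measurable]: "A \<in> sets M"
  shows "emeasure (distr (density (P w) (indicator {\<omega> \<in> space (P w). E \<omega>})) M f) A
    = emeasure (P w) {\<omega> \<in> space (P w). E \<omega> \<and> f \<omega> \<in> A}"
proof -
  have "emeasure (distr (density (P w) (indicator {\<omega> \<in> space (P w). E \<omega>})) M f) A
    = emeasure (density (P w) (indicator {\<omega> \<in> space (P w). E \<omega>})) (f -` A \<inter> space (P w))"
    by (subst emeasure_distr) auto
  also have "\<dots> = emeasure (P w) ({\<omega> \<in> space (P w). E \<omega>} \<inter> (f -` A \<inter> space (P w)))"
    by (rule emeasure_restricted) measurable
  also have "{\<omega> \<in> space (P w). E \<omega>} \<inter> (f -` A \<inter> space (P w)) = {\<omega> \<in> space (P w). E \<omega> \<and> f \<omega> \<in> A}" by auto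
  finally show ?thesis .
qed

text \<open>Both sides are measures in \<open>Y\<close> on a countable set of lists, so it suffices
  to compare them on single lists, where the path products factorise.\<close>

lemma markov_trace_trace:
  assumes l: "length l = m"
  shows "emeasure (P w) {\<omega> \<in> space (P w). trace m \<omega> = w # l \<and> strace m n \<omega> \<in> Y}
    = emeasure (P w) {\<omega> \<in> space (P w). trace m \<omega> = w # l}
      * emeasure (P (last (w # l))) {\<omega> \<in> space (P (last (w # l))). trace n \<omega> \<in> Y}"
proof -
  let ?z = "last (w # l)"
  let ?M1 = "distr (density (P w) (indicator {\<omega> \<in> space (P w). trace m \<omega> = w # l})) (count_space UNIV) (strace m n)"
  let ?M2 = "scale_measure (emeasure (P w) {\<omega> \<in> space (P w). trace m \<omega> = w # l})
      (distr (P ?z) (count_space UNIV) (trace n))"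
  have M1: "emeasure ?M1 A = emeasure (P w) {\<omega> \<in> space (P w). trace m \<omega> = w # l \<and> strace m n \<omega> \<in> A}" for A
    by (rule emeasure_distr_restrict) auto
  have M2: "emeasure ?M2 A = emeasure (P w) {\<omega> \<in> space (P w). trace m \<omega> = w # l}
      * emeasure (P ?z) {\<omega> \<in> space (P ?z). trace n \<omega> \<in> A}" for A
    by (simp add: emeasure_distr vimage_def Int_def conj_commute)
  have "?M1 = ?M2"
  proof (rule measure_eqI_countable[of _ UNIV])
    fix a :: "'a list list"
    show "emeasure ?M1 {a} = emeasure ?M2 {a}"
    proof (cases "length a = Suc n")
      case True
      then obtain v l' where a: "a = v # l'" "length l' = n" by (auto simp: length_Suc_conv)
      have "{\<omega> \<in> space (P w). trace m \<omega> = w # l \<and> strace m n \<omega> \<in> {a}} =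
          (if v = ?z then {\<omega> \<in> space (P w). trace (m + n) \<omega> = w # l @ l'} else {})"
        using strace_eq_Cons[OF l a(2)] by (auto simp: a(1))
      then have "emeasure ?M1 {a} = (if v = ?z then ennreal (path_prod p w (l @ l')) else 0)"
        unfolding M1 using prob_trace[of "l @ l'" "m + n" w w] l a(2) by (simp add: P.emeasure_eq_measure)
      also have "\<dots> = ennreal (path_prod p w l) * (if v = ?z then path_prod p ?z l' else 0)"
        by (simp add: path_prod_append ennreal_mult' prod_nonneg path_prod_eq_prod[of p w l])
      also have "\<dots> = emeasure ?M2 {a}"
        unfolding M2 using prob_trace[OF l, of w w] prob_trace[OF a(2), of ?z v]
        by (simp add: P.emeasure_eq_measure a(1))
      finally show ?thesis .
    next
      case False
      then have "strace m n \<omega> \<noteq> a" "trace n \<omega> \<noteq> a" for \<omega> by (auto simp: strace_def)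
      then show ?thesis unfolding M1 M2 by simp
    qed
  qed auto
  then show ?thesis using M1[of Y] M2[of Y] by simp
qed

text \<open>The finite-horizon version determines the law of the shifted walk on cylinders, and
  cylinders determine a finite measure on the sequence space.\<close>

lemma markov_trace_seq:
  assumes l: "length l = m" and \<Phi>[measurable]: "Measurable.pred seqM \<Phi>"
  shows "emeasure (P w) {\<omega> \<in> space (P w). trace m \<omega> = w # l \<and> \<Phi> (\<lambda>k. X (m + k) \<omega>)}
    = emeasure (P w) {\<omega> \<in> space (P w). trace m \<omega> = w # l}
      * emeasure (P (last (w # l))) {\<omega> \<in> space (P (last (w # l))). \<Phi> (\<lambda>k. X k \<omega>)}"
proof -
  let ?z = "last (w # l)"
  let ?M1 = "distr (density (P w) (indicator {\<omega> \<in> space (P w). trace m \<omega> = w # l})) seqM (\<lambda>\<omega> k. X (m + k) \<omega>)"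
  let ?M2 = "scale_measure (emeasure (P w) {\<omega> \<in> space (P w). trace m \<omega> = w # l})
      (distr (P ?z) seqM (\<lambda>\<omega> k. X k \<omega>))"
  have M1: "emeasure ?M1 A = emeasure (P w) {\<omega> \<in> space (P w). trace m \<omega> = w # l \<and> (\<lambda>k. X (m + k) \<omega>) \<in> A}"
    if "A \<in> sets seqM" for A
    using that by (intro emeasure_distr_restrict) auto
  have M2: "emeasure ?M2 A = emeasure (P w) {\<omega> \<in> space (P w). trace m \<omega> = w # l}
      * emeasure (P ?z) {\<omega> \<in> space (P ?z). (\<lambda>k. X k \<omega>) \<in> A}" if "A \<in> sets seqM" for A
    using that by (simp add: emeasure_distr vimage_def Int_def conj_commute)
  have "?M1 = ?M2"
  proof (rule measure_eqI_PiM_infinite[of _ UNIV "\<lambda>_. count_space UNIV"])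
    fix A :: "nat \<Rightarrow> 'a list set" and J :: "nat set"
    assume J: "finite J"
    let ?B = "prod_emb UNIV (\<lambda>_. count_space UNIV) J (Pi\<^sub>E J A)"
    have B: "?B \<in> sets seqM" using J by (intro sets_PiM_I) auto
    obtain n where n: "\<And>j. j \<in> J \<Longrightarrow> j \<le> n" using J finite_nat_set_iff_bounded_le by auto
    \<comment> \<open>A cylinder over the finite index set \<open>J\<close> is an event of the trace
      up to any \<open>n\<close> above \<open>J\<close>.\<close>
    define Y where "Y = {l'. length l' = Suc n \<and> (\<forall>j\<in>J. l' ! j \<in> A j)}"
    have "(\<lambda>k. X (m + k) \<omega>) \<in> ?B \<longleftrightarrow> strace m n \<omega> \<in> Y" "(\<lambda>k. X k \<omega>) \<in> ?B \<longleftrightarrow> trace n \<omega> \<in> Y" for \<omega>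
      using n by (auto simp: prod_emb_def Y_def strace_def PiE_def restrict_def Pi_def extensional_def less_Suc_eq_le simp del: upt_Suc)
    then show "emeasure ?M1 ?B = emeasure ?M2 ?B"
      unfolding M1[OF B] M2[OF B] using markov_trace_trace[OF l] by simp
  next
    show "finite_measure ?M1"
      by (rule finite_measureI) (use M1[OF sets.top] in \<open>simp add: P.emeasure_eq_measure space_PiM\<close>)
  qed auto
  moreover have s: "{x \<in> space seqM. \<Phi> x} \<in> sets seqM" by measurable
  ultimately show ?thesis using M1[OF s] M2[OF s] by (simp add: space_PiM del: last.simps)
qed

text \<open>An arbitrary event of the past is a countable union of single traces, so the version for
  a fixed trace is summed by comparing two measures on trace lists.\<close>

theorem markov_property:
  assumes \<Phi>[measurable]: "Measurable.pred seqM \<Phi>"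
  shows "\<P>(\<omega> in P w. \<Psi> (trace m \<omega>) \<and> X m \<omega> = z \<and> \<Phi> (\<lambda>k. X (m + k) \<omega>))
    = \<P>(\<omega> in P w. \<Psi> (trace m \<omega>) \<and> X m \<omega> = z) * \<P>(\<omega> in P z. \<Phi> (\<lambda>k. X k \<omega>))"
proof -
  note [measurable] = pred_seq[OF \<Phi>]
  let ?c = "emeasure (P z) {\<omega> \<in> space (P z). \<Phi> (\<lambda>k. X k \<omega>)}"
  let ?M1 = "distr (density (P w) (indicator {\<omega> \<in> space (P w). X m \<omega> = z \<and> \<Phi> (\<lambda>k. X (m + k) \<omega>)})) (count_space UNIV) (trace m)"
  let ?M2 = "scale_measure ?c (distr (density (P w) (indicator {\<omega> \<in> space (P w). X m \<omega> = z})) (count_space UNIV) (trace m))"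
  have M1: "emeasure ?M1 A = emeasure (P w) {\<omega> \<in> space (P w). (X m \<omega> = z \<and> \<Phi> (\<lambda>k. X (m + k) \<omega>)) \<and> trace m \<omega> \<in> A}" for A
    by (rule emeasure_distr_restrict) auto
  have M2: "emeasure ?M2 A = ?c * emeasure (P w) {\<omega> \<in> space (P w). X m \<omega> = z \<and> trace m \<omega> \<in> A}" for A
    by (subst emeasure_scale_measure, subst emeasure_distr_restrict) auto
  have "?M1 = ?M2"
  proof (rule measure_eqI_countable[of _ UNIV])
    fix a :: "'a list list"
    show "emeasure ?M1 {a} = emeasure ?M2 {a}"
    proof (cases "length a = Suc m \<and> last a = z")
      case True
      then obtain v l where a: "a = v # l" "length l = m" "last (v # l) = z" by (auto simp: length_Suc_conv)
      have 1: "{\<omega> \<in> space (P w). (X m \<omega> = z \<and> \<Phi> (\<lambda>k. X (m + k) \<omega>)) \<and> trace m \<omega> \<in> {a}}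
          = {\<omega> \<in> space (P w). trace m \<omega> = v # l \<and> \<Phi> (\<lambda>k. X (m + k) \<omega>)}"
        and 2: "{\<omega> \<in> space (P w). X m \<omega> = z \<and> trace m \<omega> \<in> {a}} = {\<omega> \<in> space (P w). trace m \<omega> = v # l}"
        using a(3) unfolding a(1) by (auto simp del: last.simps) (metis last_trace)+
      show ?thesis
      proof (cases "v = w")
        case True
        then show ?thesis
          unfolding M1 M2 1 2 using markov_trace_seq[OF a(2) \<Phi>, of w] a(3) by (simp add: mult.commute)
      next
        \<comment> \<open>A trace that does not begin at the starting word has probability
          0.\<close>
        case False
        have "emeasure (P w) {\<omega> \<in> space (P w). trace m \<omega> = v # l} = 0"
          using prob_trace[OF a(2), of w v] False by (simp add: P.emeasure_eq_measure)
        moreover have "emeasure (P w) {\<omega> \<in> space (P w). trace m \<omega> = v # l \<and> \<Phi> (\<lambda>k. X (m + k) \<omega>)}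
            \<le> emeasure (P w) {\<omega> \<in> space (P w). trace m \<omega> = v # l}"
          by (intro emeasure_mono) auto
        ultimately show ?thesis unfolding M1 M2 1 2 by simp
      qed
    next
      case False
      then have "trace m \<omega> = a \<Longrightarrow> X m \<omega> \<noteq> z" for \<omega> using last_trace[of m \<omega>] by auto
      then have 1: "{\<omega> \<in> space (P w). (X m \<omega> = z \<and> \<Phi> (\<lambda>k. X (m + k) \<omega>)) \<and> trace m \<omega> \<in> {a}} = {}"
        and 2: "{\<omega> \<in> space (P w). X m \<omega> = z \<and> trace m \<omega> \<in> {a}} = {}" by auto
      show ?thesis unfolding M1 M2 1 2 by simp
    qed
  qed auto
  then have "emeasure (P w) {\<omega> \<in> space (P w). \<Psi> (trace m \<omega>) \<and> X m \<omega> = z \<and> \<Phi> (\<lambda>k. X (m + k) \<omega>)}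
      = ?c * emeasure (P w) {\<omega> \<in> space (P w). \<Psi> (trace m \<omega>) \<and> X m \<omega> = z}"
    using M1[of "{l. \<Psi> l}"] M2[of "{l. \<Psi> l}"] by (simp add: conj_ac)
  then show ?thesis
    by (simp add: P.emeasure_eq_measure ennreal_mult'[symmetric] mult.commute)
qed

lemma trace_pred[measurable]: "Measurable.pred (P w) (\<lambda>\<omega>. \<Psi> (trace m \<omega>))"
  by (rule measurable_compose[OF trace_meas]) simp

lemma AE_start: "AE \<omega> in P w. X 0 \<omega> = w"
proof -
  have "\<P>(\<omega> in P w. trace 0 \<omega> = [w]) = 1" using prob_trace[of "[]" 0 w w] by simp
  then have "AE \<omega> in P w. trace 0 \<omega> = [w]" by (subst (asm) P.prob_eq_1) auto
  then show ?thesis by eventually_elim (simp add: trace_def)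
qed

lemma AE_step: "AE \<omega> in P w. \<forall>n. p (X n \<omega>) (X (Suc n) \<omega>) > 0"
proof -
  have "AE \<omega> in P w. p (X n \<omega>) (X (Suc n) \<omega>) > 0" for n
  proof -
    have "AE \<omega> in P w. trace (Suc n) \<omega> = v # l \<longrightarrow> p (X n \<omega>) (X (Suc n) \<omega>) > 0" for v l
    proof (cases "length l = Suc n \<and> path_prod p v l > 0")
      case True
      have "p (X n \<omega>) (X (Suc n) \<omega>) > 0" if "trace (Suc n) \<omega> = v # l" for \<omega>
      proof -
        have "(\<Prod>i<Suc n. p ((v # l) ! i) ((v # l) ! Suc i)) \<noteq> 0"
          using conjunct2[OF True] unfolding path_prod_eq_prod conjunct1[OF True] by linarith
        then have "\<forall>i\<in>{..<Suc n}. p ((v # l) ! i) ((v # l) ! Suc i) \<noteq> 0"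
          unfolding prod_zero_iff[OF finite_lessThan] by blast
        then have "p ((v # l) ! n) ((v # l) ! Suc n) \<noteq> 0" by blast
        then show ?thesis unfolding that[symmetric] by (simp add: less_le)
      qed
      then show ?thesis by simp
    next
      case False
      have "\<P>(\<omega> in P w. trace (Suc n) \<omega> = v # l) = 0"
      proof (cases "length l = Suc n")
        case True
        moreover have "path_prod p v l \<ge> 0" by (simp add: path_prod_eq_prod prod_nonneg)
        ultimately show ?thesis using False prob_trace[OF True, of w v] by (cases "v = w") auto
      next
        case False
        then have "trace (Suc n) \<omega> \<noteq> v # l" for \<omega>
          by (metis length_Cons length_trace nat.inject)
        then show ?thesis by simp
      qed
      then have "AE \<omega> in P w. trace (Suc n) \<omega> \<noteq> v # l" by (subst (asm) P.prob_eq_0) auto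
      then show ?thesis by eventually_elim simp
    qed
    then have "AE \<omega> in P w. \<forall>v l. trace (Suc n) \<omega> = v # l \<longrightarrow> p (X n \<omega>) (X (Suc n) \<omega>) > 0"
      unfolding AE_all_countable by blast
    then show ?thesis
    proof eventually_elim
      case (elim \<omega>)
      then show ?case by (metis length_trace length_Suc_conv)
    qed
  qed
  then show ?thesis by (simp add: AE_all_countable)
qed

end

section \<open>Splitting a word before its last two letters\<close>

lemma stem_append_suffix2: "stem w @ suffix2 w = w"
  by (simp add: stem_def suffix2_def)

lemma length_suffix2: "length w \<ge> 2 \<Longrightarrow> length (suffix2 w) = 2"
  by (simp add: suffix2_def)

lemma suffix2_append: "length w \<ge> 2 \<Longrightarrow> suffix2 (s @ w) = suffix2 w"
  by (simp add: suffix2_def)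

lemma suffix2_id: "length w = 2 \<Longrightarrow> suffix2 w = w"
  by (simp add: suffix2_def)

lemma stem_append: "length w \<ge> 2 \<Longrightarrow> stem (s @ w) = s @ stem w"
  by (simp add: stem_def)

lemma stem_Nil: "length w = 2 \<Longrightarrow> stem w = []"
  by (simp add: stem_def)

lemma snoc2_exists: "length w \<ge> 2 \<Longrightarrow> \<exists>w0 a b. w = w0 @ [a, b]"
  by (metis stem_append_suffix2 length_suffix2 numeral_2_eq_2 length_0_conv length_Suc_conv)

text \<open>Turns a positive probability into a sample point with all almost sure properties, so
  that facts about the law can be read off one trajectory.\<close>

lemma (in prob_space) prob_pos_witness:
  assumes "\<P>(\<omega> in M. E \<omega>) > 0" "AE \<omega> in M. Q \<omega>"
  shows "\<exists>\<omega>\<in>space M. E \<omega> \<and> Q \<omega>"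
proof (rule ccontr)
  assume n: "\<not> ?thesis"
  \<comment> \<open>A nonmeasurable set has \<open>measure\<close> 0 by convention, so positivity
    implies measurability.\<close>
  have "{\<omega> \<in> space M. E \<omega>} \<in> events"
    using assms(1) measure_notin_sets[of "{\<omega> \<in> space M. E \<omega>}" M] by auto
  moreover have "AE \<omega> in M. \<not> E \<omega>"
    using assms(2) AE_space by eventually_elim (use n in blast)
  ultimately have "\<P>(\<omega> in M. E \<omega>) = 0" by (subst prob_eq_0) auto
  then show False using assms(1) by simp
qed

lemma (in prob_space) prob_sums_disjoint:
  assumes [measurable]: "\<And>n::nat. Measurable.pred M (E n)"
    and "\<And>m n \<omega>. E m \<omega> \<Longrightarrow> E n \<omega> \<Longrightarrow> m = n"
  shows "(\<lambda>n. \<P>(\<omega> in M. E n \<omega>)) sums \<P>(\<omega> in M. \<exists>n. E n \<omega>)"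
proof -
  have "(\<lambda>n. prob {\<omega> \<in> space M. E n \<omega>}) sums prob (\<Union>n. {\<omega> \<in> space M. E n \<omega>})"
    using assms(2) by (intro finite_measure_UNION) (auto simp: disjoint_family_on_def)
  moreover have "(\<Union>n. {\<omega> \<in> space M. E n \<omega>}) = {\<omega> \<in> space M. \<exists>n. E n \<omega>}" by auto
  ultimately show ?thesis by simp
qed

section \<open>Cones\<close>

context regular_language_walk
begin

lemma p_pos_iff: "p u v > 0 \<longleftrightarrow> v \<in> set_pmf (K u)"
  by (simp add: set_pmf_iff less_le)

lemma step_suffix: "p (w @ u) v > 0 \<Longrightarrow> length u \<ge> 2 \<Longrightarrow> \<exists>v'. v = w @ v' \<and> length v' \<ge> 1"
  using snoc2_exists[of u] step_long[of v "w @ _"] by (fastforce simp: p_pos_iff)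

lemma step_length: assumes "p u v > 0" shows "length v \<le> length u + 1"
proof -
  consider "u = []" | a where "u = [a]" | "length u \<ge> 2"
    by (cases u rule: list.exhaust; cases "tl u") auto
  then show ?thesis
  proof cases
    case 3
    then obtain w a b where "u = w @ [a, b]" using snoc2_exists by blast
    then show ?thesis using assms step_long[of v w a b] by (auto simp: p_pos_iff)
  qed (use assms step_empty step_letter in \<open>force simp: p_pos_iff\<close>)+
qed

text \<open>The locale states homogeneity only for targets of the admissible form; for all other
  targets both probabilities are 0.\<close>

lemma p_shift: assumes "length u \<ge> 2" shows "p (s @ u) (s @ v) = p u v"
proof -
  obtain w a b where u: "u = w @ [a, b]" using snoc2_exists assms by blast
  show ?thesis
  proof (cases "\<exists>x. v = w @ x \<and> length x \<in> {1, 2, 3}")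
    case True
    then obtain x where x: "v = w @ x" "length x \<in> {1, 2, 3}" by blast
    show ?thesis
      using step_long_homogeneous[OF x(2), of w] step_long_homogeneous[OF x(2), of "s @ w"] by (simp add: u x)
  next
    case False
    have "\<not> p u v > 0" using False step_long[of v w a b] by (auto simp: p_pos_iff u)
    moreover have "\<not> p (s @ u) (s @ v) > 0"
      using False step_long[of "s @ v" "s @ w" a b] by (auto simp: p_pos_iff u)
    ultimately show ?thesis by (simp add: not_less pmf_nonneg order.antisym)
  qed
qed

text \<open>The level is a parameter so that cones at different heights can be compared by
  monotonicity of the closure.\<close>

definition cone_step :: "nat \<Rightarrow> 'a list \<Rightarrow> 'a list \<Rightarrow> bool" where
  "cone_step n u v \<longleftrightarrow> length u \<ge> n \<and> length v \<ge> n \<and> p u v > 0"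

lemma cone_iff: "u \<in> cone w \<longleftrightarrow> (cone_step (length w))\<^sup>*\<^sup>* w u"
  by (simp add: cone_def cone_step_def[abs_def])

lemma cone_refl[simp]: "w \<in> cone w" by (simp add: cone_iff)

lemma cone_length: "u \<in> cone w \<Longrightarrow> length u \<ge> length w"
  unfolding cone_iff by (erule rtranclp.cases) (auto simp: cone_step_def)

lemma cone_closed: "u \<in> cone w \<Longrightarrow> p u v > 0 \<Longrightarrow> length v \<ge> length w \<Longrightarrow> v \<in> cone w"
  using cone_length[of u w] unfolding cone_iff by (auto intro: rtranclp.rtrancl_into_rtrancl simp: cone_step_def)

lemma cone_mono: assumes "u \<in> cone w" shows "cone u \<subseteq> cone w"
proof
  fix v assume "v \<in> cone u"
  then have "(cone_step (length u))\<^sup>*\<^sup>* u v" by (simp add: cone_iff)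
  moreover have "cone_step (length u) \<le> cone_step (length w)"
    using cone_length[OF assms] by (auto simp: cone_step_def le_fun_def)
  ultimately have "(cone_step (length w))\<^sup>*\<^sup>* u v" using rtranclp_mono by blast
  then show "v \<in> cone w" using assms unfolding cone_iff by simp
qed

text \<open>All words on a path inside the cone have at least two letters after \<open>s\<close>, so
  no step can touch \<open>s\<close> and every step is translation invariant.\<close>

lemma cone_append: assumes w: "length w \<ge> 2" shows "cone (s @ w) = (@) s ` cone w"
proof -
  have "u \<in> (@) s ` cone w" if "(cone_step (length (s @ w)))\<^sup>*\<^sup>* (s @ w) u" for u
    using that
  proof induction
    case (step u v)
    then obtain u' where u': "u = s @ u'" "u' \<in> cone w" by auto
    then have "length u' \<ge> 2" using w cone_length[of u' w] by simp
    then obtain v' where v': "v = s @ v'" using step(2) step_suffix[of s u' v] u' by (auto simp: cone_step_def)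
    have "p u' v' > 0" "length v' \<ge> length w"
      using step(2) p_shift[OF \<open>length u' \<ge> 2\<close>, of s v'] u' v' by (auto simp: cone_step_def)
    then show ?case using cone_closed[OF u'(2)] v' by auto
  qed simp
  moreover have "s @ u \<in> cone (s @ w)" if "(cone_step (length w))\<^sup>*\<^sup>* w u" for u
    using that
  proof induction
    case (step u v)
    then show ?case
      using w p_shift[of u s v] by (intro cone_closed[OF step(3)]) (auto simp: cone_step_def)
  qed simp
  ultimately show ?thesis unfolding cone_iff[of _ "s @ w", symmetric] by (auto simp flip: cone_iff)
qed

lemma cone_suffix2: "length w \<ge> 2 \<Longrightarrow> cone w = (@) (stem w) ` cone_type w"
  unfolding cone_type_def using cone_append[of "suffix2 w" "stem w"]
  by (simp add: length_suffix2 stem_append_suffix2)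

lemma cone_type_append: "length w \<ge> 2 \<Longrightarrow> cone_type (s @ w) = cone_type w"
  by (simp add: cone_type_def suffix2_append)

lemma cone_type_suffix2: "length w \<ge> 2 \<Longrightarrow> cone_type (suffix2 w) = cone_type w"
  by (simp add: cone_type_def suffix2_id length_suffix2)

lemma cone_type_in: "length w \<ge> 2 \<Longrightarrow> cone_type w \<in> cone_types"
  using snoc2_exists[of w] unfolding cone_types_def cone_type_def
  by (force simp: suffix2_append suffix2_id)

lemma cone_prefix: "u \<in> cone w \<Longrightarrow> length w \<ge> 2 \<Longrightarrow> \<exists>x. u = stem w @ x \<and> length x \<ge> 2"
  using cone_suffix2[of w] cone_length[of _ "suffix2 w"] length_suffix2[of w] by (auto simp: cone_type_def)

lemma finite_words: "finite {u :: 'a list. length u = n}"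
  using finite_lists_length_eq[of "UNIV :: 'a set" n] by simp

lemma boundary_subset: "boundary w \<subseteq> cone w" by (auto simp: boundary_def)

lemma finite_boundary: "finite (boundary w)"
  by (rule finite_subset[OF _ finite_words[of "length w"]]) (auto simp: boundary_def)

subsection \<open>Positive probabilities\<close>

lemma ball_trace: "(\<forall>x\<in>set (trace n \<omega>). D x) \<longleftrightarrow> (\<forall>m\<le>n. D (X m \<omega>))"
  by (auto simp: trace_def less_Suc_eq_le simp del: upt_Suc)

lemma prob_step: "\<P>(\<omega> in P u. X 1 \<omega> = v) = p u v"
proof -
  have "\<P>(\<omega> in P u. X 1 \<omega> = v) = \<P>(\<omega> in P u. trace 1 \<omega> = [u, v])"
    using AE_start[of u] by (intro P.prob_eq_AE) (auto simp: trace_def)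
  then show ?thesis using prob_trace[of "[v]" 1 u u] by simp
qed

text \<open>With \<open>reach_of_pos\<close> this translates between paths of possible steps inside
  \<open>D\<close> and events of positive probability.\<close>

lemma pos_of_reach:
  assumes "(\<lambda>u v. D u \<and> D v \<and> p u v > 0)\<^sup>*\<^sup>* u w" "D u"
  shows "\<exists>n. \<P>(\<omega> in P u. (\<forall>m\<le>n. D (X m \<omega>)) \<and> X n \<omega> = w) > 0"
  using assms(1)
proof induction
  case base
  have "\<P>(\<omega> in P u. (\<forall>m\<le>0. D (X m \<omega>)) \<and> X 0 \<omega> = u) = 1"
    by (subst P.prob_eq_1) (use AE_start[of u] assms(2) in \<open>auto elim: eventually_mono\<close>)
  then show ?case by (intro exI[of _ 0]) simp
next
  case (step v w)
  then obtain n where n: "\<P>(\<omega> in P u. (\<forall>m\<le>n. D (X m \<omega>)) \<and> X n \<omega> = v) > 0" by blast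
  have "\<P>(\<omega> in P u. (\<forall>m\<le>n. D (X m \<omega>)) \<and> X n \<omega> = v \<and> X (n + 1) \<omega> = w)
      = \<P>(\<omega> in P u. (\<forall>m\<le>n. D (X m \<omega>)) \<and> X n \<omega> = v) * p v w"
    using markov_property[of "\<lambda>f. f 1 = w" u "\<lambda>l. \<forall>x\<in>set l. D x" n v] prob_step[of v w]
    by (simp add: ball_trace)
  then have "0 < \<P>(\<omega> in P u. (\<forall>m\<le>n. D (X m \<omega>)) \<and> X n \<omega> = v \<and> X (n + 1) \<omega> = w)"
    using n step by simp
  also have "\<dots> \<le> \<P>(\<omega> in P u. (\<forall>m\<le>Suc n. D (X m \<omega>)) \<and> X (Suc n) \<omega> = w)"
    using step by (intro P.finite_measure_mono) (auto simp: le_Suc_eq)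
  finally show ?case by blast
qed

lemma path_reach:
  assumes "\<And>n. p (X n \<omega>) (X (Suc n) \<omega>) > 0" "\<And>k. k \<le> n \<Longrightarrow> D (X k \<omega>)"
  shows "(\<lambda>u v. D u \<and> D v \<and> p u v > 0)\<^sup>*\<^sup>* (X 0 \<omega>) (X n \<omega>)"
  using assms(2)
proof (induction n)
  case (Suc n)
  have "(\<lambda>u v. D u \<and> D v \<and> p u v > 0)\<^sup>*\<^sup>* (X 0 \<omega>) (X n \<omega>)" using Suc by simp
  then show ?case
    by (rule rtranclp.rtrancl_into_rtrancl) (use assms(1)[of n] Suc.prems in auto)
qed simp

lemma reach_of_pos:
  assumes "\<P>(\<omega> in P u. X n \<omega> = w \<and> (\<forall>k\<le>n. D (X k \<omega>))) > 0"
  shows "(\<lambda>u v. D u \<and> D v \<and> p u v > 0)\<^sup>*\<^sup>* u w"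
proof -
  have "AE \<omega> in P u. X 0 \<omega> = u \<and> (\<forall>n. p (X n \<omega>) (X (Suc n) \<omega>) > 0)"
    using AE_start AE_step by eventually_elim auto
  from P.prob_pos_witness[OF assms this]
  obtain \<omega> where \<omega>: "X n \<omega> = w" "\<forall>k\<le>n. D (X k \<omega>)" "X 0 \<omega> = u" "\<forall>n. p (X n \<omega>) (X (Suc n) \<omega>) > 0"
    by blast
  then show ?thesis using path_reach[of \<omega> n D] by simp
qed

lemma language_iff: "w \<in> language \<longleftrightarrow> (\<lambda>u v. p u v > 0)\<^sup>*\<^sup>* [] w"
  using reach_of_pos[of "[]" _ w "\<lambda>_. True"] pos_of_reach[of "\<lambda>_. True" "[]" w]
  by (auto simp: language_def)

lemma language_closed: "u \<in> language \<Longrightarrow> p u v > 0 \<Longrightarrow> v \<in> language"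
  unfolding language_iff by (rule rtranclp.rtrancl_into_rtrancl)

lemma cone_subset_language: assumes "w \<in> language" shows "cone w \<subseteq> language"
proof
  fix u assume "u \<in> cone w"
  then have "(cone_step (length w))\<^sup>*\<^sup>* w u" by (simp add: cone_iff)
  then show "u \<in> language" by induction (use assms language_closed in \<open>auto simp: cone_step_def\<close>)
qed

subsection \<open>Homogeneity\<close>

lemma path_prod_shift:
  "length x \<ge> 2 \<Longrightarrow> (\<forall>y\<in>set l. length y \<ge> 2) \<Longrightarrow>
    path_prod p (s @ x) (map ((@) s) l) = path_prod p x l"
  by (induction l arbitrary: x) (auto simp: p_shift)

text \<open>Homogeneity for finite trajectories whose words all keep at least two letters beyond the
  common prefix \<open>s\<close>.\<close>

lemma prob_trace_shift:
  assumes x: "length x \<ge> 2" and G: "\<And>l y. l \<in> G \<Longrightarrow> y \<in> set l \<Longrightarrow> length y \<ge> 2"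
  shows "\<P>(\<omega> in P (s @ x). trace n \<omega> \<in> map ((@) s) ` G) = \<P>(\<omega> in P x. trace n \<omega> \<in> G)"
proof -
  \<comment> \<open>Removing the prefix inverts the translation, so both laws become measures on the
    same lists and can be compared point by point.\<close>
  let ?g = "map (drop (length s)) :: 'a list list \<Rightarrow> 'a list list"
  let ?M1 = "distr (density (P (s @ x)) (indicator {\<omega> \<in> space (P (s @ x)). trace n \<omega> \<in> map ((@) s) ` G}))
    (count_space UNIV) (\<lambda>\<omega>. ?g (trace n \<omega>))"
  let ?M2 = "distr (density (P x) (indicator {\<omega> \<in> space (P x). trace n \<omega> \<in> G})) (count_space UNIV) (trace n)"
  have M1: "emeasure ?M1 A = emeasure (P (s @ x)) {\<omega> \<in> space (P (s @ x)).
      trace n \<omega> \<in> map ((@) s) ` G \<and> ?g (trace n \<omega>) \<in> A}" for A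
    by (rule emeasure_distr_restrict) auto
  have M2: "emeasure ?M2 A = emeasure (P x) {\<omega> \<in> space (P x). trace n \<omega> \<in> G \<and> trace n \<omega> \<in> A}" for A
    by (rule emeasure_distr_restrict) auto
  have inv: "?g (map ((@) s) l) = l" for l by (simp add: comp_def)
  have "?M1 = ?M2"
  proof (rule measure_eqI_countable[of _ UNIV])
    fix a :: "'a list list"
    have 1: "{\<omega> \<in> space (P (s @ x)). trace n \<omega> \<in> map ((@) s) ` G \<and> ?g (trace n \<omega>) \<in> {a}}
      = (if a \<in> G then {\<omega> \<in> space (P (s @ x)). trace n \<omega> = map ((@) s) a} else {})"
      using inv by auto
    have 2: "{\<omega> \<in> space (P x). trace n \<omega> \<in> G \<and> trace n \<omega> \<in> {a}}
      = (if a \<in> G then {\<omega> \<in> space (P x). trace n \<omega> = a} else {})" by auto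
    show "emeasure ?M1 {a} = emeasure ?M2 {a}"
    proof (cases "a \<in> G \<and> length a = Suc n")
      case True
      then obtain v l where a: "a = v # l" "length l = n" by (auto simp: length_Suc_conv)
      then have "\<P>(\<omega> in P (s @ x). trace n \<omega> = map ((@) s) a) = \<P>(\<omega> in P x. trace n \<omega> = a)"
        using prob_trace[of "map ((@) s) l" n "s @ x" "s @ v"] prob_trace[of l n x v] x G[of a] True
        by (auto simp: path_prod_shift)
      then show ?thesis unfolding M1 M2 1 2 by (simp add: P.emeasure_eq_measure)
    next
      case False
      then have "a \<in> G \<Longrightarrow> trace n \<omega> \<noteq> a" "a \<in> G \<Longrightarrow> trace n \<omega> \<noteq> map ((@) s) a" for \<omega>
        by (metis length_trace length_map)+
      then show ?thesis unfolding M1 M2 1 2 by simp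
    qed
  qed auto
  then show ?thesis using M1[of UNIV] M2[of UNIV] by (simp add: P.emeasure_eq_measure)
qed

section \<open>Staying in a cone and entering a subcone\<close>

definition stay :: "'a list \<Rightarrow> real" where
  "stay w = \<P>(\<omega> in P w. \<forall>n. X n \<omega> \<in> cone w)"

definition first_entry :: "'a list \<Rightarrow> 'a list \<Rightarrow> nat \<Rightarrow> real" where
  "first_entry x y n = \<P>(\<omega> in P x.
      X (Suc n) \<omega> = y \<and> X n \<omega> \<notin> cone y \<and> (\<forall>m\<le>Suc n. X m \<omega> \<in> cone x))"

lemma stay_limit: "(\<lambda>n. \<P>(\<omega> in P w. \<forall>m\<le>n. X m \<omega> \<in> cone w)) \<longlonglongrightarrow> stay w"
proof -
  have "(\<lambda>n. P.prob w {\<omega> \<in> space (P w). \<forall>m\<le>n. X m \<omega> \<in> cone w})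
      \<longlonglongrightarrow> P.prob w (\<Inter>n. {\<omega> \<in> space (P w). \<forall>m\<le>n. X m \<omega> \<in> cone w})"
    by (intro P.finite_Lim_measure_decseq) (auto simp: decseq_def)
  moreover have "(\<Inter>n. {\<omega> \<in> space (P w). \<forall>m\<le>n. X m \<omega> \<in> cone w}) = {\<omega> \<in> space (P w). \<forall>n. X n \<omega> \<in> cone w}"
    by auto
  ultimately show ?thesis by (simp add: stay_def)
qed

text \<open>Homogeneity is available for finite horizons; the infinite horizon follows by continuity
  from above.\<close>

lemma stay_append: assumes x: "length x \<ge> 2" shows "stay (s @ x) = stay x"
proof -
  have len: "length y \<ge> 2" if "y \<in> cone x" for y using cone_length[OF that] x by simp
  have "\<P>(\<omega> in P (s @ x). \<forall>m\<le>n. X m \<omega> \<in> cone (s @ x)) = \<P>(\<omega> in P x. \<forall>m\<le>n. X m \<omega> \<in> cone x)" for n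
  proof -
    have "\<P>(\<omega> in P (s @ x). trace n \<omega> \<in> map ((@) s) ` {l. set l \<subseteq> cone x}) = \<P>(\<omega> in P x. trace n \<omega> \<in> {l. set l \<subseteq> cone x})"
      using x len by (intro prob_trace_shift) auto
    moreover have "map ((@) s) ` {l. set l \<subseteq> cone x} = {l. set l \<subseteq> (@) s ` cone x}"
      using lists_image[of "(@) s" "cone x"] by (auto simp: lists_eq_set)
    ultimately show ?thesis
      unfolding cone_append[OF x] subset_eq mem_Collect_eq ball_trace by (simp add: ball_trace)
  qed
  then show ?thesis using stay_limit[of "s @ x"] stay_limit[of x] LIMSEQ_unique by auto
qed

text \<open>From a word of two letters, keeping length at least 2 means staying in its cone. So
  \<open>stay\<close> extends \<xi> to longer words.\<close>

lemma stay_eq_\<xi>: assumes "length w \<ge> 2" shows "stay w = \<xi> (suffix2 w)"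
proof -
  have l: "length (suffix2 w) = 2" using length_suffix2[OF assms] .
  have "stay w = stay (suffix2 w)"
    using stay_append[of "suffix2 w" "stem w"] l by (simp add: stem_append_suffix2)
  also have "\<dots> = \<xi> (suffix2 w)"
    unfolding stay_def \<xi>_def
  proof (rule P.prob_eq_AE)
    show "AE \<omega> in P (suffix2 w). (\<forall>n. X n \<omega> \<in> cone (suffix2 w)) \<longleftrightarrow> (\<forall>n. 2 \<le> length (X n \<omega>))"
      using AE_start AE_step
    proof eventually_elim
      case (elim \<omega>)
      have "X n \<omega> \<in> cone (suffix2 w)" if "\<forall>n. 2 \<le> length (X n \<omega>)" for n
      proof (induction n)
        case (Suc n)
        then show ?case using elim that l by (intro cone_closed[OF Suc]) auto
      qed (simp add: elim)
      then show ?case using cone_length[of _ "suffix2 w"] l by fastforce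
    qed
  qed auto
  finally show ?thesis .
qed

lemma first_entry_append:
  assumes x: "length x \<ge> 2" and y: "length y \<ge> 2"
  shows "first_entry (s @ x) (s @ y) n = first_entry x y n"
proof -
  define G where "G = {l. set l \<subseteq> cone x \<and> l ! Suc n = y \<and> l ! n \<notin> cone y \<and> length l = Suc (Suc n)}"
  have len: "length z \<ge> 2" if "z \<in> cone x" for z using cone_length[OF that] x by simp
  have 1: "\<P>(\<omega> in P (s @ x). trace (Suc n) \<omega> \<in> map ((@) s) ` G) = \<P>(\<omega> in P x. trace (Suc n) \<omega> \<in> G)"
    using x len by (intro prob_trace_shift) (auto simp: G_def)
  have 2: "trace (Suc n) \<omega> \<in> G \<longleftrightarrow> X (Suc n) \<omega> = y \<and> X n \<omega> \<notin> cone y \<and> (\<forall>m\<le>Suc n. X m \<omega> \<in> cone x)" for \<omega>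
    by (auto simp: G_def subset_eq ball_trace)
  have 3: "trace (Suc n) \<omega> \<in> map ((@) s) ` G \<longleftrightarrow>
      X (Suc n) \<omega> = s @ y \<and> X n \<omega> \<notin> cone (s @ y) \<and> (\<forall>m\<le>Suc n. X m \<omega> \<in> cone (s @ x))" (is "?A \<longleftrightarrow> ?B") for \<omega>
  proof
    assume ?A
    then obtain l where l: "l \<in> G" "trace (Suc n) \<omega> = map ((@) s) l" by auto
    have nth: "X i \<omega> = s @ l ! i" if "i \<le> Suc n" for i
      using nth_trace[OF that, of \<omega>] l that by (simp add: G_def)
    have "l ! i \<in> cone x" if "i \<le> Suc n" for i using l(1) that by (auto simp: G_def subset_eq)
    then show ?B using l(1) by (auto simp: nth cone_append x y G_def)
  next
    assume B: ?B
    have "trace (Suc n) \<omega> \<in> {l. set l \<subseteq> (@) s ` cone x}"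
      using B by (simp add: subset_eq ball_trace cone_append[OF x])
    then have "trace (Suc n) \<omega> \<in> map ((@) s) ` {l. set l \<subseteq> cone x}"
      using lists_image[of "(@) s" "cone x"] unfolding lists_eq_set by metis
    then obtain l where l: "set l \<subseteq> cone x" "trace (Suc n) \<omega> = map ((@) s) l" by auto
    have len: "length l = Suc (Suc n)" using arg_cong[OF l(2), of length] by simp
    have nth: "X i \<omega> = s @ l ! i" if "i \<le> Suc n" for i
      using nth_trace[OF that, of \<omega>] l that len by simp
    have "l \<in> G" using B l(1) len by (auto simp: G_def nth cone_append y)
    then show ?A using l(2) by auto
  qed
  show ?thesis using 1 unfolding 2 3 first_entry_def .
qed

lemma \<LL>_first_entry: "\<LL> x y = (\<Sum>n. first_entry x y n)"
  by (simp add: \<LL>_def first_entry_def)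

lemma \<LL>_append: "length x \<ge> 2 \<Longrightarrow> length y \<ge> 2 \<Longrightarrow> \<LL> (s @ x) (s @ y) = \<LL> x y"
  by (simp add: \<LL>_first_entry first_entry_append)

end

locale transient_covered_walk = covered_walk +
  assumes transient: transient and weakly_symmetric: weakly_symmetric and suffix_irreducible: suffix_irreducible
begin

subsection \<open>Cones of a symmetric walk\<close>

lemma p_sym: "p u v > 0 \<Longrightarrow> p v u > 0"
  using weakly_symmetric by (simp add: weakly_symmetric_def)

lemma cone_step_sym: "(cone_step n)\<^sup>*\<^sup>* u v \<Longrightarrow> (cone_step n)\<^sup>*\<^sup>* v u"
  by (rule sympD[OF symp_rtranclp]) (auto simp: cone_step_def p_sym intro!: sympI)

text \<open>Weak symmetry makes paths reversible. A cone is thus a connected component of the words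
  above a level, and two cones that meet are nested.\<close>

lemma cone_meet:
  assumes "v \<in> cone u" "v \<in> cone w" "length w \<le> length u" shows "u \<in> cone w"
proof -
  have "(cone_step (length u))\<^sup>*\<^sup>* v u" using assms(1) cone_step_sym by (simp add: cone_iff)
  moreover have "cone_step (length u) \<le> cone_step (length w)"
    using assms(3) by (auto simp: cone_step_def le_fun_def)
  ultimately have "(cone_step (length w))\<^sup>*\<^sup>* v u" using rtranclp_mono by blast
  then show ?thesis using assms(2) by (simp add: cone_iff)
qed

lemma cone_eqI: assumes "u \<in> cone w" "length u = length w" shows "cone u = cone w"
  using cone_meet[of u w u] cone_mono[of w u] cone_mono[of u w] assms by (auto simp: subset_antisym)

text \<open>A step out of the cone must drop below its level; the reversed step gains at most one
  letter, so the exit starts exactly on that level.\<close>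

lemma cone_exit:
  assumes "u \<in> cone w" "p u v > 0" "v \<notin> cone w" shows "length v < length w" "length u = length w"
proof -
  show v: "length v < length w" using cone_closed[OF assms(1,2)] assms(3) by fastforce
  show "length u = length w"
    using v step_length[OF p_sym[OF assms(2)]] cone_length[OF assms(1)] by simp
qed

lemma boundary_iff: "u \<in> boundary w \<longleftrightarrow> u \<in> cone w \<and> length u = length w \<and> (\<exists>v. p u v > 0 \<and> length v < length w)"
  using cone_exit cone_length unfolding boundary_def by (blast dest: leD)

lemma boundary_exit: "u \<in> cone w \<Longrightarrow> p u v > 0 \<Longrightarrow> v \<notin> cone w \<Longrightarrow> u \<in> boundary w"
  using cone_exit by (auto simp: boundary_def)

lemma boundary_entry: "u \<notin> cone w \<Longrightarrow> v \<in> cone w \<Longrightarrow> p u v > 0 \<Longrightarrow> v \<in> boundary w"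
  using boundary_exit p_sym by blast

text \<open>Every boundary word is itself a root of the cone. This lets the position at an entry
  time replace the chosen root.\<close>

lemma boundary_cone: assumes "u \<in> boundary w" shows "cone u = cone w" "boundary u = boundary w" "length u = length w"
proof -
  show l: "length u = length w" using assms by (simp add: boundary_def)
  show c: "cone u = cone w" using assms by (intro cone_eqI) (auto simp: boundary_def)
  show "boundary u = boundary w" unfolding boundary_def l c ..
qed

lemma boundary_append: assumes w: "length w \<ge> 2" shows "boundary (s @ w) = (@) s ` boundary w"
proof -
  have "(\<exists>v. p (s @ u) v > 0 \<and> length v < length (s @ w)) \<longleftrightarrow> (\<exists>v. p u v > 0 \<and> length v < length w)"
    if "u \<in> cone w" for u
  proof -
    have u: "length u \<ge> 2" using cone_length[OF that] w by simp
    show ?thesis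
    proof
      assume "\<exists>v. p (s @ u) v > 0 \<and> length v < length (s @ w)"
      then obtain v where v: "p (s @ u) v > 0" "length v < length (s @ w)" by blast
      then obtain v' where "v = s @ v'" using step_suffix u by blast
      then show "\<exists>v. p u v > 0 \<and> length v < length w" using v p_shift[OF u] by auto
    next
      assume "\<exists>v. p u v > 0 \<and> length v < length w"
      then show "\<exists>v. p (s @ u) v > 0 \<and> length v < length (s @ w)"
        using p_shift[OF u] by (metis length_append nat_add_left_cancel_less)
    qed
  qed
  then have *: "s @ u \<in> boundary (s @ w) \<longleftrightarrow> u \<in> boundary w" if "u \<in> cone w" for u
    using that by (simp add: boundary_iff cone_append[OF w] image_iff)
  show ?thesis
  proof
    show "boundary (s @ w) \<subseteq> (@) s ` boundary w"
      using boundary_subset[of "s @ w"] * unfolding cone_append[OF w] by blast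
    show "(@) s ` boundary w \<subseteq> boundary (s @ w)"
      using boundary_subset[of w] * by blast
  qed
qed

subsection \<open>Transience\<close>

lemma infinitely_often_pred[measurable]: "Measurable.pred seqM (\<lambda>f. \<forall>m. \<exists>n\<ge>m. f n = w)"
  by measurable

text \<open>Decomposition by the first visit to \<open>w\<close> at or after time \<open>l\<close>.
  With \<open>l = 1\<close> and \<open>u = w\<close> it gives a fixed-point equation, with
  \<open>l = 0\<close> it carries the result over to another start.\<close>

lemma first_hit_sums:
  "(\<lambda>n. \<P>(\<omega> in P u. (\<forall>i<n. l \<le> i \<longrightarrow> X i \<omega> \<noteq> w) \<and> l \<le> n \<and> X n \<omega> = w) * \<P>(\<omega> in P w. \<forall>m. \<exists>n\<ge>m. X n \<omega> = w))
    sums \<P>(\<omega> in P u. \<forall>m. \<exists>n\<ge>m. X n \<omega> = w)"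
proof -
  let ?F = "\<lambda>n \<omega>. (\<forall>i<n. l \<le> i \<longrightarrow> X i \<omega> \<noteq> w) \<and> l \<le> n \<and> X n \<omega> = w"
  let ?I = "\<lambda>\<omega>. \<forall>m. \<exists>n\<ge>m. X n \<omega> = w"
  have shift: "?I \<omega> \<longleftrightarrow> (\<forall>m. \<exists>k\<ge>m. X (n + k) \<omega> = w)" for n \<omega>
  proof
    assume I: "?I \<omega>"
    show "\<forall>m. \<exists>k\<ge>m. X (n + k) \<omega> = w"
    proof
      fix m
      obtain i where "i \<ge> n + m" "X i \<omega> = w" using I by blast
      then show "\<exists>k\<ge>m. X (n + k) \<omega> = w" by (intro exI[of _ "i - n"]) auto
    qed
  next
    assume "\<forall>m. \<exists>k\<ge>m. X (n + k) \<omega> = w"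
    then show "?I \<omega>" by (metis le_add2 le_trans)
  qed
  have "(\<lambda>n. \<P>(\<omega> in P u. ?F n \<omega> \<and> ?I \<omega>)) sums \<P>(\<omega> in P u. \<exists>n. ?F n \<omega> \<and> ?I \<omega>)"
  proof (rule P.prob_sums_disjoint)
    show "m = n" if "?F m \<omega> \<and> ?I \<omega>" "?F n \<omega> \<and> ?I \<omega>" for m n \<omega>
      using that by (cases m n rule: linorder_cases) auto
  qed measurable
  moreover have "(\<exists>n. ?F n \<omega> \<and> ?I \<omega>) \<longleftrightarrow> ?I \<omega>" for \<omega>
  proof
    assume I: "?I \<omega>"
    then have "\<exists>n. n \<ge> l \<and> X n \<omega> = w" by blast
    then have "?F (LEAST n. n \<ge> l \<and> X n \<omega> = w) \<omega>"
      by (rule LeastI2_wellorder_ex) (auto dest: not_less_Least)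
    then show "\<exists>n. ?F n \<omega> \<and> ?I \<omega>" using I by blast
  qed blast
  moreover have "\<P>(\<omega> in P u. ?F n \<omega> \<and> ?I \<omega>) = \<P>(\<omega> in P u. ?F n \<omega>) * \<P>(\<omega> in P w. ?I \<omega>)" for n
  proof -
    have F: "?F n \<omega> \<longleftrightarrow> ((\<forall>i<n. l \<le> i \<longrightarrow> trace n \<omega> ! i \<noteq> w) \<and> l \<le> n) \<and> X n \<omega> = w" for \<omega> by simp
    have "\<P>(\<omega> in P u. ?F n \<omega> \<and> ?I \<omega>) = \<P>(\<omega> in P u. ?F n \<omega> \<and> (\<forall>m. \<exists>k\<ge>m. X (n + k) \<omega> = w))"
      using shift by (intro arg_cong[where f = "P.prob u"] Collect_cong) blast
    then show ?thesis
      using markov_property[of "\<lambda>f. \<forall>m. \<exists>n\<ge>m. f n = w" u "\<lambda>tr. (\<forall>i<n. l \<le> i \<longrightarrow> tr ! i \<noteq> w) \<and> l \<le> n" n w]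
      by simp
  qed
  ultimately show ?thesis by simp
qed

text \<open>The probability of infinitely many returns equals itself times the return probability,
  which is less than 1 by transience.\<close>

lemma not_infinitely_often_start:
  assumes w: "w \<in> language" shows "\<P>(\<omega> in P w. \<forall>m. \<exists>n\<ge>m. X n \<omega> = w) = 0"
proof -
  let ?F = "\<lambda>n \<omega>. (\<forall>i<n. 1 \<le> i \<longrightarrow> X i \<omega> \<noteq> w) \<and> 1 \<le> n \<and> X n \<omega> = w"
  let ?I = "\<P>(\<omega> in P w. \<forall>m. \<exists>n\<ge>m. X n \<omega> = w)"
  have "(\<lambda>n. \<P>(\<omega> in P w. ?F n \<omega>)) sums \<P>(\<omega> in P w. \<exists>n. ?F n \<omega>)"
  proof (rule P.prob_sums_disjoint)
    show "m = n" if "?F m \<omega>" "?F n \<omega>" for m n \<omega> using that by (cases m n rule: linorder_cases) auto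
  qed measurable
  from sums_mult2[OF this] have "(\<lambda>n. \<P>(\<omega> in P w. ?F n \<omega>) * ?I) sums (\<P>(\<omega> in P w. \<exists>n. ?F n \<omega>) * ?I)" .
  then have eq: "?I = \<P>(\<omega> in P w. \<exists>n. ?F n \<omega>) * ?I"
    using first_hit_sums[of w 1 w] sums_unique2 by blast
  have "\<P>(\<omega> in P w. \<exists>n. ?F n \<omega>) \<le> \<P>(\<omega> in P w. \<exists>n\<ge>1. X n \<omega> = w)"
    by (intro P.finite_measure_mono) auto
  also have "\<dots> < 1" using transient w by (simp add: transient_def)
  finally show ?thesis using eq by simp
qed

lemma AE_language: "AE \<omega> in P []. \<forall>n. X n \<omega> \<in> language"
proof -
  have "AE \<omega> in P []. X n \<omega> \<noteq> w" if "w \<notin> language" for n w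
  proof -
    have "\<P>(\<omega> in P []. X n \<omega> = w) = 0"
      using that by (simp add: language_def zero_less_measure_iff)
    then show ?thesis by (subst (asm) P.prob_eq_0) auto
  qed
  then have "AE \<omega> in P []. \<forall>n w. w \<notin> language \<longrightarrow> X n \<omega> \<noteq> w" unfolding AE_all_countable by auto
  then show ?thesis by eventually_elim blast
qed

text \<open>Collects the almost sure properties once; what follows about last entries is then
  deterministic, path by path.\<close>

definition good_path :: "'b \<Rightarrow> bool" where
  "good_path \<omega> \<longleftrightarrow> X 0 \<omega> = [] \<and> (\<forall>n. p (X n \<omega>) (X (Suc n) \<omega>) > 0) \<and>
     (\<forall>n. X n \<omega> \<in> language) \<and> (\<forall>w. finite {n. X n \<omega> = w})"

lemma AE_good_path: "AE \<omega> in P []. good_path \<omega>"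
proof -
  have "AE \<omega> in P []. w \<in> language \<longrightarrow> finite {n. X n \<omega> = w}" for w
  proof (cases "w \<in> language")
    case True
    have "\<P>(\<omega> in P []. \<forall>m. \<exists>n\<ge>m. X n \<omega> = w) = 0"
      using first_hit_sums[of "[]" 0 w] sums_unique2[OF _ sums_zero]
      unfolding not_infinitely_often_start[OF True] mult_zero_right by blast
    then have "AE \<omega> in P []. \<not> (\<forall>m. \<exists>n\<ge>m. X n \<omega> = w)" by (subst (asm) P.prob_eq_0) auto
    then show ?thesis
      by eventually_elim (auto simp: finite_nat_set_iff_bounded not_le)
  qed simp
  then have "AE \<omega> in P []. \<forall>w. w \<in> language \<longrightarrow> finite {n. X n \<omega> = w}" unfolding AE_all_countable by blast
  then show ?thesis
    using AE_start[of "[]"] AE_step[of "[]"] AE_language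
  proof eventually_elim
    case (elim \<omega>)
    have "finite {n. X n \<omega> = w}" for w
    proof (cases "w \<in> language")
      case False
      then have "{n. X n \<omega> = w} = {}" using elim(4) by auto
      then show ?thesis by simp
    qed (use elim in simp)
    then show ?case using elim by (simp add: good_path_def)
  qed
qed

lemma good_path_leaves:
  assumes "good_path \<omega>" "finite B" shows "\<exists>m. \<forall>n\<ge>m. X n \<omega> \<notin> B"
proof -
  have "{n. X n \<omega> \<in> B} = (\<Union>w\<in>B. {n. X n \<omega> = w})" by auto
  then have "finite {n. X n \<omega> \<in> B}" using assms by (simp add: good_path_def)
  then show ?thesis unfolding finite_nat_set_iff_bounded by (auto simp: not_le[symmetric])
qed

text \<open>The path finally leaves the finite set of uncovered words and boundary words. From then
  on it sits in one of the cones and cannot exit, because exits start on the boundary.\<close>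

lemma eventually_in_cone:
  assumes good: "good_path \<omega>" and R: "finite R" and D: "\<forall>n\<ge>m. X n \<omega> \<in> D" and fin: "finite (D - (\<Union>r\<in>R. cone r))"
  shows "\<exists>r\<in>R. \<exists>m. \<forall>n\<ge>m. X n \<omega> \<in> cone r"
proof -
  have "finite ((D - (\<Union>r\<in>R. cone r)) \<union> (\<Union>r\<in>R. boundary r))" using fin R finite_boundary by auto
  then obtain m' where m': "\<forall>n\<ge>m'. X n \<omega> \<notin> (D - (\<Union>r\<in>R. cone r)) \<union> (\<Union>r\<in>R. boundary r)"
    using good_path_leaves[OF good] by blast
  define k where "k = max m m'"
  have "X k \<omega> \<in> D" using D by (simp add: k_def)
  moreover have "X k \<omega> \<notin> D - (\<Union>r\<in>R. cone r)" using m'[rule_format, of k] by (simp add: k_def)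
  ultimately obtain r where r: "r \<in> R" "X k \<omega> \<in> cone r" by blast
  have "X n \<omega> \<in> cone r" if "n \<ge> k" for n
    using that
  proof (induction n rule: dec_induct)
    case (step n)
    have "X n \<omega> \<notin> boundary r" using m' r step by (auto simp: k_def)
    then show ?case using boundary_exit[OF step(3)] good by (auto simp: good_path_def)
  qed (rule r)
  then show ?thesis using r by blast
qed

subsection \<open>Last entries\<close>

text \<open>By minimality of \<open>e\<close> the walk is outside the cone just before
  \<open>e\<close>; the case \<open>e - 1 = b\<close> is covered by the assumption that
  \<open>X b \<omega>\<close> lies in none of the cones. Hence the entry happens through the
  boundary.\<close>

lemma last_entry_step:
  assumes good: "good_path \<omega>" and b: "\<And>r. r \<in> R \<Longrightarrow> X b \<omega> \<notin> cone r"
    and ev: "\<exists>r\<in>R. \<exists>m. \<forall>n\<ge>m. X n \<omega> \<in> cone r"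
    and e: "e = Inf {m. m > b \<and> (\<exists>r\<in>R. \<forall>n\<ge>m. X n \<omega> \<in> cone r)}"
  shows "e > b" "\<exists>r\<in>R. X e \<omega> \<in> boundary r \<and> (\<forall>n\<ge>e. X n \<omega> \<in> cone r) \<and> X (e - 1) \<omega> \<notin> cone r"
proof -
  let ?K = "{m. m > b \<and> (\<exists>r\<in>R. \<forall>n\<ge>m. X n \<omega> \<in> cone r)}"
  obtain r0 m0 where "r0 \<in> R" "\<forall>n\<ge>m0. X n \<omega> \<in> cone r0" using ev by blast
  then have "max (Suc b) m0 \<in> ?K" by auto
  then have eK: "e \<in> ?K" unfolding e by (intro Inf_nat_def1) blast
  then show "e > b" by simp
  obtain r where r: "r \<in> R" "\<forall>n\<ge>e. X n \<omega> \<in> cone r" using eK by blast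
  have out: "X (e - 1) \<omega> \<notin> cone r"
  proof
    assume in_r: "X (e - 1) \<omega> \<in> cone r"
    then have "e - 1 \<noteq> b" using b[OF r(1)] by metis
    moreover have "\<forall>n\<ge>e - 1. X n \<omega> \<in> cone r" using r(2) in_r by (metis Suc_le_eq Suc_pred' le_neq_implies_less not_gr_zero diff_0_eq_0 diff_is_0_eq le_0_eq nat_le_linear)
    ultimately have "e - 1 \<in> ?K" using eK r(1) by auto
    then have "e \<le> e - 1" unfolding e by (rule wellorder_Inf_le1)
    then show False using \<open>e > b\<close> by simp
  qed
  have "Suc (e - 1) = e" using \<open>e > b\<close> by simp
  then have "p (X (e - 1) \<omega>) (X e \<omega>) > 0" using good by (metis good_path_def)
  then have "X e \<omega> \<in> boundary r" using boundary_entry[OF out] r(2) by blast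
  then show "\<exists>r\<in>R. X e \<omega> \<in> boundary r \<and> (\<forall>n\<ge>e. X n \<omega> \<in> cone r) \<and> X (e - 1) \<omega> \<notin> cone r"
    using r out by blast
qed

text \<open>An earlier time would put both \<open>X (m - 1) \<omega>\<close> and
  \<open>X m \<omega>\<close> in some cone of the family. Disjointness makes it the cone of
  \<open>r\<close>, which excludes \<open>X (m - 1) \<omega>\<close>.\<close>

lemma last_entry_unique:
  assumes disj: "\<And>r r'. r \<in> R \<Longrightarrow> r' \<in> R \<Longrightarrow> r \<noteq> r' \<Longrightarrow> cone r \<inter> cone r' = {}"
    and r: "r \<in> R" "\<forall>n\<ge>m. X n \<omega> \<in> cone r" "X (m - 1) \<omega> \<notin> cone r" and m: "m > b"
  shows "Inf {m. m > b \<and> (\<exists>r\<in>R. \<forall>n\<ge>m. X n \<omega> \<in> cone r)} = m"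
proof -
  have "m \<le> k" if k: "k > b" "r' \<in> R" "\<forall>n\<ge>k. X n \<omega> \<in> cone r'" for k r'
  proof (rule ccontr)
    assume "\<not> m \<le> k"
    then have "X (m - 1) \<omega> \<in> cone r'" "X m \<omega> \<in> cone r'" "X m \<omega> \<in> cone r" using k r by auto
    then show False using disj[OF r(1) k(2)] r(3) by blast
  qed
  then show ?thesis using m r by (intro cInf_eq_minimum) auto
qed

lemma initial_cover:
  shows "\<And>r. r \<in> set C0 \<Longrightarrow> r \<in> language" "\<And>r. r \<in> set C0 \<Longrightarrow> length r \<ge> 2"
    "\<And>r r'. r \<in> set C0 \<Longrightarrow> r' \<in> set C0 \<Longrightarrow> r \<noteq> r' \<Longrightarrow> cone r \<inter> cone r' = {}"
    "finite (language - (\<Union>r\<in>set C0. cone r))"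
proof -
  fix r r' assume "r \<in> set C0" "r' \<in> set C0" "r \<noteq> r'"
  then obtain k l where "k < length C0" "l < length C0" "C0 ! k = r" "C0 ! l = r'" by (auto simp: in_set_conv_nth)
  then show "cone r \<inter> cone r' = {}"
    using initial_covering \<open>r \<noteq> r'\<close> unfolding is_initial_covering_def by metis
qed (use initial_covering in \<open>auto simp: is_initial_covering_def\<close>)

definition roots :: "'a list \<Rightarrow> 'a list set" where
  "roots w = (@) (stem w) ` set (cov (cone_type w))"

lemma finite_roots[simp]: "finite (roots w)" by (simp add: roots_def)

lemma \<S>_eq: "\<S> w = (\<Union>r\<in>roots w. boundary r)"
  by (simp add: \<S>_def roots_def)

lemma cover:
  assumes w: "length w \<ge> 2"
  shows "\<And>r. r \<in> roots w \<Longrightarrow> length r > length w"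
    "\<And>r. r \<in> roots w \<Longrightarrow> r \<in> cone w"
    "\<And>r r'. r \<in> roots w \<Longrightarrow> r' \<in> roots w \<Longrightarrow> r \<noteq> r' \<Longrightarrow> cone r \<inter> cone r' = {}"
    "finite (cone w - (\<Union>r\<in>roots w. cone r))"
proof -
  obtain w0 a b where w': "w = w0 @ [a, b]" using snoc2_exists[OF w] by blast
  have st: "stem (w0 @ [a, b]) = w0" by (simp add: stem_def)
  have cov: "is_covering (cone_type w) (cov (cone_type w))" using covering cone_type_in[OF w] by blast
  note * = cov[unfolded is_covering_def, THEN conjunct2, THEN conjunct1, rule_format, of w0 a b]
  show "r \<in> roots w \<Longrightarrow> length r > length w" for r
    using cov by (force simp: is_covering_def roots_def st w')
  show "r \<in> roots w \<Longrightarrow> r \<in> cone w" for r using * by (auto simp: roots_def st w')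
  show "finite (cone w - (\<Union>r\<in>roots w. cone r))" using * by (simp add: roots_def st w')
  fix r r' assume r: "r \<in> roots w" "r' \<in> roots w" "r \<noteq> r'"
  then obtain v v' where v: "v \<in> set (cov (cone_type w))" "v' \<in> set (cov (cone_type w))" "r = w0 @ v" "r' = w0 @ v'"
    by (auto simp: roots_def w' st)
  then obtain k l where "k < length (cov (cone_type w))" "l < length (cov (cone_type w))"
    "cov (cone_type w) ! k = v" "cov (cone_type w) ! l = v'" by (auto simp: in_set_conv_nth)
  then show "cone r \<inter> cone r' = {}" using * r(3) v unfolding w' by metis
qed

text \<open>The walk starts at the empty word, outside all cones, so \<open>m > 0\<close> holds
  anyway. The new form has the shape of the later entry times and shares their lemmas.\<close>

lemma last_entry_0_alt: assumes "good_path \<omega>"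
  shows "last_entry 0 \<omega> = Inf {m. m > 0 \<and> (\<exists>r\<in>set C0. \<forall>n\<ge>m. X n \<omega> \<in> cone r)}"
proof -
  have "m > 0" if "r \<in> set C0" "\<forall>n\<ge>m. X n \<omega> \<in> cone r" for m r
    using that initial_cover(2)[of r] cone_length[of "X 0 \<omega>" r] assms
    by (metis good_path_def gr0I le_refl list.size(3) not_numeral_le_zero le_trans)
  then have "{m. \<exists>r\<in>set C0. \<forall>n\<ge>m. X n \<omega> \<in> cone r} = {m. m > 0 \<and> (\<exists>r\<in>set C0. \<forall>n\<ge>m. X n \<omega> \<in> cone r)}"
    by blast
  then show ?thesis by simp
qed

lemma last_entry_Suc_alt:
  "last_entry (Suc k) \<omega> = Inf {m. m > last_entry k \<omega> \<and> (\<exists>r\<in>roots (X (last_entry k \<omega>) \<omega>). \<forall>n\<ge>m. X n \<omega> \<in> cone r)}"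
  by (simp add: Let_def roots_def)

lemma last_entry_0:
  assumes good: "good_path \<omega>"
  defines "e \<equiv> last_entry 0 \<omega>"
  shows "e > 0" "\<exists>r\<in>set C0. X e \<omega> \<in> boundary r" "\<forall>n\<ge>e. X n \<omega> \<in> cone (X e \<omega>)" "X (e - 1) \<omega> \<notin> cone (X e \<omega>)"
proof -
  have b: "X 0 \<omega> \<notin> cone r" if "r \<in> set C0" for r
    using good initial_cover(2)[OF that] cone_length[of "X 0 \<omega>" r] by (auto simp: good_path_def)
  have ev: "\<exists>r\<in>set C0. \<exists>m. \<forall>n\<ge>m. X n \<omega> \<in> cone r"
    using good by (intro eventually_in_cone[OF good _ _ initial_cover(4), of 0]) (auto simp: good_path_def)
  have e: "e = Inf {m. m > 0 \<and> (\<exists>r\<in>set C0. \<forall>n\<ge>m. X n \<omega> \<in> cone r)}"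
    unfolding e_def by (rule last_entry_0_alt[OF good])
  note * = last_entry_step[OF good b ev e]
  show "e > 0" by (rule *(1))
  obtain r where r: "r \<in> set C0" "X e \<omega> \<in> boundary r" "\<forall>n\<ge>e. X n \<omega> \<in> cone r" "X (e - 1) \<omega> \<notin> cone r"
    using *(2) by blast
  then show "\<exists>r\<in>set C0. X e \<omega> \<in> boundary r" "\<forall>n\<ge>e. X n \<omega> \<in> cone (X e \<omega>)" "X (e - 1) \<omega> \<notin> cone (X e \<omega>)"
    using boundary_cone[OF r(2)] by auto
qed

lemma last_entry_0_unique:
  assumes good: "good_path \<omega>" and m: "m > 0" and r: "r \<in> set C0" "X m \<omega> \<in> boundary r"
    and stays: "\<forall>n\<ge>m. X n \<omega> \<in> cone (X m \<omega>)" "X (m - 1) \<omega> \<notin> cone (X m \<omega>)"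
  shows "last_entry 0 \<omega> = m"
  unfolding last_entry_0_alt[OF good]
  using last_entry_unique[OF initial_cover(3) r(1), of m \<omega> 0] stays m boundary_cone[OF r(2)] by simp

lemma last_entry_Suc:
  assumes good: "good_path \<omega>" and w: "w = X (last_entry k \<omega>) \<omega>" "length w \<ge> 2"
    and stays: "\<forall>n\<ge>last_entry k \<omega>. X n \<omega> \<in> cone w"
  defines "e \<equiv> last_entry (Suc k) \<omega>"
  shows "e > last_entry k \<omega>" "X e \<omega> \<in> \<S> w" "\<forall>n\<ge>e. X n \<omega> \<in> cone (X e \<omega>)" "X (e - 1) \<omega> \<notin> cone (X e \<omega>)"
proof -
  have b: "X (last_entry k \<omega>) \<omega> \<notin> cone r" if "r \<in> roots w" for r
    using cover(1)[OF w(2) that] cone_length[of "X (last_entry k \<omega>) \<omega>" r] w(1) by auto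
  have ev: "\<exists>r\<in>roots w. \<exists>m. \<forall>n\<ge>m. X n \<omega> \<in> cone r"
    by (rule eventually_in_cone[OF good _ stays cover(4)[OF w(2)]]) simp
  have e: "e = Inf {m. m > last_entry k \<omega> \<and> (\<exists>r\<in>roots w. \<forall>n\<ge>m. X n \<omega> \<in> cone r)}"
    unfolding e_def w(1) by (rule last_entry_Suc_alt)
  note * = last_entry_step[OF good b ev e]
  show "e > last_entry k \<omega>" by (rule *(1))
  obtain r where r: "r \<in> roots w" "X e \<omega> \<in> boundary r" "\<forall>n\<ge>e. X n \<omega> \<in> cone r" "X (e - 1) \<omega> \<notin> cone r"
    using *(2) by blast
  then show "X e \<omega> \<in> \<S> w" "\<forall>n\<ge>e. X n \<omega> \<in> cone (X e \<omega>)" "X (e - 1) \<omega> \<notin> cone (X e \<omega>)"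
    using boundary_cone[OF r(2)] by (auto simp: \<S>_eq)
qed

lemma last_entry_Suc_unique:
  assumes w: "w = X (last_entry k \<omega>) \<omega>" "length w \<ge> 2" and m: "m > last_entry k \<omega>" "X m \<omega> \<in> \<S> w"
    and stays: "\<forall>n\<ge>m. X n \<omega> \<in> cone (X m \<omega>)" "X (m - 1) \<omega> \<notin> cone (X m \<omega>)"
  shows "last_entry (Suc k) \<omega> = m"
proof -
  obtain r where r: "r \<in> roots w" "X m \<omega> \<in> boundary r" using m by (auto simp: \<S>_eq)
  show ?thesis
    unfolding last_entry_Suc_alt w(1)[symmetric]
    using last_entry_unique[OF cover(3)[OF w(2)] r(1), of m \<omega>] stays m boundary_cone[OF r(2)] by simp
qed

lemma \<S>_cone: assumes w: "length w \<ge> 2" and u: "u \<in> \<S> w"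
  shows "u \<in> cone w" "length u > length w" "cone u \<subseteq> cone w"
proof -
  obtain r where r: "r \<in> roots w" "u \<in> boundary r" using u by (auto simp: \<S>_eq)
  show "length u > length w" using cover(1)[OF w r(1)] boundary_cone(3)[OF r(2)] by simp
  show "cone u \<subseteq> cone w" using cone_mono[OF cover(2)[OF w r(1)]] boundary_cone(1)[OF r(2)] by simp
  then show "u \<in> cone w" using cone_refl by blast
qed

text \<open>
  The lists below contain the positions at successive last entry times, the most recent one first.
  \<open>entered f us m\<close> is the part of the event "these are the last entry positions and the last of them
  is entered at time \<open>m\<close>" that is determined up to time \<open>m\<close>; what remains is that \<open>f\<close> never leaves
  the cone of \<open>hd us\<close> after \<open>m\<close>.
\<close>

fun entered :: "(nat \<Rightarrow> 'a list) \<Rightarrow> 'a list list \<Rightarrow> nat \<Rightarrow> bool" where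
  "entered f [] m \<longleftrightarrow> False"
| "entered f [u] m \<longleftrightarrow> m > 0 \<and> f m = u \<and> f (m - 1) \<notin> cone u"
| "entered f (u # v # us) m \<longleftrightarrow> (\<exists>m'<m. entered f (v # us) m' \<and> f m = u \<and> f (m - 1) \<notin> cone u \<and>
     (\<forall>n. m' \<le> n \<and> n \<le> m \<longrightarrow> f n \<in> cone v))"

fun admissible :: "'a list list \<Rightarrow> bool" where
  "admissible [] \<longleftrightarrow> False"
| "admissible [u] \<longleftrightarrow> (\<exists>r\<in>set C0. u \<in> boundary r)"
| "admissible (u # v # us) \<longleftrightarrow> u \<in> \<S> v \<and> admissible (v # us)"

primrec entries :: "'b \<Rightarrow> 'a list list \<Rightarrow> bool" where
  "entries \<omega> [] \<longleftrightarrow> True"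
| "entries \<omega> (u # us) \<longleftrightarrow> X (last_entry (length us) \<omega>) \<omega> = u \<and> entries \<omega> us"

lemma entered_cong: "(\<And>i. i \<le> m \<Longrightarrow> f i = g i) \<Longrightarrow> entered f us m \<longleftrightarrow> entered g us m"
proof (induction us arbitrary: m rule: induct_list012)
  case (3 u v us)
  have "entered f (v # us) m' \<longleftrightarrow> entered g (v # us) m'" if "m' < m" for m'
    by (rule 3(2)) (use 3(3) that in simp)
  moreover have "f (m - 1) = g (m - 1)" "f m = g m" by (auto intro!: 3(3))
  ultimately show ?case using 3(3) by (auto cong: conj_cong)
qed auto

lemma entered_trace: "entered (\<lambda>i. X i \<omega>) us m \<longleftrightarrow> entered (\<lambda>i. trace m \<omega> ! i) us m"
  by (rule entered_cong) simp

lemma entered_pred[measurable]: "Measurable.pred (P w) (\<lambda>\<omega>. entered (\<lambda>i. X i \<omega>) us m)"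
  unfolding entered_trace by measurable

lemma entered_at: "entered f us m \<Longrightarrow> us \<noteq> [] \<and> m > 0 \<and> f m = hd us \<and> f (m - 1) \<notin> cone (hd us)"
  by (cases us rule: admissible.cases) auto

text \<open>The later of two different entry times would have a predecessor inside the cone. The
  horizon \<open>k\<close> makes this usable both for finite traces and for the whole
  trajectory.\<close>

lemma entered_unique:
  assumes "entered f us m" "entered f us m'" "\<And>n. m \<le> n \<Longrightarrow> n \<le> k \<Longrightarrow> f n \<in> cone (hd us)"
    "\<And>n. m' \<le> n \<Longrightarrow> n \<le> k \<Longrightarrow> f n \<in> cone (hd us)" "m \<le> k" "m' \<le> k"
  shows "m = m'"
  using assms entered_at[OF assms(1)] entered_at[OF assms(2)]
  by (metis Suc_le_eq Suc_pred' diff_le_self le_trans less_Suc_eq_le linorder_neqE_nat)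

lemma admissible_length: "admissible us \<Longrightarrow> length (hd us) \<ge> 2"
proof (induction us rule: admissible.induct)
  case (2 u)
  then show ?case using boundary_cone(3) initial_cover(2) by fastforce
next
  case (3 u v us)
  then show ?case using \<S>_cone(2)[of v u] by simp
qed simp

lemma entered_last_entry:
  assumes good: "good_path \<omega>"
  shows "admissible us \<Longrightarrow> entered (\<lambda>i. X i \<omega>) us m \<Longrightarrow> \<forall>n\<ge>m. X n \<omega> \<in> cone (hd us) \<Longrightarrow>
    last_entry (length us - 1) \<omega> = m \<and> entries \<omega> us"
proof (induction us arbitrary: m rule: admissible.induct)
  case (2 u)
  then have "last_entry 0 \<omega> = m" using last_entry_0_unique[OF good] by auto
  then show ?case using 2 by auto
next
  case (3 u v us)
  obtain m' where m': "m' < m" "entered (\<lambda>i. X i \<omega>) (v # us) m'" "X m \<omega> = u" "X (m - 1) \<omega> \<notin> cone u"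
    "\<And>n. m' \<le> n \<Longrightarrow> n \<le> m \<Longrightarrow> X n \<omega> \<in> cone v" using 3(3) by auto
  have adm: "admissible (v # us)" and u: "u \<in> \<S> v" using 3(2) by auto
  have v: "length v \<ge> 2" using admissible_length[OF adm] by simp
  \<comment> \<open>Up to \<open>m\<close> this is part of \<open>entered\<close>; afterwards the
    walk is in the smaller cone of \<open>u\<close>.\<close>
  have "\<forall>n\<ge>m'. X n \<omega> \<in> cone v"
    using 3(4) m'(5) \<S>_cone(3)[OF v u] by (metis list.sel(1) nat_le_linear subsetD)
  then have IH: "last_entry (length us) \<omega> = m'" "entries \<omega> (v # us)" using 3(1)[OF adm m'(2)] by auto
  have "last_entry (Suc (length us)) \<omega> = m"
    using IH m' u 3(4) v by (intro last_entry_Suc_unique[of v]) auto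
  then show ?case using IH m' by simp
qed simp

lemma last_entry_entered:
  assumes good: "good_path \<omega>"
  shows "admissible us \<Longrightarrow> entries \<omega> us \<Longrightarrow>
    entered (\<lambda>i. X i \<omega>) us (last_entry (length us - 1) \<omega>) \<and> (\<forall>n\<ge>last_entry (length us - 1) \<omega>. X n \<omega> \<in> cone (hd us))"
proof (induction us rule: admissible.induct)
  case (2 u)
  then show ?case using last_entry_0[OF good] by (auto simp del: last_entry.simps)
next
  case (3 u v us)
  have adm: "admissible (v # us)" using 3(2) by auto
  have v: "length v \<ge> 2" using admissible_length[OF adm] by simp
  have IH: "entered (\<lambda>i. X i \<omega>) (v # us) (last_entry (length us) \<omega>)" "\<forall>n\<ge>last_entry (length us) \<omega>. X n \<omega> \<in> cone v"
    using 3(1)[OF adm] 3(3) by auto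
  have vX: "v = X (last_entry (length us) \<omega>) \<omega>" "u = X (last_entry (Suc (length us)) \<omega>) \<omega>"
    using 3(3) by (auto simp del: last_entry.simps)
  note * = last_entry_Suc[OF good vX(1) v IH(2)]
  have "entered (\<lambda>i. X i \<omega>) (u # v # us) (last_entry (Suc (length us)) \<omega>)"
    unfolding entered.simps
    by (rule exI[of _ "last_entry (length us) \<omega>"]) (use * IH vX in \<open>auto simp del: last_entry.simps\<close>)
  then show ?case using * vX by (simp del: last_entry.simps entered.simps)
qed simp

lemma entries_iff:
  assumes "good_path \<omega>" "admissible us"
  shows "entries \<omega> us \<longleftrightarrow> (\<exists>m. entered (\<lambda>i. X i \<omega>) us m \<and> (\<forall>n\<ge>m. X n \<omega> \<in> cone (hd us)))"
  using entered_last_entry[OF assms] last_entry_entered[OF assms] by blast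

subsection \<open>Positivity of the staying probabilities\<close>

lemma cone_reach:
  assumes "x \<in> cone w" shows "(\<lambda>u v. u \<in> cone w \<and> v \<in> cone w \<and> p u v > 0)\<^sup>*\<^sup>* w x"
proof -
  have "(cone_step (length w))\<^sup>*\<^sup>* w x" using assms by (simp add: cone_iff)
  then show ?thesis
  proof induction
    case (step u v)
    then have "u \<in> cone w" "v \<in> cone w"
      by (auto simp: cone_iff cone_step_def intro: rtranclp.rtrancl_into_rtrancl)
    then show ?case using step by (intro rtranclp.rtrancl_into_rtrancl[OF step(3)]) (auto simp: cone_step_def)
  qed simp
qed

text \<open>The root reaches \<open>x\<close> inside the cone with positive probability, and the
  Markov property at that time does the rest.\<close>

lemma stay_pos_root:
  assumes x: "x \<in> cone w" and pos: "\<P>(\<omega> in P x. \<forall>n. X n \<omega> \<in> cone w) > 0"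
  shows "stay w > 0"
proof -
  obtain n where n: "\<P>(\<omega> in P w. (\<forall>m\<le>n. X m \<omega> \<in> cone w) \<and> X n \<omega> = x) > 0"
    using pos_of_reach[OF cone_reach[OF x]] by auto
  have "\<P>(\<omega> in P w. (\<forall>m\<le>n. X m \<omega> \<in> cone w) \<and> X n \<omega> = x \<and> (\<forall>k. X (n + k) \<omega> \<in> cone w))
      = \<P>(\<omega> in P w. (\<forall>m\<le>n. X m \<omega> \<in> cone w) \<and> X n \<omega> = x) * \<P>(\<omega> in P x. \<forall>n. X n \<omega> \<in> cone w)"
    using markov_property[of "\<lambda>f. \<forall>k. f k \<in> cone w" w "\<lambda>l. \<forall>y\<in>set l. y \<in> cone w" n x]
    by (simp add: ball_trace[of _ _ "\<lambda>y. y \<in> cone w"])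
  then have "0 < \<P>(\<omega> in P w. (\<forall>m\<le>n. X m \<omega> \<in> cone w) \<and> X n \<omega> = x \<and> (\<forall>k. X (n + k) \<omega> \<in> cone w))"
    using n pos by simp
  also have "\<dots> \<le> stay w"
    unfolding stay_def
  proof (intro P.finite_measure_mono subsetI)
    fix \<omega> assume \<omega>: "\<omega> \<in> {\<omega> \<in> space (P w). (\<forall>m\<le>n. X m \<omega> \<in> cone w) \<and> X n \<omega> = x \<and> (\<forall>k. X (n + k) \<omega> \<in> cone w)}"
    have "X m \<omega> \<in> cone w" for m using \<omega> by (cases "m \<le> n") (auto dest: spec[of _ "m - n"])
    then show "\<omega> \<in> {\<omega> \<in> space (P w). \<forall>n. X n \<omega> \<in> cone w}" using \<omega> by auto
  qed simp
  finally show ?thesis .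
qed

text \<open>Otherwise, for each time, word and root, the event of being at that word and then
  staying in that cone would be null. There are countably many of them, while almost surely one
  occurs.\<close>

lemma exists_staying_root: "\<exists>r\<in>set C0. stay r > 0"
proof (rule ccontr)
  assume none: "\<not> ?thesis"
  have zero: "AE \<omega> in P []. \<not> (X m \<omega> = x \<and> (\<forall>k. X (m + k) \<omega> \<in> cone r))" if r: "r \<in> set C0" for r m x
  proof -
    have "\<P>(\<omega> in P []. True \<and> X m \<omega> = x \<and> (\<forall>k. X (m + k) \<omega> \<in> cone r))
      = \<P>(\<omega> in P []. True \<and> X m \<omega> = x) * \<P>(\<omega> in P x. \<forall>k. X k \<omega> \<in> cone r)"
      using markov_property[of "\<lambda>f. \<forall>k. f k \<in> cone r" "[]" "\<lambda>_. True" m x] by simp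
    moreover have "\<P>(\<omega> in P x. \<forall>k. X k \<omega> \<in> cone r) = 0"
    proof (rule ccontr)
      assume "\<P>(\<omega> in P x. \<forall>k. X k \<omega> \<in> cone r) \<noteq> 0"
      then have pos: "\<P>(\<omega> in P x. \<forall>k. X k \<omega> \<in> cone r) > 0" by (simp add: zero_less_measure_iff)
      obtain \<omega> where "\<forall>k. X k \<omega> \<in> cone r" "X 0 \<omega> = x" using P.prob_pos_witness[OF pos AE_start] by blast
      then have "x \<in> cone r" by metis
      then show False using stay_pos_root[OF _ pos] none r by blast
    qed
    ultimately have "\<P>(\<omega> in P []. X m \<omega> = x \<and> (\<forall>k. X (m + k) \<omega> \<in> cone r)) = 0" by simp
    then show ?thesis by (subst (asm) P.prob_eq_0) auto
  qed
  have "AE \<omega> in P []. \<forall>r\<in>set C0. \<forall>m x. \<not> (X m \<omega> = x \<and> (\<forall>k. X (m + k) \<omega> \<in> cone r))"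
  proof (intro AE_finite_allI)
    show "AE \<omega> in P []. \<forall>m x. \<not> (X m \<omega> = x \<and> (\<forall>k. X (m + k) \<omega> \<in> cone r))" if "r \<in> set C0" for r
      unfolding AE_all_countable using zero[OF that] by blast
  qed simp
  then have "AE \<omega> in P []. False"
    using AE_good_path
  proof eventually_elim
    case (elim \<omega>)
    obtain r m where "r \<in> set C0" "\<forall>n\<ge>m. X n \<omega> \<in> cone r"
      using eventually_in_cone[OF elim(2) _ _ initial_cover(4), of 0] elim(2) by (auto simp: good_path_def)
    then show ?case using elim(1) by (metis le_add1)
  qed
  then show False by simp
qed

lemma suffix_occurs:
  assumes w: "w \<in> language" "length w \<ge> 2" and ab: "length ab = 2"
  shows "\<exists>u\<in>cone w. suffix2 u = ab"
proof -
  obtain w0 a0 b0 where w': "w = w0 @ [a0, b0]" using snoc2_exists[OF w(2)] by blast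
  obtain a b where ab': "ab = [a, b]" using ab by (metis snoc2_exists append_Nil length_append add_0 length_0_conv add_right_cancel eq_imp_le list.size(3,4) numeral_2_eq_2 add_Suc_right One_nat_def plus_1_eq_Suc)
  obtain n w1 where "\<P>(\<omega> in P w. X n \<omega> = w0 @ w1 @ [a, b] \<and> (\<forall>k\<le>n. length (X k \<omega>) \<ge> length w)) > 0"
    using suffix_irreducible w(1) unfolding suffix_irreducible_def w' by blast
  then have "(\<lambda>u v. length u \<ge> length w \<and> length v \<ge> length w \<and> p u v > 0)\<^sup>*\<^sup>* w (w0 @ w1 @ [a, b])"
    by (rule reach_of_pos)
  then have "w0 @ w1 @ [a, b] \<in> cone w" by (simp add: cone_def)
  moreover have "suffix2 (w0 @ w1 @ [a, b]) = ab" by (simp add: ab' suffix2_def)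
  ultimately show ?thesis by blast
qed

lemma language_suffix_exists:
  assumes "length ab = 2" shows "\<exists>w\<in>language. length w \<ge> 2 \<and> suffix2 w = ab"
proof -
  obtain r where r: "r \<in> set C0" using exists_staying_root by blast
  obtain u where "u \<in> cone r" "suffix2 u = ab"
    using suffix_occurs[OF initial_cover(1)[OF r] initial_cover(2)[OF r] assms] by blast
  then show ?thesis
    using cone_subset_language[OF initial_cover(1)[OF r]] cone_length[of u r] initial_cover(2)[OF r]
    by (intro bexI[of _ u]) auto
qed

text \<open>Suffix irreducibility puts a word ending like a favourable root into any cone of the
  language. Staying in its subcone is staying in the larger cone, so positivity spreads to all pairs
  of letters.\<close>

lemma \<xi>_pos: assumes ab: "length ab = 2" shows "\<xi> ab > 0"
proof -
  obtain r where r: "r \<in> set C0" "stay r > 0" using exists_staying_root by blast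
  have rl: "length r \<ge> 2" using initial_cover(2)[OF r(1)] .
  obtain w where w: "w \<in> language" "length w \<ge> 2" "suffix2 w = ab" using language_suffix_exists[OF ab] by blast
  obtain u where u: "u \<in> cone w" "suffix2 u = suffix2 r"
    using suffix_occurs[OF w(1,2) length_suffix2[OF rl]] by blast
  have ul: "length u \<ge> 2" using cone_length[OF u(1)] w by simp
  have "0 < stay u" using r(2) stay_eq_\<xi>[OF ul] stay_eq_\<xi>[OF rl] u(2) by simp
  also have "\<dots> \<le> \<P>(\<omega> in P u. \<forall>n. X n \<omega> \<in> cone w)"
    unfolding stay_def using cone_mono[OF u(1)] by (intro P.finite_measure_mono) auto
  finally have "stay w > 0" by (rule stay_pos_root[OF u(1)])
  then show ?thesis using stay_eq_\<xi>[OF w(2)] w(3) by simp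
qed

lemma stay_pos: "length w \<ge> 2 \<Longrightarrow> stay w > 0"
  using stay_eq_\<xi> \<xi>_pos length_suffix2 by metis

subsection \<open>The law of the last entries\<close>

definition entry_prob :: "'a list list \<Rightarrow> nat \<Rightarrow> real" where
  "entry_prob us m = \<P>(\<omega> in P []. entered (\<lambda>i. X i \<omega>) us m)"

lemma entry_prob_nonneg[simp]: "entry_prob us m \<ge> 0" by (simp add: entry_prob_def)

lemma first_entry_nonneg[simp]: "first_entry x y n \<ge> 0" by (simp add: first_entry_def)

text \<open>At most one \<open>m\<close> is the time of the last entry, and after \<open>m\<close>
  the walk only has to stay in the cone, which by the Markov property is independent of the
  past.\<close>

lemma entry_prob_stay_sums:
  "(\<lambda>m. entry_prob us m * stay (hd us)) sums
     \<P>(\<omega> in P []. \<exists>m. entered (\<lambda>i. X i \<omega>) us m \<and> (\<forall>n\<ge>m. X n \<omega> \<in> cone (hd us)))"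
proof -
  let ?E = "\<lambda>m \<omega>. entered (\<lambda>i. X i \<omega>) us m \<and> (\<forall>n\<ge>m. X n \<omega> \<in> cone (hd us))"
  have "(\<lambda>m. \<P>(\<omega> in P []. ?E m \<omega>)) sums \<P>(\<omega> in P []. \<exists>m. ?E m \<omega>)"
  proof (rule P.prob_sums_disjoint)
    show "m = m'" if "?E m \<omega>" "?E m' \<omega>" for m m' \<omega>
      by (rule entered_unique[of _ us m m' "max m m'"]) (use that in auto)
  qed measurable
  moreover have "\<P>(\<omega> in P []. ?E m \<omega>) = entry_prob us m * stay (hd us)" for m
  proof -
    have shift: "(\<forall>n\<ge>m. X n \<omega> \<in> D) \<longleftrightarrow> (\<forall>k. X (m + k) \<omega> \<in> D)" for D \<omega>
      by (metis le_add1 le_add_diff_inverse)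
    have e: "entered (\<lambda>i. X i \<omega>) us m \<longleftrightarrow> entered (\<lambda>i. trace m \<omega> ! i) us m \<and> X m \<omega> = hd us" for \<omega>
      using entered_trace entered_at by blast
    show ?thesis
      using markov_property[of "\<lambda>f. \<forall>k. f k \<in> cone (hd us)" "[]" "\<lambda>l. entered (\<lambda>i. l ! i) us m" m "hd us"]
      unfolding entry_prob_def stay_def e shift by (simp add: conj_assoc)
  qed
  ultimately show ?thesis by simp
qed

text \<open>The sum weighted by \<open>stay\<close> is a probability, and dividing by the positive
  number \<open>stay (hd us)\<close> keeps it finite.\<close>

lemma summable_entry_prob: assumes "length (hd us) \<ge> 2" shows "summable (entry_prob us)"
proof -
  have "summable (\<lambda>m. entry_prob us m * stay (hd us) / stay (hd us))"
    by (rule summable_divide[OF sums_summable[OF entry_prob_stay_sums]])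
  then show ?thesis using stay_pos[OF assms] by simp
qed

text \<open>Entering \<open>y\<close> and never leaving its cone again can happen at one time only,
  so the series multiplied by \<open>stay y\<close> is a probability. This makes
  \<open>\<LL>\<close> a convergent series.\<close>

lemma summable_first_entry: assumes y: "length y \<ge> 2" shows "summable (first_entry x y)"
proof -
  let ?E = "\<lambda>n \<omega>. X (Suc n) \<omega> = y \<and> X n \<omega> \<notin> cone y \<and> (\<forall>m\<le>Suc n. X m \<omega> \<in> cone x) \<and> (\<forall>k. X (Suc n + k) \<omega> \<in> cone y)"
  have "(\<lambda>m. \<P>(\<omega> in P x. ?E m \<omega>)) sums \<P>(\<omega> in P x. \<exists>m. ?E m \<omega>)"
  proof (rule P.prob_sums_disjoint)
    have *: "\<not> m < n" if "?E m \<omega>" "?E n \<omega>" for m n \<omega>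
    proof
      assume "m < n"
      then have "X (Suc m + (n - Suc m)) \<omega> \<in> cone y" using that by blast
      then show False using that \<open>m < n\<close> by simp
    qed
    then show "m = n" if "?E m \<omega>" "?E n \<omega>" for m n \<omega>
      using *[OF that] *[OF that(2,1)] by simp
  qed measurable
  moreover have "\<P>(\<omega> in P x. ?E n \<omega>) = first_entry x y n * stay y" for n
  proof -
    have e: "?E n \<omega> \<longleftrightarrow> (trace (Suc n) \<omega> ! n \<notin> cone y \<and> (\<forall>m\<le>Suc n. trace (Suc n) \<omega> ! m \<in> cone x)) \<and> X (Suc n) \<omega> = y
      \<and> (\<forall>k. X (Suc n + k) \<omega> \<in> cone y)" for \<omega> by auto
    show ?thesis
      unfolding e first_entry_def stay_def
      using markov_property[of "\<lambda>f. \<forall>k. f k \<in> cone y" x "\<lambda>l. l ! n \<notin> cone y \<and> (\<forall>m\<le>Suc n. l ! m \<in> cone x)" "Suc n" y]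
      by (simp add: conj_ac)
  qed
  ultimately have "summable (\<lambda>n. first_entry x y n * stay y / stay y)"
    by (intro summable_divide) (auto dest: sums_summable)
  then show ?thesis using stay_pos[OF y] by simp
qed

lemma entry_prob_0: "entry_prob us 0 = 0"
proof -
  have "\<not> entered f us 0" for f using entered_at[of f us 0] by auto
  then show ?thesis by (simp add: entry_prob_def)
qed

text \<open>A convolution over the time \<open>m'\<close> of the previous entry, obtained from the
  Markov property at \<open>m'\<close>.\<close>

lemma entry_prob_Suc:
  "entry_prob (u # v # us) (Suc m) = (\<Sum>m'\<le>m. entry_prob (v # us) m' * first_entry v u (m - m'))"
proof -
  let ?E = "\<lambda>m' \<omega>. entered (\<lambda>i. X i \<omega>) (v # us) m' \<and> X (Suc m) \<omega> = u \<and> X m \<omega> \<notin> cone u \<and>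
     (\<forall>n. m' \<le> n \<and> n \<le> Suc m \<longrightarrow> X n \<omega> \<in> cone v)"
  have "entered (\<lambda>i. X i \<omega>) (u # v # us) (Suc m) \<longleftrightarrow> (\<exists>m'\<in>{..m}. ?E m' \<omega>)" for \<omega>
    by (auto simp: less_Suc_eq_le)
  then have "entry_prob (u # v # us) (Suc m) = P.prob [] (\<Union>m'\<in>{..m}. {\<omega> \<in> space (P []). ?E m' \<omega>})"
    unfolding entry_prob_def by (intro arg_cong[where f = "P.prob []"]) auto
  also have "\<dots> = (\<Sum>m'\<in>{..m}. \<P>(\<omega> in P []. ?E m' \<omega>))"
  proof (rule P.finite_measure_finite_Union)
    have "m1 = m2" if "?E m1 \<omega>" "?E m2 \<omega>" "m1 \<le> m" "m2 \<le> m" for m1 m2 \<omega>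
      by (rule entered_unique[of "\<lambda>i. X i \<omega>" "v # us" m1 m2 m]) (use that in auto)
    then show "disjoint_family_on (\<lambda>m'. {\<omega> \<in> space (P []). ?E m' \<omega>}) {..m}"
      unfolding disjoint_family_on_def by blast
  qed auto
  also have "\<dots> = (\<Sum>m'\<le>m. entry_prob (v # us) m' * first_entry v u (m - m'))"
  proof (intro sum.cong refl)
    fix m' assume "m' \<in> {..m}"
    then have m': "m' \<le> m" by simp
    define d where "d = m - m'"
    have m: "m = m' + d" using m' by (simp add: d_def)
    have all: "(\<forall>n. m' \<le> n \<and> n \<le> Suc m \<longrightarrow> X n \<omega> \<in> cone v) \<longleftrightarrow> (\<forall>k\<le>Suc d. X (m' + k) \<omega> \<in> cone v)" for \<omega>
      unfolding m by (metis add_Suc_right le_add1 le_add_diff_inverse nat_add_left_cancel_le)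
    have e: "?E m' \<omega> \<longleftrightarrow> entered (\<lambda>i. trace m' \<omega> ! i) (v # us) m' \<and> X m' \<omega> = v \<and>
       (X (m' + Suc d) \<omega> = u \<and> X (m' + d) \<omega> \<notin> cone u \<and> (\<forall>k\<le>Suc d. X (m' + k) \<omega> \<in> cone v))" for \<omega>
      unfolding all using entered_trace[of \<omega> "v # us" m'] entered_at[of "\<lambda>i. X i \<omega>" "v # us" m'] by (auto simp: m)
    have e': "entered (\<lambda>i. X i \<omega>) (v # us) m' \<longleftrightarrow> entered (\<lambda>i. trace m' \<omega> ! i) (v # us) m' \<and> X m' \<omega> = v" for \<omega>
      using entered_trace[of \<omega> "v # us" m'] entered_at[of "\<lambda>i. X i \<omega>" "v # us" m'] by auto
    show "\<P>(\<omega> in P []. ?E m' \<omega>) = entry_prob (v # us) m' * first_entry v u (m - m')"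
      unfolding e unfolding entry_prob_def e' first_entry_def d_def[symmetric]
      using markov_property[of "\<lambda>f. f (Suc d) = u \<and> f d \<notin> cone u \<and> (\<forall>k\<le>Suc d. f k \<in> cone v)" "[]"
        "\<lambda>l. entered (\<lambda>i. l ! i) (v # us) m'" m' v]
      by simp
  qed
  finally show ?thesis .
qed

text \<open>Summing the convolution over time is a Cauchy product; the time lost in the shift
  contributes nothing by \<open>entry_prob_0\<close>.\<close>

lemma suminf_entry_prob:
  assumes v: "length v \<ge> 2" and u: "length u \<ge> 2"
  shows "(\<Sum>m. entry_prob (u # v # us) m) = (\<Sum>m. entry_prob (v # us) m) * \<LL> v u"
proof -
  have "(\<lambda>m. entry_prob (u # v # us) (Suc m)) sums ((\<Sum>m. entry_prob (v # us) m) * (\<Sum>n. first_entry v u n))"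
    unfolding entry_prob_Suc
    using summable_entry_prob[of "v # us"] summable_first_entry[OF u] v by (intro Cauchy_product_sums) auto
  then have "(\<lambda>m. entry_prob (u # v # us) m) sums ((\<Sum>m. entry_prob (v # us) m) * \<LL> v u)"
    by (subst (asm) sums_Suc_iff) (simp add: entry_prob_0 \<LL>_first_entry)
  then show ?thesis by (simp add: sums_unique2[OF summable_sums] sums_iff)
qed

lemma \<S>_append: assumes w: "length w \<ge> 2" shows "\<S> (s @ w) = (@) s ` \<S> w"
proof -
  have "boundary (stem (s @ w) @ v) = (@) s ` boundary (stem w @ v)" if "v \<in> set (cov (cone_type w))" for v
  proof -
    have "stem w @ v \<in> roots w" using that by (simp add: roots_def)
    then have "length (stem w @ v) \<ge> 2" using cover(1)[OF w] w by force
    then show ?thesis using boundary_append[of "stem w @ v" s] by (simp add: stem_append[OF w])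
  qed
  then show ?thesis
    unfolding \<S>_def cone_type_append[OF w] image_UN by (intro SUP_cong refl)
qed

lemma \<S>_suffix2: assumes "length w \<ge> 2" shows "\<S> w = (@) (stem w) ` \<S> (suffix2 w)"
  using \<S>_append[of "suffix2 w" "stem w"] length_suffix2[OF assms] by (simp add: stem_append_suffix2)

lemma finite_\<S>[simp]: "finite (\<S> w)" by (simp add: \<S>_eq finite_boundary)

lemma \<S>_length: "length w \<ge> 2 \<Longrightarrow> y \<in> \<S> (suffix2 w) \<Longrightarrow> length y \<ge> 3"
  using \<S>_cone(2)[of "suffix2 w" y] length_suffix2[of w] by simp

section \<open>Measurability of the last entries and the values of \<open>W\<close>\<close>

definition initial_words :: "'a list set" where "initial_words = (\<Union>r\<in>set C0. boundary r)"

lemma finite_initial_words[simp]: "finite initial_words" by (simp add: initial_words_def finite_boundary)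

lemma initial_words_length: "w \<in> initial_words \<Longrightarrow> length w \<ge> 2"
  using initial_cover(2) by (auto simp: initial_words_def dest: boundary_cone(3))

lemma initial_words_language: "w \<in> initial_words \<Longrightarrow> w \<in> language"
  using initial_cover(1) cone_subset_language boundary_subset by (fastforce simp: initial_words_def)

lemma last_entry_meas[measurable]: "last_entry k \<in> P w \<rightarrow>\<^sub>M count_space UNIV"
proof (induction k)
  case 0
  have "(\<lambda>\<omega>. LEAST m. m \<in> {m. \<exists>r\<in>set C0. \<forall>n\<ge>m. X n \<omega> \<in> cone r}) \<in> P w \<rightarrow>\<^sub>M count_space UNIV"
    by measurable
  then show ?case by (simp add: Inf_nat_def[abs_def])
next
  case (Suc k)
  note [measurable] = Suc
  have [measurable]: "(\<lambda>\<omega>. X (last_entry k \<omega>) \<omega>) \<in> P w \<rightarrow>\<^sub>M count_space UNIV"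
    by (rule measurable_compose_countable[OF _ Suc]) simp
  have [measurable]: "Measurable.pred (P w) (\<lambda>\<omega>. \<exists>r\<in>roots (X (last_entry k \<omega>) \<omega>). \<forall>n\<ge>m. X n \<omega> \<in> cone r)" for m
    by (rule measurable_compose_countable[where f = "\<lambda>w \<omega>. \<exists>r\<in>roots w. \<forall>n\<ge>m. X n \<omega> \<in> cone r"]) measurable
  have "(\<lambda>\<omega>. LEAST m. m \<in> {m. m > last_entry k \<omega> \<and> (\<exists>r\<in>roots (X (last_entry k \<omega>) \<omega>). \<forall>n\<ge>m. X n \<omega> \<in> cone r)})
      \<in> P w \<rightarrow>\<^sub>M count_space UNIV" unfolding mem_Collect_eq by measurable
  then show ?case unfolding last_entry_Suc_alt[abs_def] Inf_nat_def .
qed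

lemma W_meas[measurable]: "W k \<in> P w \<rightarrow>\<^sub>M count_space UNIV"
proof -
  have [measurable]: "(\<lambda>\<omega>. X (last_entry k \<omega>) \<omega>) \<in> P w \<rightarrow>\<^sub>M count_space UNIV" for k
    by (rule measurable_compose_countable[OF _ last_entry_meas]) simp
  show ?thesis
  proof (cases k)
    case 0
    then show ?thesis by (simp add: W.simps(1)[abs_def] del: last_entry.simps)
  next
    case (Suc k')
    have "(\<lambda>\<omega>. drop (length (X (last_entry k' \<omega>) \<omega>) - 2) (X (last_entry (Suc k') \<omega>) \<omega>)) \<in> P w \<rightarrow>\<^sub>M count_space UNIV"
      by (rule measurable_compose_countable[where f = "\<lambda>u \<omega>. drop (length u - 2) (X (last_entry (Suc k') \<omega>) \<omega>)"])
        (auto intro: measurable_compose[of _ _ "count_space UNIV"] simp del: last_entry.simps)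
    then show ?thesis by (simp add: Suc W.simps(2)[abs_def] del: last_entry.simps)
  qed
qed

lemma good_entries:
  assumes good: "good_path \<omega>"
  shows "length (X (last_entry k \<omega>) \<omega>) \<ge> 2 \<and> (\<forall>n\<ge>last_entry k \<omega>. X n \<omega> \<in> cone (X (last_entry k \<omega>) \<omega>))"
proof (induction k)
  case 0
  have "X (last_entry 0 \<omega>) \<omega> \<in> initial_words" using last_entry_0(2)[OF good] by (auto simp: initial_words_def simp del: last_entry.simps)
  then show ?case using initial_words_length last_entry_0(3)[OF good] by (simp del: last_entry.simps)
next
  case (Suc k)
  then show ?case
    using last_entry_Suc[OF good refl, of k] \<S>_cone(2)[of "X (last_entry k \<omega>) \<omega>"]
    by (force simp del: last_entry.simps)
qed

text \<open>The stem of a position is common to all words of its cone and is never changed again, so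
  positions and values of \<open>W\<close> determine each other.\<close>

lemma good_W:
  assumes good: "good_path \<omega>"
  shows "W 0 \<omega> \<in> initial_words" "X (last_entry (Suc k) \<omega>) \<omega> = stem (X (last_entry k \<omega>) \<omega>) @ W (Suc k) \<omega>"
    "suffix2 (X (last_entry k \<omega>) \<omega>) = suffix2 (W k \<omega>)" "W (Suc k) \<omega> \<in> \<S> (suffix2 (W k \<omega>))"
proof -
  let ?x = "\<lambda>k. X (last_entry k \<omega>) \<omega>"
  note len = good_entries[OF good, THEN conjunct1]
  have S: "?x (Suc k) \<in> \<S> (?x k)" for k
    using last_entry_Suc(2)[OF good refl, of k] good_entries[OF good, of k] by (simp del: last_entry.simps)
  have ex: "\<exists>y\<in>\<S> (suffix2 (?x k)). ?x (Suc k) = stem (?x k) @ y" for k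
    using S[of k] \<S>_suffix2[OF len[of k]] by auto
  have W: "?x (Suc k) = stem (?x k) @ W (Suc k) \<omega> \<and> W (Suc k) \<omega> \<in> \<S> (suffix2 (?x k))" for k
  proof -
    obtain y where y: "y \<in> \<S> (suffix2 (?x k))" "?x (Suc k) = stem (?x k) @ y" using ex by blast
    have "length (stem (?x k)) = length (?x k) - 2" by (simp add: stem_def del: last_entry.simps)
    then have "W (Suc k) \<omega> = y" using y(2) by (simp del: last_entry.simps)
    then show ?thesis using y by blast
  qed
  show "W 0 \<omega> \<in> initial_words" using last_entry_0(2)[OF good] by (auto simp: initial_words_def simp del: last_entry.simps)
  show "?x (Suc k) = stem (?x k) @ W (Suc k) \<omega>" using W[of k] by blast
  show suf: "suffix2 (?x k) = suffix2 (W k \<omega>)" for k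
  proof (cases k)
    case (Suc k')
    have "length (W (Suc k') \<omega>) \<ge> 2" using W[of k'] \<S>_length[OF len[of k']] by fastforce
    then show ?thesis using W[of k'] suffix2_append Suc by metis
  qed simp
  show "W (Suc k) \<omega> \<in> \<S> (suffix2 (W k \<omega>))" using W[of k] suf[of k] by (simp del: last_entry.simps W.simps)
qed

text \<open>Lists of values of \<open>W\<close> are also kept with the most recent value first.\<close>

primrec place :: "'a list \<Rightarrow> 'a list list \<Rightarrow> 'a list list" where
  "place w0 [] = [w0]"
| "place w0 (x # xs) = (stem (hd (place w0 xs)) @ x) # place w0 xs"

primrec W_past :: "'b \<Rightarrow> 'a list \<Rightarrow> 'a list list \<Rightarrow> bool" where
  "W_past \<omega> w0 [] \<longleftrightarrow> W 0 \<omega> = w0"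
| "W_past \<omega> w0 (x # xs) \<longleftrightarrow> W (Suc (length xs)) \<omega> = x \<and> W_past \<omega> w0 xs"

lemma length_place[simp]: "length (place w0 xs) = Suc (length xs)" by (induction xs) auto

lemma place_not_Nil[simp]: "place w0 xs \<noteq> []" by (cases xs) auto

lemma W_past_entries: assumes good: "good_path \<omega>" shows "W_past \<omega> w0 xs \<longleftrightarrow> entries \<omega> (place w0 xs)"
proof (induction xs)
  case (Cons x xs)
  have "entries \<omega> (place w0 xs) \<Longrightarrow> X (last_entry (length xs) \<omega>) \<omega> = hd (place w0 xs)"
    by (cases "place w0 xs") (auto simp del: last_entry.simps dest: arg_cong[of _ _ length])
  then show ?case
    using Cons good_W(2)[OF good, of "length xs"] by (auto simp del: last_entry.simps W.simps)
qed simp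

lemma admissible_Cons: "us \<noteq> [] \<Longrightarrow> admissible (u # us) \<longleftrightarrow> u \<in> \<S> (hd us) \<and> admissible us"
  by (cases us) auto

lemma place_facts:
  "admissible (place w0 xs) \<Longrightarrow> length (hd (place w0 xs)) \<ge> 2 \<and> suffix2 (hd (place w0 xs)) = suffix2 (hd (xs @ [w0]))"
proof (induction xs)
  case Nil
  then show ?case using admissible_length by fastforce
next
  case (Cons x xs)
  have "admissible (place w0 xs)" "stem (hd (place w0 xs)) @ x \<in> \<S> (hd (place w0 xs))"
    using Cons.prems by (auto simp: admissible_Cons)
  then have "length x \<ge> 2"
    using Cons.IH \<S>_suffix2[of "hd (place w0 xs)"] \<S>_length[of "hd (place w0 xs)" x] by auto
  then show ?case by (simp add: suffix2_append)
qed

lemma W_past_admissible: assumes good: "good_path \<omega>" shows "W_past \<omega> w0 xs \<Longrightarrow> admissible (place w0 xs)"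
proof (induction xs)
  case Nil
  then show ?case using good_W(1)[OF good] by (auto simp: initial_words_def)
next
  case (Cons x xs)
  then have adm: "admissible (place w0 xs)" and x: "W (Suc (length xs)) \<omega> = x" by auto
  have "entries \<omega> (place w0 (x # xs))" using Cons.prems W_past_entries[OF good] by blast
  then have e: "X (last_entry (length xs) \<omega>) \<omega> = hd (place w0 xs)"
    by (cases "place w0 xs") (auto simp del: last_entry.simps dest: arg_cong[of _ _ length])
  have "x \<in> \<S> (suffix2 (hd (place w0 xs)))"
    using good_W(3,4)[OF good, of "length xs"] x e by (simp del: last_entry.simps W.simps)
  then have "stem (hd (place w0 xs)) @ x \<in> \<S> (hd (place w0 xs))"
    using \<S>_suffix2 place_facts[OF adm] by blast
  then show ?case using adm by (simp add: admissible_Cons)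
qed

lemma W_past_pred[measurable]: "Measurable.pred (P w) (\<lambda>\<omega>. W_past \<omega> w0 xs)"
  by (induction xs) (simp_all del: W.simps)

lemma prob_W_past:
  assumes adm: "admissible (place w0 xs)"
  shows "\<P>(\<omega> in P []. W_past \<omega> w0 xs) = (\<Sum>m. entry_prob (place w0 xs) m) * \<xi> (suffix2 (hd (xs @ [w0])))"
proof -
  let ?us = "place w0 xs"
  have len: "length (hd ?us) \<ge> 2" using place_facts[OF adm] by blast
  have "\<P>(\<omega> in P []. W_past \<omega> w0 xs) = \<P>(\<omega> in P []. \<exists>m. entered (\<lambda>i. X i \<omega>) ?us m \<and> (\<forall>n\<ge>m. X n \<omega> \<in> cone (hd ?us)))"
  proof (rule P.prob_eq_AE)
    show "AE \<omega> in P []. W_past \<omega> w0 xs \<longleftrightarrow> (\<exists>m. entered (\<lambda>i. X i \<omega>) ?us m \<and> (\<forall>n\<ge>m. X n \<omega> \<in> cone (hd ?us)))"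
      using AE_good_path by eventually_elim (use W_past_entries entries_iff[OF _ adm] in blast)
  qed measurable
  also have "\<dots> = (\<Sum>m. entry_prob ?us m) * stay (hd ?us)"
    using sums_unique[OF entry_prob_stay_sums[of ?us]] suminf_mult2[OF summable_entry_prob[OF len], of "stay (hd ?us)"]
    by simp
  finally show ?thesis using stay_eq_\<xi>[OF len] place_facts[OF adm] by simp
qed

text \<open>One more value multiplies the summed entry probabilities by \<open>\<LL>\<close> and
  replaces the final staying probability by that of the new suffix. The quotient is
  \<open>q\<close>; histories that cannot occur have probability 0 on both sides.\<close>

lemma W_past_Cons:
  "\<P>(\<omega> in P []. W_past \<omega> w0 (x # xs)) = \<P>(\<omega> in P []. W_past \<omega> w0 xs) * q (hd (xs @ [w0])) x"
proof -
  let ?us = "place w0 xs" and ?ab = "suffix2 (hd (xs @ [w0]))"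
  have null: "\<P>(\<omega> in P []. W_past \<omega> w0 ys) = 0" if "\<not> admissible (place w0 ys)" for ys
  proof -
    have "AE \<omega> in P []. \<not> W_past \<omega> w0 ys"
      using AE_good_path by eventually_elim (use W_past_admissible that in blast)
    then show ?thesis by (subst P.prob_eq_0) auto
  qed
  show ?thesis
  proof (cases "admissible ?us")
    case False
    then have "\<not> admissible (place w0 (x # xs))" by (simp add: admissible_Cons)
    then show ?thesis using null[OF False] null[of "x # xs"] by (simp del: W_past.simps place.simps)
  next
    case adm: True
    note facts = place_facts[OF adm]
    have ab: "length ?ab = 2" using facts length_suffix2 by metis
    show ?thesis
    proof (cases "x \<in> \<S> ?ab")
      case False
      then have "\<not> admissible (place w0 (x # xs))"
        using \<S>_suffix2[of "hd ?us"] facts by (auto simp: admissible_Cons)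
      then show ?thesis using null[of "x # xs"] False by (simp add: q_def del: W_past.simps place.simps)
    next
      case True
      then have adm': "admissible (place w0 (x # xs))"
        using \<S>_suffix2[of "hd ?us"] facts adm by (auto simp: admissible_Cons)
      have x: "length x \<ge> 2" using \<S>_cone(2)[OF _ True] ab by simp
      obtain v vs where us: "?us = v # vs" by (cases ?us) auto
      have v: "length v \<ge> 2" "suffix2 v = ?ab" using facts us by auto
      have "(\<Sum>m. entry_prob (place w0 (x # xs)) m) = (\<Sum>m. entry_prob ?us m) * \<LL> v (stem v @ x)"
        using suminf_entry_prob[of v "stem v @ x" vs] v x by (simp add: us)
      also have "\<LL> v (stem v @ x) = \<LL> ?ab x"
        using \<LL>_append[of ?ab x "stem v"] ab x v stem_append_suffix2[of v] by simp
      finally show ?thesis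
        using prob_W_past[OF adm'] prob_W_past[OF adm] \<xi>_pos[OF ab] True by (simp add: q_def)
    qed
  qed
qed

lemma W_past_rev: "W_past \<omega> w0 (rev xs) \<longleftrightarrow> W 0 \<omega> = w0 \<and> (\<forall>i<length xs. W (Suc i) \<omega> = xs ! i)"
  by (induction xs rule: rev_induct) (auto simp: nth_append less_Suc_eq simp del: W.simps)

theorem prob_W:
  "\<P>(\<omega> in P []. W 0 \<omega> = w0 \<and> (\<forall>i<length xs. W (Suc i) \<omega> = xs ! i))
    = \<P>(\<omega> in P []. W 0 \<omega> = w0) * path_prod q w0 xs"
  unfolding W_past_rev[symmetric]
proof (induction xs rule: rev_induct)
  case (snoc x xs)
  have "hd (rev xs @ [w0]) = last (w0 # xs)" by (cases xs rule: rev_cases) auto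
  then show ?case
    using W_past_Cons[of w0 x "rev xs"] snoc by (simp add: path_prod_append mult.assoc del: W_past.simps last.simps)
qed (simp del: W.simps)

lemma AE_initial_words: "AE \<omega> in P []. W 0 \<omega> \<in> initial_words"
  using AE_good_path by eventually_elim (rule good_W(1))

lemma sum_initial_words:
  assumes [measurable]: "Measurable.pred (P []) E"
  shows "\<P>(\<omega> in P []. E \<omega>) = (\<Sum>w0\<in>initial_words. \<P>(\<omega> in P []. W 0 \<omega> = w0 \<and> E \<omega>))"
proof -
  have "\<P>(\<omega> in P []. E \<omega>) = \<P>(\<omega> in P []. \<exists>w0\<in>initial_words. W 0 \<omega> = w0 \<and> E \<omega>)"
    by (rule P.prob_eq_AE) (use AE_initial_words in \<open>auto elim: eventually_mono simp del: W.simps\<close>)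
  also have "{\<omega> \<in> space (P []). \<exists>w0\<in>initial_words. W 0 \<omega> = w0 \<and> E \<omega>} = (\<Union>w0\<in>initial_words. {\<omega> \<in> space (P []). W 0 \<omega> = w0 \<and> E \<omega>})"
    by auto
  also have "P.prob [] \<dots> = (\<Sum>w0\<in>initial_words. \<P>(\<omega> in P []. W 0 \<omega> = w0 \<and> E \<omega>))"
    by (intro P.finite_measure_finite_Union) (auto simp: disjoint_family_on_def simp del: W.simps)
  finally show ?thesis .
qed

text \<open>The product formula averaged over \<open>W 0\<close>, which is needed since path weights
  condition on \<open>W 1\<close> alone.\<close>

lemma prob_W_1:
  "\<P>(\<omega> in P []. W 1 \<omega> = x \<and> (\<forall>i<length xs. W (Suc (Suc i)) \<omega> = xs ! i))
    = \<P>(\<omega> in P []. W 1 \<omega> = x) * path_prod q x xs"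
proof -
  have 1: "\<P>(\<omega> in P []. W 0 \<omega> = w0 \<and> W 1 \<omega> = x \<and> (\<forall>i<length xs. W (Suc (Suc i)) \<omega> = xs ! i))
     = \<P>(\<omega> in P []. W 0 \<omega> = w0) * (q w0 x * path_prod q x xs)" for w0 xs
    using prob_W[of w0 "x # xs"] by (simp add: All_less_Suc2 del: W.simps)
  show ?thesis
    using sum_initial_words[of "\<lambda>\<omega>. W 1 \<omega> = x \<and> (\<forall>i<length xs. W (Suc (Suc i)) \<omega> = xs ! i)"]
      sum_initial_words[of "\<lambda>\<omega>. W 1 \<omega> = x"] 1[of _ xs] 1[of _ "[]"]
    by (simp add: sum_distrib_right mult.assoc del: W.simps)
qed

section \<open>Positive transitions, possible values and path weights\<close>

declare W.simps [simp del] last_entry.simps [simp del]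

text \<open>All three data are read off the set: its smallest word length, the stem shared by its
  words, and what is left after removing that stem.\<close>

lemma cone_eq_imp:
  assumes eq: "cone u = cone v" and u: "length u \<ge> 2"
  shows "length u = length v" "stem u = stem v" "cone_type u = cone_type v"
proof -
  have uv: "u \<in> cone v" "v \<in> cone u" using cone_refl[of u] cone_refl[of v] unfolding eq by blast+
  then show l: "length u = length v" using cone_length[of u v] cone_length[of v u] by simp
  show s: "stem u = stem v" using cone_prefix[OF uv(1)] u l by (auto simp: stem_def)
  have "(@) (stem v) ` cone_type u = cone u" unfolding cone_suffix2[OF u] s ..
  also have "\<dots> = (@) (stem v) ` cone_type v" unfolding eq by (rule cone_suffix2) (use u l in simp)
  finally have "(@) (stem v) ` cone_type u = (@) (stem v) ` cone_type v" .
  then show "cone_type u = cone_type v" by (rule inj_image_eq_iff[THEN iffD1, rotated]) (simp add: inj_def)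
qed

text \<open>A boundary word \<open>y\<close> has a shorter neighbour \<open>v\<close>, which lies
  outside the cone of \<open>y\<close> but still in that of \<open>x\<close>. A path from
  \<open>x\<close> to \<open>v\<close> followed by the step to \<open>y\<close> is an entry of
  positive probability.\<close>

lemma \<LL>_pos:
  assumes x: "length x = 2" and y: "y \<in> \<S> x" shows "\<LL> x y > 0"
proof -
  obtain r where r: "r \<in> roots x" "y \<in> boundary r" using y by (auto simp: \<S>_eq)
  have len: "length y > 2" "y \<in> cone x" using \<S>_cone[of x y] x y by auto
  obtain v where v: "p y v > 0" "length v < length y"
    using r(2) boundary_cone(3)[OF r(2)] by (auto simp: boundary_iff)
  \<comment> \<open>The step from \<open>v\<close> to \<open>y\<close> adds at most one letter and
    \<open>y\<close> has at least three.\<close>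
  have vl: "length v \<ge> 2" using step_length[OF p_sym[OF v(1)]] len by simp
  have vx: "v \<in> cone x" using cone_closed[OF len(2) v(1)] vl x by simp
  have vy: "v \<notin> cone y" using cone_length[of v y] v(2) by auto
  obtain n where n: "\<P>(\<omega> in P x. (\<forall>m\<le>n. X m \<omega> \<in> cone x) \<and> X n \<omega> = v) > 0"
    using pos_of_reach[OF cone_reach[OF vx]] by auto
  have "\<P>(\<omega> in P x. (\<forall>m\<le>n. X m \<omega> \<in> cone x) \<and> X n \<omega> = v \<and> X (n + 1) \<omega> = y)
      = \<P>(\<omega> in P x. (\<forall>m\<le>n. X m \<omega> \<in> cone x) \<and> X n \<omega> = v) * p v y"
    using markov_property[of "\<lambda>f. f 1 = y" x "\<lambda>l. \<forall>z\<in>set l. z \<in> cone x" n v] prob_step[of v y]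
    by (simp add: ball_trace[of _ _ "\<lambda>y. y \<in> cone x"])
  then have "0 < \<P>(\<omega> in P x. (\<forall>m\<le>n. X m \<omega> \<in> cone x) \<and> X n \<omega> = v \<and> X (n + 1) \<omega> = y)"
    using n p_sym[OF v(1)] by simp
  also have "\<dots> \<le> first_entry x y n"
    unfolding first_entry_def using vy len(2) by (intro P.finite_measure_mono) (auto simp: le_Suc_eq)
  also have "\<dots> \<le> \<LL> x y"
    unfolding \<LL>_first_entry using sum_le_suminf[OF summable_first_entry[of y x], of "{n}"] len by simp
  finally show ?thesis .
qed

text \<open>Possible transitions are decided by \<open>\<S>\<close>, hence by the cone type alone;
  this is the source of the property \<open>q_pos_type\<close> of the abstract chain.\<close>

lemma q_pos_iff: assumes x: "length x \<ge> 2" shows "q x y > 0 \<longleftrightarrow> y \<in> \<S> (suffix2 x)"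
proof (cases "y \<in> \<S> (suffix2 x)")
  case True
  have l: "length (suffix2 x) = 2" using length_suffix2[OF x] .
  have y: "length (suffix2 y) = 2" using \<S>_length[OF x True] by (intro length_suffix2) simp
  show ?thesis using True \<LL>_pos[OF l True] \<xi>_pos[OF l] \<xi>_pos[OF y] by (simp add: q_def)
qed (simp add: q_def)

lemma q_nonneg: "length x \<ge> 2 \<Longrightarrow> q x y \<ge> 0"
  using q_pos_iff[of x y] by (cases "y \<in> \<S> (suffix2 x)") (auto simp: q_def)

lemma q_suffix2: "suffix2 x = suffix2 x' \<Longrightarrow> q x y = q x' y"
  by (simp add: q_def)

lemma W_values_iff:
  "x \<in> W_values \<longleftrightarrow> (\<exists>w0\<in>initial_words. \<P>(\<omega> in P []. W 0 \<omega> = w0) > 0 \<and> x \<in> \<S> (suffix2 w0))"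
proof -
  have e: "\<P>(\<omega> in P []. W 1 \<omega> = x) = (\<Sum>w0\<in>initial_words. \<P>(\<omega> in P []. W 0 \<omega> = w0) * q w0 x)"
    using sum_initial_words[of "\<lambda>\<omega>. W 1 \<omega> = x"] prob_W[of _ "[x]"] by (simp del: W.simps)
  have "x \<in> W_values \<longleftrightarrow> (\<exists>w0\<in>initial_words. \<P>(\<omega> in P []. W 0 \<omega> = w0) * q w0 x \<noteq> 0)"
    unfolding W_values_def mem_Collect_eq e
    by (subst less_le) (auto simp: sum_nonneg_eq_0_iff q_nonneg initial_words_length sum_nonneg eq_commute[of 0])
  also have "\<dots> \<longleftrightarrow> (\<exists>w0\<in>initial_words. \<P>(\<omega> in P []. W 0 \<omega> = w0) > 0 \<and> x \<in> \<S> (suffix2 w0))"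
  proof (intro bex_cong refl)
    fix w0 assume "w0 \<in> initial_words"
    then have "q w0 x > 0 \<longleftrightarrow> x \<in> \<S> (suffix2 w0)" by (intro q_pos_iff initial_words_length)
    moreover have "q w0 x \<noteq> 0 \<longleftrightarrow> q w0 x > 0" using q_nonneg[OF initial_words_length, of w0 x] \<open>w0 \<in> initial_words\<close> by auto
    ultimately show "\<P>(\<omega> in P []. W 0 \<omega> = w0) * q w0 x \<noteq> 0 \<longleftrightarrow> \<P>(\<omega> in P []. W 0 \<omega> = w0) > 0 \<and> x \<in> \<S> (suffix2 w0)"
      by (simp add: zero_less_measure_iff)
  qed
  finally show ?thesis .
qed

lemma finite_W_values: "finite W_values"
  by (rule finite_subset[of _ "\<Union>w0\<in>initial_words. \<S> (suffix2 w0)"]) (auto simp: W_values_iff)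

lemma W_values_length: "x \<in> W_values \<Longrightarrow> length x \<ge> 3"
  using \<S>_length initial_words_length by (auto simp: W_values_iff)

lemma W_values_boundary: assumes "x \<in> W_values" shows "x \<in> boundary x"
proof -
  obtain w r where "r \<in> roots w" "x \<in> boundary r" using assms by (auto simp: W_values_iff \<S>_eq)
  then show ?thesis using boundary_cone(2) by blast
qed

lemma prob_W_0_1:
  assumes w0: "length w0 \<ge> 2"
  shows "\<P>(\<omega> in P []. W 0 \<omega> = w0 \<and> W 1 \<omega> = x) > 0 \<longleftrightarrow>
    \<P>(\<omega> in P []. W 0 \<omega> = w0) > 0 \<and> x \<in> \<S> (suffix2 w0)"
  using prob_W[of w0 "[x]"] q_pos_iff[OF w0, of x] q_nonneg[OF w0, of x]
  by (auto simp: zero_less_mult_iff zero_less_measure_iff simp del: W.simps)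

lemma prob_W_0_initial_words: "\<P>(\<omega> in P []. W 0 \<omega> = w0 \<and> E \<omega>) > 0 \<Longrightarrow> w0 \<in> initial_words"
  using P.prob_pos_witness[OF _ AE_initial_words, of "\<lambda>\<omega>. W 0 \<omega> = w0 \<and> E \<omega>"] by auto

lemma AE_W_values: "AE \<omega> in P []. W 1 \<omega> \<in> W_values"
proof -
  have "AE \<omega> in P []. x \<notin> W_values \<longrightarrow> W 1 \<omega> \<noteq> x" for x
  proof (cases "x \<in> W_values")
    case False
    then have "\<P>(\<omega> in P []. W 1 \<omega> = x) = 0" by (simp add: W_values_def zero_less_measure_iff)
    then have "AE \<omega> in P []. W 1 \<omega> \<noteq> x" by (subst (asm) P.prob_eq_0) (auto simp del: W.simps)
    then show ?thesis by eventually_elim simp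
  qed simp
  then have "AE \<omega> in P []. \<forall>x. x \<notin> W_values \<longrightarrow> W 1 \<omega> \<noteq> x" unfolding AE_all_countable by blast
  then show ?thesis by eventually_elim blast
qed

lemma path_prod_suffix2:
  "suffix2 x = suffix2 x' \<Longrightarrow> xs \<noteq> [] \<Longrightarrow> path_prod q x xs = path_prod q x' xs"
  by (cases xs) (auto simp: q_suffix2[of x x'])

text \<open>All values of \<open>W 1\<close> ending in \<open>ab\<close> have the same transition
  row, so the conditional probability is the path product started from \<open>ab\<close> itself. The
  event about the last suffix holds by the choice of \<open>xs\<close>.\<close>

lemma path_weight_eq:
  assumes ab: "\<P>(\<omega> in P []. suffix2 (W 1 \<omega>) = ab) > 0" "suffix2 ab = ab"
    and xs: "xs \<noteq> []" "suffix2 (last xs) = ab"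
  shows "path_weight ab xs = path_prod q ab xs"
proof -
  let ?U = "{x \<in> W_values. suffix2 x = ab}"
  let ?R = "\<lambda>\<omega>. \<forall>i<length xs. W (Suc (Suc i)) \<omega> = xs ! i"
  have fin: "finite ?U" using finite_W_values by simp
  have sum: "\<P>(\<omega> in P []. E \<omega> \<and> suffix2 (W 1 \<omega>) = ab) = (\<Sum>x\<in>?U. \<P>(\<omega> in P []. W 1 \<omega> = x \<and> E \<omega>))"
    if [measurable]: "Measurable.pred (P []) E" for E
  proof -
    have "\<P>(\<omega> in P []. E \<omega> \<and> suffix2 (W 1 \<omega>) = ab) = \<P>(\<omega> in P []. \<exists>x\<in>?U. W 1 \<omega> = x \<and> E \<omega>)"
    proof (rule P.prob_eq_AE)
      have "{\<omega> \<in> space (P []). \<exists>x\<in>?U. W 1 \<omega> = x \<and> E \<omega>} = (\<Union>x\<in>?U. {\<omega> \<in> space (P []). W 1 \<omega> = x \<and> E \<omega>})"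
        by auto
      then show "{\<omega> \<in> space (P []). \<exists>x\<in>?U. W 1 \<omega> = x \<and> E \<omega>} \<in> P.events []"
        using fin by (auto intro!: sets.finite_UN simp del: W.simps)
      have [measurable]: "Measurable.pred (P []) (\<lambda>\<omega>. suffix2 (W 1 \<omega>) = ab)"
        by (rule measurable_compose[OF W_meas]) simp
      show "{\<omega> \<in> space (P []). E \<omega> \<and> suffix2 (W 1 \<omega>) = ab} \<in> P.events []" by measurable
      show "AE \<omega> in P []. (E \<omega> \<and> suffix2 (W 1 \<omega>) = ab) = (\<exists>x\<in>?U. W 1 \<omega> = x \<and> E \<omega>)"
        using AE_W_values by eventually_elim (auto simp del: W.simps)
    qed
    also have "{\<omega> \<in> space (P []). \<exists>x\<in>?U. W 1 \<omega> = x \<and> E \<omega>} = (\<Union>x\<in>?U. {\<omega> \<in> space (P []). W 1 \<omega> = x \<and> E \<omega>})"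
      by auto
    also have "P.prob [] \<dots> = (\<Sum>x\<in>?U. \<P>(\<omega> in P []. W 1 \<omega> = x \<and> E \<omega>))"
      using fin by (intro P.finite_measure_finite_Union) (auto simp: disjoint_family_on_def simp del: W.simps)
    finally show ?thesis .
  qed
  have ev: "(\<forall>i\<in>{2..length xs + 1}. W i \<omega> = xs ! (i - 2)) \<and> suffix2 (W (length xs + 1) \<omega>) = ab \<longleftrightarrow> ?R \<omega>" for \<omega>
  proof
    assume a: "(\<forall>i\<in>{2..length xs + 1}. W i \<omega> = xs ! (i - 2)) \<and> suffix2 (W (length xs + 1) \<omega>) = ab"
    show "?R \<omega>"
    proof (intro allI impI)
      fix i assume "i < length xs"
      then have "Suc (Suc i) \<in> {2..length xs + 1}" by simp
      then have "W (Suc (Suc i)) \<omega> = xs ! (Suc (Suc i) - 2)" by (rule bspec[OF conjunct1[OF a]])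
      then show "W (Suc (Suc i)) \<omega> = xs ! i" by simp
    qed
  next
    assume R: "?R \<omega>"
    have 1: "W i \<omega> = xs ! (i - 2)" if "i \<in> {2..length xs + 1}" for i
    proof -
      have "i - 2 < length xs" and i: "Suc (Suc (i - 2)) = i" using that by auto
      then have "W (Suc (Suc (i - 2))) \<omega> = xs ! (i - 2)" using R by blast
      then show ?thesis unfolding i .
    qed
    have "length xs + 1 \<in> {2..length xs + 1}" using xs(1) by (cases xs) auto
    then have "W (length xs + 1) \<omega> = last xs" using 1 xs(1) by (simp add: last_conv_nth del: W.simps)
    then show "(\<forall>i\<in>{2..length xs + 1}. W i \<omega> = xs ! (i - 2)) \<and> suffix2 (W (length xs + 1) \<omega>) = ab"
      using 1 xs(2) by (intro conjI ballI) simp_all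
  qed
  have "\<P>(\<omega> in P []. ?R \<omega> \<and> suffix2 (W 1 \<omega>) = ab) = (\<Sum>x\<in>?U. \<P>(\<omega> in P []. W 1 \<omega> = x \<and> ?R \<omega>))"
    by (rule sum) measurable
  also have "\<dots> = (\<Sum>x\<in>?U. \<P>(\<omega> in P []. W 1 \<omega> = x) * path_prod q ab xs)"
  proof (intro sum.cong refl)
    fix x assume "x \<in> ?U"
    then have "path_prod q x xs = path_prod q ab xs"
      using path_prod_suffix2[of x ab xs] xs(1) ab(2) by simp
    then show "\<P>(\<omega> in P []. W 1 \<omega> = x \<and> ?R \<omega>) = \<P>(\<omega> in P []. W 1 \<omega> = x) * path_prod q ab xs"
      by (simp only: prob_W_1)
  qed
  also have "\<dots> = \<P>(\<omega> in P []. suffix2 (W 1 \<omega>) = ab) * path_prod q ab xs"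
    using sum[of "\<lambda>_. True"] by (simp add: sum_distrib_right del: W.simps)
  finally show ?thesis
    using ab(1) unfolding path_weight_def cond_prob_def ev by simp
qed

subsection \<open>Every type is reached from every type\<close>

definition subtype :: "'a list set \<Rightarrow> 'a list set \<Rightarrow> bool" where
  "subtype i j \<longleftrightarrow> (\<exists>v\<in>set (cov i). cone_type v = j)"

text \<open>A path from the empty word to \<open>w\<close> has to enter the cone, and it does so
  through the boundary.\<close>

lemma boundary_not_empty:
  assumes "w \<in> language" "length w \<ge> 2" shows "boundary w \<noteq> {}"
proof -
  have "(\<lambda>u v. p u v > 0)\<^sup>*\<^sup>* [] w" using assms by (simp add: language_iff)
  then have "[] \<in> cone w \<or> boundary w \<noteq> {}"
  proof (induction rule: converse_rtranclp_induct)
    case (step u v)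
    then show ?case using boundary_exit[of v w u] p_sym by blast
  qed simp
  then show ?thesis using cone_length[of "[]" w] assms(2) by auto
qed

text \<open>
  Iterating the single subcone \<open>w \<mapsto> w\<^sub>1 \<mapsto> w\<^sub>2 \<mapsto> \<dots>\<close> leaves only finitely many words of \<open>C(w)\<close>
  outside \<open>C(w\<^sub>k)\<close>.  A cone \<open>C(u) \<subseteq> C(w)\<close> with \<open>|u| = |w\<^sub>k|\<close> is infinite, hence equal to \<open>C(w\<^sub>k)\<close>.
\<close>

lemma subtype_reach_nonexpanding:
  assumes ne: "\<not> expanding" and w: "w \<in> language" "length w \<ge> 2" and ab: "length ab = 2"
  shows "subtype\<^sup>+\<^sup>+ (cone_type w) (cone_type ab)"
proof -
  have single: "\<exists>r. roots w = {r} \<and> length r = Suc (length w) \<and> r \<in> cone w \<and> finite (cone w - cone r) \<and>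
      subtype (cone_type w) (cone_type r)" if w: "length w \<ge> 2" for w
  proof -
    have "length (cov (cone_type w)) = 1 \<and> (\<forall>v\<in>set (cov (cone_type w)). length v = 3)"
      using covering[OF cone_type_in[OF w]] ne by (simp add: is_covering_def)
    then obtain v where v: "cov (cone_type w) = [v]" "length v = 3" by (auto simp: length_Suc_conv)
    have l: "length (stem w @ v) = Suc (length w)" using v(2) w by (simp add: stem_def)
    have "subtype (cone_type w) (cone_type (stem w @ v))"
      using v by (auto simp: subtype_def cone_type_append)
    then show ?thesis using l cover[OF w] v(1) by (auto simp: roots_def)
  qed
  define nxt where "nxt w = (THE r. roots w = {r})" for w
  have nxt: "roots w = {nxt w}" "length (nxt w) = Suc (length w)" "nxt w \<in> cone w" "finite (cone w - cone (nxt w))"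
    "subtype (cone_type w) (cone_type (nxt w))" if len: "length w \<ge> 2" for w
  proof -
    obtain r where r: "roots w = {r}" "length r = Suc (length w)" "r \<in> cone w" "finite (cone w - cone r)"
      "subtype (cone_type w) (cone_type r)" using single[OF len] by blast
    from r(1) have "nxt w = r" unfolding nxt_def by simp
    with r show "roots w = {nxt w}" "length (nxt w) = Suc (length w)" "nxt w \<in> cone w" "finite (cone w - cone (nxt w))"
    "subtype (cone_type w) (cone_type (nxt w))" by simp_all
  qed
  have iter: "length ((nxt ^^ k) w) = length w + k \<and> (nxt ^^ k) w \<in> cone w \<and> finite (cone w - cone ((nxt ^^ k) w))
     \<and> (k > 0 \<longrightarrow> subtype\<^sup>+\<^sup>+ (cone_type w) (cone_type ((nxt ^^ k) w)))" if w: "length w \<ge> 2" for k :: nat and w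
  proof (induction k)
    case (Suc k)
    let ?u = "(nxt ^^ k) w"
    have u: "length ?u \<ge> 2" using Suc w by simp
    note n = nxt[OF u]
    have "cone w - cone (nxt ?u) \<subseteq> (cone w - cone ?u) \<union> (cone ?u - cone (nxt ?u))" by blast
    then have "finite (cone w - cone (nxt ?u))" using Suc n(4) finite_subset by blast
    moreover have "nxt ?u \<in> cone w" using cone_mono[of ?u w] Suc n(3) by blast
    moreover have "subtype\<^sup>+\<^sup>+ (cone_type w) (cone_type (nxt ?u))"
    proof (cases "k = 0")
      case True
      then show ?thesis using n(5) by simp
    next
      case False
      then have "subtype\<^sup>+\<^sup>+ (cone_type w) (cone_type ?u)" using Suc by simp
      then show ?thesis using n(5) by (rule tranclp.trancl_into_trancl)
    qed
    ultimately show ?case using Suc n(2) by simp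
  qed simp
  have inf: "infinite (cone u)" if u: "length u \<ge> 2" for u
  proof
    assume "finite (cone u)"
    then have "finite (length ` cone u)" by simp
    then obtain m where m: "\<forall>n\<in>length ` cone u. n \<le> m" unfolding finite_nat_set_iff_bounded_le by blast
    define v where "v = (nxt ^^ Suc m) u"
    have v: "length v = length u + Suc m" "v \<in> cone u"
      using iter[OF u, of "Suc m"] unfolding v_def[symmetric] by blast+
    have "length v \<le> m" using m v(2) by blast
    then show False using v(1) by simp
  qed
  \<comment> \<open>The suffix is sought in the first subcone and not in the cone of
    \<open>w\<close>, so that \<open>u\<close> is longer than \<open>w\<close> and at least one
    subtype step is made.\<close>
  have r: "nxt w \<in> language" "length (nxt w) \<ge> 2"
    using nxt(2,3)[OF w(2)] w cone_subset_language by auto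
  obtain u where u: "u \<in> cone (nxt w)" "suffix2 u = ab" using suffix_occurs[OF r ab] by blast
  have ul: "length u \<ge> Suc (length w)" using cone_length[OF u(1)] nxt(2)[OF w(2)] by simp
  define k where "k = length u - length w"
  have k: "k > 0" "length u = length w + k" using ul by (auto simp: k_def)
  let ?v = "(nxt ^^ k) w"
  have v: "length ?v = length u" "finite (cone w - cone ?v)" "subtype\<^sup>+\<^sup>+ (cone_type w) (cone_type ?v)"
    using iter[OF w(2), of k] k by auto
  have sub: "cone u \<subseteq> cone w"
    using cone_mono[OF u(1)] cone_mono[OF nxt(3)[OF w(2)]] by (rule subset_trans)
  have "\<exists>z. z \<in> cone u \<and> z \<in> cone ?v"
  proof (rule ccontr)
    assume "\<not> ?thesis"
    then have "cone u \<subseteq> cone w - cone ?v" using sub by blast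
    then have "finite (cone u)" using v(2) by (rule finite_subset)
    then show False using inf[of u] ul w(2) by simp
  qed
  then obtain z where z: "z \<in> cone u" "z \<in> cone ?v" by blast
  have "u \<in> cone ?v" by (rule cone_meet[OF z]) (simp add: v(1))
  then have "cone_type u = cone_type ?v"
    using cone_eqI[of u ?v] v(1) w(2) ul by (intro cone_eq_imp(3)) simp_all
  moreover have "cone_type u = cone_type ab" using u(2) ab by (simp add: cone_type_def suffix2_id)
  ultimately show ?thesis using v(3) by simp
qed

text \<open>An expanding walk needs one step, since every covering contains all types. Otherwise
  \<open>w\<close> is first exchanged for a word of the language with the same last two
  letters.\<close>

lemma subtype_reach:
  assumes w: "length w \<ge> 2" and ab: "length ab = 2"
  shows "subtype\<^sup>+\<^sup>+ (cone_type w) (cone_type ab)"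
proof (cases expanding)
  case True
  have "cone_types \<subseteq> cone_type ` set (cov (cone_type w))"
    using covering[OF cone_type_in[OF w]] True by (simp add: is_covering_def)
  then have "subtype (cone_type w) (cone_type ab)"
    using cone_type_in[of ab] ab unfolding subtype_def by fastforce
  then show ?thesis by blast
next
  case False
  obtain w' where "w' \<in> language" "length w' \<ge> 2" "suffix2 w' = suffix2 w"
    using language_suffix_exists[OF length_suffix2[OF w]] by blast
  then show ?thesis using subtype_reach_nonexpanding[OF False, of w' ab] ab by (simp add: cone_type_def)
qed

text \<open>Nonempty boundaries are known only inside the language. The subcone is therefore placed
  at a word of the language with the same suffix, and its boundary is translated back.\<close>

lemma subtype_entry:
  assumes x: "length x \<ge> 2" and ij: "subtype (cone_type x) j"
  shows "\<exists>y\<in>\<S> (suffix2 x). cone_type y = j"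
proof -
  obtain v where v: "v \<in> set (cov (cone_type x))" "cone_type v = j" using ij by (auto simp: subtype_def)
  obtain w where w: "w \<in> language" "length w \<ge> 2" "suffix2 w = suffix2 x"
    using language_suffix_exists[OF length_suffix2[OF x]] by blast
  have ct: "cone_type w = cone_type x" "cone_type (suffix2 x) = cone_type x"
    using w(3) cone_type_suffix2[OF x] by (auto simp: cone_type_def)
  have r: "stem w @ v \<in> roots w" using v ct by (simp add: roots_def)
  have s2: "length (suffix2 x) = 2" using length_suffix2[OF x] .
  have r2: "v \<in> roots (suffix2 x)" using v ct stem_Nil[OF s2] by (simp add: roots_def)
  have vl: "length v \<ge> 2" using cover(1)[OF _ r2] s2 by simp
  have "boundary (stem w @ v) \<noteq> {}"
    using cover(1,2)[OF w(2) r] w cone_subset_language by (intro boundary_not_empty) auto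
  then obtain y where y: "y \<in> boundary v" using boundary_append[OF vl] by auto
  have "cone_type y = cone_type v"
    using boundary_cone(1,3)[OF y] vl by (intro cone_eq_imp(3)) auto
  then show ?thesis using r2 y v by (auto simp: \<S>_eq)
qed

end

section \<open>The hidden Markov chain\<close>

locale hidden_walk = transient_covered_walk K P X cov C0
  for K :: "'a::finite list \<Rightarrow> 'a list pmf"
    and P :: "'a list \<Rightarrow> 'w measure"
    and X :: "nat \<Rightarrow> 'w \<Rightarrow> 'a list"
    and cov :: "'a list set \<Rightarrow> 'a list list"
    and C0 :: "'a list list" +
  fixes \<nu> :: "('a cone_label \<times> 'a list) pmf" and N :: "'n measure"
    and Z :: "nat \<Rightarrow> 'n \<Rightarrow> 'a cone_label \<times> 'a list" and a b :: 'a
  assumes hidden_invariant: "hidden_invariant \<nu>"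
    and hidden_chain: "markov_chain N hidden_states (pmf \<nu>) hidden_trans (\<lambda>k. Z (Suc k))"
    and unambiguous: "boundary [a, b] = {[a, b]}"
begin

sublocale N: prob_space N using hidden_chain by (simp add: markov_chain_def)

section \<open>Hidden states as words labelled by the preceding type\<close>

definition entry_set :: "'a list set \<Rightarrow> 'a list set" where
  "entry_set m = (\<Union>v\<in>set (cov m). boundary v)"

definition initial_types :: "'a list set set" where
  "initial_types = {cone_type w | w. w \<in> initial_words \<and> \<P>(\<omega> in P []. W 0 \<omega> = w) > 0}"

definition labelled_root :: "'a list set \<Rightarrow> 'a list set \<Rightarrow> nat \<Rightarrow> 'a list" where
  "labelled_root m j n = subcones m j ! (n - 1)"

lemma \<S>_entry_set: assumes x: "length x \<ge> 2" shows "\<S> (suffix2 x) = entry_set (cone_type x)"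
  using stem_Nil[OF length_suffix2[OF x]] by (simp add: \<S>_def entry_set_def cone_type_suffix2[OF x])

lemma type_representative: "m \<in> cone_types \<Longrightarrow> \<exists>w. length w = 2 \<and> cone_type w = m"
proof -
  assume "m \<in> cone_types"
  then obtain c d where "m = cone [c, d]" by (auto simp: cone_types_def)
  then have "length [c, d] = 2 \<and> cone_type [c, d] = m" by (simp add: cone_type_def suffix2_id)
  then show ?thesis by blast
qed

lemma roots_representative: "length w = 2 \<Longrightarrow> roots w = set (cov (cone_type w))"
  by (simp add: roots_def stem_Nil)

lemma cover_type:
  assumes "m \<in> cone_types"
  shows "v \<in> set (cov m) \<Longrightarrow> length v \<ge> 3"
    "v \<in> set (cov m) \<Longrightarrow> v' \<in> set (cov m) \<Longrightarrow> v \<noteq> v' \<Longrightarrow> cone v \<inter> cone v' = {}"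
    "distinct (cov m)"
proof -
  obtain w where w: "length w = 2" "cone_type w = m" using type_representative[OF assms] by blast
  have R: "roots w = set (cov m)" using roots_representative[OF w(1)] w(2) by simp
  show "v \<in> set (cov m) \<Longrightarrow> length v \<ge> 3" using cover(1)[of w v] w R by simp
  show "v \<in> set (cov m) \<Longrightarrow> v' \<in> set (cov m) \<Longrightarrow> v \<noteq> v' \<Longrightarrow> cone v \<inter> cone v' = {}"
    using cover(3)[of w v v'] w R by simp
  obtain w0 a' b' where w0: "w = w0 @ [a', b']" using snoc2_exists[of w] w(1) by auto
  then have w': "w = [] @ [a', b']" using w(1) by simp
  have "is_covering m (cov m)" by (rule covering[OF assms])
  then have "cone (cov m ! k) \<inter> cone (cov m ! l) = {}" if "k < length (cov m)" "l < length (cov m)" "k \<noteq> l" for k l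
    using that w(2) unfolding is_covering_def w' by (metis append_Nil)
  then show "distinct (cov m)" unfolding distinct_conv_nth by (metis cone_refl disjoint_iff)
qed

text \<open>The cones of a covering are disjoint, so only one of their boundaries contains
  \<open>y\<close>; its root has the type of \<open>y\<close> and is therefore listed among the
  subcones of that type.\<close>

lemma entry_set_root:
  assumes m: "m \<in> cone_types" and y: "y \<in> entry_set m"
  shows "\<exists>!n. n \<in> {1..num_subcones m (cone_type y)} \<and> y \<in> boundary (labelled_root m (cone_type y) n)"
proof -
  obtain v where v: "v \<in> set (cov m)" "y \<in> boundary v" using y by (auto simp: entry_set_def)
  have "cone_type y = cone_type v"
    using cover_type(1)[OF m v(1)] boundary_cone[OF v(2)] by (intro cone_eq_imp(3)) auto
  then have "v \<in> set (subcones m (cone_type y))" using v by (simp add: subcones_def)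
  then obtain k where k: "k < length (subcones m (cone_type y))" "subcones m (cone_type y) ! k = v"
    by (auto simp: in_set_conv_nth)
  show ?thesis
  proof (rule ex1I[of _ "Suc k"])
    show "Suc k \<in> {1..num_subcones m (cone_type y)} \<and> y \<in> boundary (labelled_root m (cone_type y) (Suc k))"
      using k v by (simp add: num_subcones_def labelled_root_def)
    fix n assume n: "n \<in> {1..num_subcones m (cone_type y)} \<and> y \<in> boundary (labelled_root m (cone_type y) n)"
    then have n': "n - 1 < length (subcones m (cone_type y))" by (auto simp: num_subcones_def)
    let ?v' = "subcones m (cone_type y) ! (n - 1)"
    have "?v' \<in> set (subcones m (cone_type y))" using n' by (rule nth_mem)
    then have "?v' \<in> set (cov m)" by (simp add: subcones_def)
    moreover have "y \<in> cone v" "y \<in> cone ?v'" using n v(2) boundary_subset by (auto simp: labelled_root_def)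
    ultimately have "?v' = v" using cover_type(2)[OF m _ v(1)] by blast
    moreover have "distinct (subcones m (cone_type y))" using cover_type(3)[OF m] by (simp add: subcones_def)
    ultimately have "n - 1 = k" using k n' by (simp add: nth_eq_iff_index_eq[symmetric])
    then show "n = Suc k" using n by auto
  qed
qed

definition index :: "'a list set \<Rightarrow> 'a list \<Rightarrow> nat" where
  "index m y = (THE n. n \<in> {1..num_subcones m (cone_type y)} \<and> y \<in> boundary (labelled_root m (cone_type y) n))"

definition labelled :: "'a list set \<Rightarrow> 'a list \<Rightarrow> 'a cone_label \<times> 'a list" where
  "labelled m y = ((cone_type y, m, index m y), y)"

lemma initial_types_subset: "initial_types \<subseteq> cone_types"
  using initial_words_length cone_type_in by (auto simp: initial_types_def)

lemma finite_initial_types: "finite initial_types"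
  by (rule finite_subset[of _ "cone_type ` initial_words"]) (auto simp: initial_types_def)

text \<open>A label carries no information beyond the word and the type of its predecessor: the
  first component is the type of the word and the index is forced by disjointness.\<close>

lemma hidden_states_eq: "hidden_states = {labelled m y | m y. m \<in> initial_types \<and> y \<in> entry_set m}"
proof (intro equalityI subsetI)
  fix z assume "z \<in> hidden_states"
  then obtain j m n x w0 where z: "z = ((j, m, n), x)" and x: "x \<in> W_values" "cone_type (suffix2 x) = j"
    "n \<in> {1..num_subcones m j}" and w0: "\<P>(\<omega> in P []. W 0 \<omega> = w0 \<and> W 1 \<omega> = x) > 0"
    "cone_type (suffix2 w0) = m" "x \<in> boundary (subcone_root (suffix2 w0) j n)"
    unfolding hidden_states_def by blast
  have B: "w0 \<in> initial_words" using w0(1) by (rule prob_W_0_initial_words)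
  have l: "length w0 \<ge> 2" using initial_words_length[OF B] .
  have pos: "\<P>(\<omega> in P []. W 0 \<omega> = w0) > 0" "x \<in> \<S> (suffix2 w0)" using w0(1) prob_W_0_1[OF l] by auto
  have j: "j = cone_type x" using x(2) cone_type_suffix2 W_values_length[OF x(1)] by simp
  have m: "cone_type w0 = m" using w0(2) cone_type_suffix2[OF l] by simp
  have mi: "m \<in> initial_types" using B pos m by (auto simp: initial_types_def)
  have xe: "x \<in> entry_set m" using pos(2) \<S>_entry_set[OF l] m by simp
  have "x \<in> boundary (labelled_root m j n)"
    using w0(2,3) stem_Nil[OF length_suffix2[OF l]] by (simp add: subcone_root_def labelled_root_def)
  then have "index m x = n"
    unfolding index_def using x(3) j entry_set_root[OF _ xe] mi initial_types_subset
    by (intro the1_equality) auto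
  then show "z \<in> {labelled m y | m y. m \<in> initial_types \<and> y \<in> entry_set m}"
    using z j mi xe by (auto simp: labelled_def)
next
  fix z assume "z \<in> {labelled m y | m y. m \<in> initial_types \<and> y \<in> entry_set m}"
  then obtain m y where z: "z = labelled m y" "m \<in> initial_types" "y \<in> entry_set m" by blast
  obtain w0 where w0: "w0 \<in> initial_words" "\<P>(\<omega> in P []. W 0 \<omega> = w0) > 0" "cone_type w0 = m"
    using z(2) by (auto simp: initial_types_def)
  have l: "length w0 \<ge> 2" using initial_words_length[OF w0(1)] .
  have yS: "y \<in> \<S> (suffix2 w0)" using z(3) \<S>_entry_set[OF l] w0(3) by simp
  have yW: "y \<in> W_values" using w0 yS by (auto simp: W_values_iff)
  have ty: "cone_type (suffix2 y) = cone_type y" using cone_type_suffix2 W_values_length[OF yW] by simp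
  have tw: "cone_type (suffix2 w0) = m" using cone_type_suffix2[OF l] w0(3) by simp
  have ix: "index m y \<in> {1..num_subcones m (cone_type y)} \<and> y \<in> boundary (labelled_root m (cone_type y) (index m y))"
    unfolding index_def using z initial_types_subset by (intro theI'[OF entry_set_root]) auto
  have "\<P>(\<omega> in P []. W 0 \<omega> = w0 \<and> W 1 \<omega> = y) > 0" using prob_W_0_1[OF l] w0(2) yS by blast
  moreover have "y \<in> boundary (subcone_root (suffix2 w0) (cone_type y) (index m y))"
    using ix tw stem_Nil[OF length_suffix2[OF l]] by (simp add: subcone_root_def labelled_root_def)
  ultimately show "z \<in> hidden_states"
    unfolding hidden_states_def z(1) labelled_def using yW ty ix tw initial_words_language[OF w0(1)] by blast
qed

lemma entry_set_length: "m \<in> cone_types \<Longrightarrow> y \<in> entry_set m \<Longrightarrow> length y \<ge> 3"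
  using cover_type(1) by (auto simp: entry_set_def dest!: boundary_cone(3))

lemma hidden_state_facts:
  assumes "z \<in> hidden_states"
  obtains m where "m \<in> initial_types" "snd z \<in> entry_set m" "z = labelled m (snd z)" "length (snd z) \<ge> 3" "snd z \<in> W_values"
proof -
  obtain m y where "m \<in> initial_types" "y \<in> entry_set m" "z = labelled m y" using assms hidden_states_eq by blast
  moreover have "snd z \<in> W_values" using assms by (auto simp: hidden_states_def)
  ultimately show ?thesis using that initial_types_subset entry_set_length by (auto simp: labelled_def)
qed

lemma finite_hidden_states: "finite hidden_states"
proof -
  have "hidden_states \<subseteq> (\<lambda>(m, y). labelled m y) ` (initial_types \<times> W_values)"
  proof
    fix z assume "z \<in> hidden_states"
    then obtain m where "m \<in> initial_types" "z = labelled m (snd z)" "snd z \<in> W_values"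
      by (rule hidden_state_facts)
    then show "z \<in> (\<lambda>(m, y). labelled m y) ` (initial_types \<times> W_values)"
      by (intro image_eqI[of _ _ "(m, snd z)"]) auto
  qed
  then show ?thesis using finite_initial_types finite_W_values by (auto intro: finite_subset)
qed

lemma trans_labelled:
  "hidden_trans (labelled m x) (labelled m' y) = (if m' = cone_type x then q x y else 0)"
  by (simp add: labelled_def)

lemma trans_nonneg: "z \<in> hidden_states \<Longrightarrow> z' \<in> hidden_states \<Longrightarrow> hidden_trans z z' \<ge> 0"
proof -
  assume "z \<in> hidden_states" "z' \<in> hidden_states"
  then obtain m m' where m: "z = labelled m (snd z)" "z' = labelled m' (snd z')" "length (snd z) \<ge> 3"
    by (metis hidden_state_facts)
  have "hidden_trans (labelled m (snd z)) (labelled m' (snd z')) \<ge> 0"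
    using q_nonneg[of "snd z"] m(3) by (simp add: trans_labelled)
  then show ?thesis using m(1,2) by simp
qed

section \<open>The support of the invariant measure\<close>

definition support_words :: "'a list set" where "support_words = snd ` set_pmf \<nu>"

definition V :: "nat \<Rightarrow> 'n \<Rightarrow> 'a list" where "V i \<omega> = snd (Z (Suc i) \<omega>)"

lemma set_\<nu>: "set_pmf \<nu> \<subseteq> hidden_states"
  using hidden_invariant by (simp add: hidden_invariant_def)

lemma \<nu>_invariant: "z \<in> hidden_states \<Longrightarrow> pmf \<nu> z = (\<Sum>z'\<in>hidden_states. pmf \<nu> z' * hidden_trans z' z)"
  using hidden_invariant by (simp add: hidden_invariant_def)

lemma set_\<nu>_closed:
  assumes z: "z \<in> set_pmf \<nu>" and z': "z' \<in> hidden_states" and pos: "hidden_trans z z' > 0"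
  shows "z' \<in> set_pmf \<nu>"
proof -
  have "0 < pmf \<nu> z * hidden_trans z z'" using pos z by (simp add: pmf_positive)
  also have "\<dots> \<le> (\<Sum>z''\<in>hidden_states. pmf \<nu> z'' * hidden_trans z'' z')"
    using z set_\<nu> trans_nonneg[OF _ z'] finite_hidden_states
    by (intro member_le_sum[where f = "\<lambda>z''. pmf \<nu> z'' * hidden_trans z'' z'"]) auto
  also have "\<dots> = pmf \<nu> z'" using \<nu>_invariant[OF z'] by simp
  finally show ?thesis by (simp add: set_pmf_iff)
qed

lemma Z_meas: "Z (Suc n) \<in> N \<rightarrow>\<^sub>M count_space hidden_states"
  using hidden_chain by (simp add: markov_chain_def)

lemma Z_in: "\<omega> \<in> space N \<Longrightarrow> Z (Suc n) \<omega> \<in> hidden_states"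
  using measurable_space[OF Z_meas] by simp

lemma Z_meas_UNIV[measurable]: "Z (Suc n) \<in> N \<rightarrow>\<^sub>M count_space UNIV"
  using measurable_comp[OF Z_meas, of id "count_space UNIV"] by (simp add: comp_def)

lemma Z_cylinder: "(\<And>i. i \<le> n \<Longrightarrow> x i \<in> hidden_states) \<Longrightarrow>
   \<P>(\<omega> in N. \<forall>i\<le>n. Z (Suc i) \<omega> = x i) = pmf \<nu> (x 0) * (\<Prod>i<n. hidden_trans (x i) (x (Suc i)))"
  using hidden_chain by (simp add: markov_chain_def)

definition good_run :: "'n \<Rightarrow> bool" where
  "good_run \<omega> \<longleftrightarrow> (\<forall>n. Z (Suc n) \<omega> \<in> hidden_states) \<and> pmf \<nu> (Z 1 \<omega>) > 0 \<and>
     (\<forall>n. hidden_trans (Z (Suc n) \<omega>) (Z (Suc (Suc n)) \<omega>) > 0)"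

text \<open>For each length there are finitely many cylinders of hidden states, and those whose
  product vanishes are null. Hence almost every run has only positive factors.\<close>

lemma AE_good_run: "AE \<omega> in N. good_run \<omega>"
proof -
  define c where "c n x = pmf \<nu> (x 0) * (\<Prod>i<n. hidden_trans (x i) (x (Suc i)))"
    for n and x :: "nat \<Rightarrow> 'a cone_label \<times> 'a list"
  have "AE \<omega> in N. c n (\<lambda>i. Z (Suc i) \<omega>) \<noteq> 0" for n
  proof -
    have "AE \<omega> in N. \<forall>x\<in>PiE {..n} (\<lambda>_. hidden_states). c n x = 0 \<longrightarrow> \<not> (\<forall>i\<le>n. Z (Suc i) \<omega> = x i)"
    proof (rule AE_finite_allI)
      show "finite (PiE {..n} (\<lambda>_. hidden_states))" using finite_hidden_states by (intro finite_PiE) auto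
      fix x assume x: "x \<in> PiE {..n} (\<lambda>_. hidden_states)"
      show "AE \<omega> in N. c n x = 0 \<longrightarrow> \<not> (\<forall>i\<le>n. Z (Suc i) \<omega> = x i)"
      proof (cases "c n x = 0")
        case True
        then have "\<P>(\<omega> in N. \<forall>i\<le>n. Z (Suc i) \<omega> = x i) = 0"
          using Z_cylinder[of n x] x by (auto simp: c_def PiE_def Pi_def)
        then have "AE \<omega> in N. \<not> (\<forall>i\<le>n. Z (Suc i) \<omega> = x i)" by (subst (asm) N.prob_eq_0) auto
        then show ?thesis by eventually_elim simp
      qed simp
    qed
    then show ?thesis
      using AE_space
    proof eventually_elim
      case (elim \<omega>)
      define x where "x = restrict (\<lambda>i. Z (Suc i) \<omega>) {..n}"
      have "x \<in> PiE {..n} (\<lambda>_. hidden_states)" using Z_in[OF elim(2)] by (auto simp: x_def)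
      moreover have "\<forall>i\<le>n. Z (Suc i) \<omega> = x i" by (simp add: x_def)
      moreover have "c n x = c n (\<lambda>i. Z (Suc i) \<omega>)" by (simp add: c_def x_def)
      ultimately show ?case using elim(1) by metis
    qed
  qed
  then have "AE \<omega> in N. \<forall>n. c n (\<lambda>i. Z (Suc i) \<omega>) \<noteq> 0" by (simp add: AE_all_countable)
  then show ?thesis
    using AE_space
  proof eventually_elim
    case (elim \<omega>)
    have "pmf \<nu> (Z 1 \<omega>) \<noteq> 0" using elim(1)[rule_format, of 0] by (simp add: c_def)
    then have "pmf \<nu> (Z 1 \<omega>) > 0" using pmf_nonneg[of \<nu> "Z 1 \<omega>"] by linarith
    moreover have "hidden_trans (Z (Suc n) \<omega>) (Z (Suc (Suc n)) \<omega>) > 0" for n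
    proof -
      have "hidden_trans (Z (Suc n) \<omega>) (Z (Suc (Suc n)) \<omega>) \<noteq> 0"
        using elim(1)[rule_format, of "Suc n"] by (simp add: c_def)
      then show ?thesis using trans_nonneg[OF Z_in[OF elim(2)] Z_in[OF elim(2)], of n "Suc n"] by linarith
    qed
    ultimately show ?case using Z_in[OF elim(2)] by (simp add: good_run_def)
  qed
qed

text \<open>
  Only types of possible values of \<open>W 0\<close> occur as first index of a label.  A state in the support of
  the invariant measure has a successor, so its own type is of this kind and all its potential
  successors are hidden states.
\<close>

lemma support_type: assumes z: "z \<in> set_pmf \<nu>" shows "cone_type (snd z) \<in> initial_types"
proof -
  have "\<P>(\<omega> in N. Z 1 \<omega> = z) = pmf \<nu> z" using Z_cylinder[of 0 "\<lambda>_. z"] z set_\<nu> by auto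
  then have "\<P>(\<omega> in N. Z 1 \<omega> = z) > 0" using z by (simp add: pmf_positive)
  from N.prob_pos_witness[OF this AE_good_run]
  obtain \<omega> where w: "Z 1 \<omega> = z" "good_run \<omega>" by blast
  then have t: "hidden_trans z (Z 2 \<omega>) > 0" "Z 2 \<omega> \<in> hidden_states"
  proof -
    have "hidden_trans (Z (Suc 0) \<omega>) (Z (Suc (Suc 0)) \<omega>) > 0" "Z (Suc (Suc 0)) \<omega> \<in> hidden_states"
      using w(2) unfolding good_run_def by blast+
    then show "hidden_trans z (Z 2 \<omega>) > 0" "Z 2 \<omega> \<in> hidden_states"
      using w(1) by (simp_all add: numeral_2_eq_2)
  qed
  obtain m where m: "z = labelled m (snd z)" using z set_\<nu> hidden_state_facts by blast
  obtain m' where m': "m' \<in> initial_types" "Z 2 \<omega> = labelled m' (snd (Z 2 \<omega>))"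
    using hidden_state_facts[OF t(2)] by blast
  have "hidden_trans (labelled m (snd z)) (labelled m' (snd (Z 2 \<omega>))) > 0" using t(1) m m' by metis
  then have "m' = cone_type (snd z)" by (simp add: trans_labelled split: if_splits)
  then show ?thesis using m' by simp
qed

lemma support_words_facts:
  assumes "x \<in> support_words" shows "x \<in> W_values" "length x \<ge> 3" "cone_type x \<in> initial_types" "x \<in> boundary x"
  using assms set_\<nu> support_type W_values_boundary by (auto simp: support_words_def elim!: hidden_state_facts)

lemma support_words_successor:
  assumes z: "z \<in> set_pmf \<nu>" and y: "y \<in> \<S> (suffix2 (snd z))"
  shows "labelled (cone_type (snd z)) y \<in> set_pmf \<nu>" "hidden_trans z (labelled (cone_type (snd z)) y) = q (snd z) y"
proof -
  have x: "snd z \<in> support_words" using z by (simp add: support_words_def)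
  have l: "length (snd z) \<ge> 2" using support_words_facts(2)[OF x] by simp
  obtain m where m: "z = labelled m (snd z)" using z set_\<nu> hidden_state_facts by blast
  show t: "hidden_trans z (labelled (cone_type (snd z)) y) = q (snd z) y"
    by (subst m) (simp add: trans_labelled)
  have "labelled (cone_type (snd z)) y \<in> hidden_states"
    using support_words_facts(3)[OF x] y \<S>_entry_set[OF l] by (auto simp: hidden_states_eq)
  then show "labelled (cone_type (snd z)) y \<in> set_pmf \<nu>"
    using q_pos_iff[OF l] y t by (intro set_\<nu>_closed[OF z]) auto
qed

lemma support_words_closed: assumes "x \<in> support_words" "y \<in> \<S> (suffix2 x)" shows "y \<in> support_words"
  using support_words_successor(1)[of _ y] assms by (force simp: support_words_def labelled_def)

text \<open>Every state after the first is determined by two consecutive words. Only the first label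
  remains free.\<close>

lemma good_run_facts:
  assumes good: "good_run \<omega>"
  shows "Z (Suc n) \<omega> \<in> set_pmf \<nu>" "V n \<omega> \<in> support_words" "V (Suc n) \<omega> \<in> \<S> (suffix2 (V n \<omega>))"
    "Z (Suc (Suc n)) \<omega> = labelled (cone_type (V n \<omega>)) (V (Suc n) \<omega>)"
proof -
  show Z: "Z (Suc n) \<omega> \<in> set_pmf \<nu>" for n
  proof (induction n)
    case 0
    then show ?case using good by (simp add: good_run_def set_pmf_iff)
  next
    case (Suc n)
    then show ?case using good set_\<nu>_closed by (auto simp: good_run_def)
  qed
  then show support_words: "V n \<omega> \<in> support_words" for n by (auto simp: V_def support_words_def)
  have zs: "Z (Suc n) \<omega> \<in> hidden_states" "Z (Suc (Suc n)) \<omega> \<in> hidden_states" using Z set_\<nu> by blast+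
  obtain m where m: "Z (Suc n) \<omega> = labelled m (V n \<omega>)" using hidden_state_facts[OF zs(1)] unfolding V_def by blast
  obtain m' where m': "Z (Suc (Suc n)) \<omega> = labelled m' (V (Suc n) \<omega>)" using hidden_state_facts[OF zs(2)] unfolding V_def by blast
  have "hidden_trans (Z (Suc n) \<omega>) (Z (Suc (Suc n)) \<omega>) > 0" using good by (simp add: good_run_def)
  then have "m' = cone_type (V n \<omega>)" "q (V n \<omega>) (V (Suc n) \<omega>) > 0"
    unfolding m m' trans_labelled by (auto split: if_splits)
  then show "V (Suc n) \<omega> \<in> \<S> (suffix2 (V n \<omega>))" "Z (Suc (Suc n)) \<omega> = labelled (cone_type (V n \<omega>)) (V (Suc n) \<omega>)"
    using m' q_pos_iff[of "V n \<omega>"] support_words_facts(2)[OF support_words[of n]] by auto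
qed

section \<open>The chain of words\<close>

text \<open>Cutting \<open>q\<close> off on words without suffix makes it nonnegative everywhere.\<close>

definition q_long :: "'a list \<Rightarrow> 'a list \<Rightarrow> real" where
  "q_long x y = (if length x \<ge> 2 then q x y else 0)"

definition \<mu> :: "'a list \<Rightarrow> real" where
  "\<mu> x = (\<Sum>z\<in>{z \<in> hidden_states. snd z = x}. pmf \<nu> z)"

definition A :: "'a list set" where "A = {x \<in> support_words. cone_type x = cone_type [a, b]}"

lemma \<mu>_support: "\<mu> x = (\<Sum>z\<in>{z \<in> set_pmf \<nu>. snd z = x}. pmf \<nu> z)"
  unfolding \<mu>_def using set_\<nu> finite_hidden_states
  by (intro sum.mono_neutral_right) (auto simp: set_pmf_iff)

lemma finite_set_\<nu>[simp]: "finite (set_pmf \<nu>)" using finite_subset[OF set_\<nu> finite_hidden_states] .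

lemma finite_support_words: "finite support_words" by (simp add: support_words_def)

lemma q_long_eq: "x \<in> support_words \<Longrightarrow> q_long x y = q x y"
  using support_words_facts(2)[of x] by (simp add: q_long_def)

lemma V_meas[measurable]: "V n \<in> N \<rightarrow>\<^sub>M count_space UNIV"
proof -
  have "(\<lambda>\<omega>. snd (Z (Suc n) \<omega>)) \<in> N \<rightarrow>\<^sub>M count_space UNIV"
    by (rule measurable_compose[OF Z_meas_UNIV]) simp
  then show ?thesis by (simp add: V_def[abs_def])
qed

text \<open>A possible path of words lifts to one labelled path for each choice of the first label,
  and all lifts have the same transition product. Summing over the first label turns \<nu> into
  \<mu>; an impossible path makes both sides 0.\<close>

lemma V_cylinder:
  assumes x: "\<forall>i\<le>n. x i \<in> support_words"
  shows "\<P>(\<omega> in N. \<forall>i\<le>n. V i \<omega> = x i) = \<mu> (x 0) * (\<Prod>i<n. q_long (x i) (x (Suc i)))"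
proof (cases "\<forall>i<n. x (Suc i) \<in> \<S> (suffix2 (x i))")
  case False
  then obtain i where i: "i < n" "x (Suc i) \<notin> \<S> (suffix2 (x i))" by blast
  have "AE \<omega> in N. \<not> (\<forall>i\<le>n. V i \<omega> = x i)"
    using AE_good_run
  proof eventually_elim
    case (elim \<omega>)
    then show ?case using good_run_facts(3)[OF elim, of i] i by (metis Suc_leI less_imp_le)
  qed
  then have "\<P>(\<omega> in N. \<forall>i\<le>n. V i \<omega> = x i) = 0" by (subst N.prob_eq_0) auto
  moreover have "q_long (x i) (x (Suc i)) = 0" using i by (simp add: q_long_def q_def)
  then have "(\<Prod>i<n. q_long (x i) (x (Suc i))) = 0" using i(1) by (intro prod_zero) auto
  ultimately show ?thesis by simp
next
  case True
  let ?U = "{z \<in> set_pmf \<nu>. snd z = x 0}"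
  \<comment> \<open>The lift of \<open>x\<close> with first state \<open>z\<close>: later labels are
    copied from the type of the preceding word.\<close>
  define f where "f z i = (case i of 0 \<Rightarrow> z | Suc j \<Rightarrow> labelled (cone_type (x j)) (x (Suc j)))" for z i
  have snd_f: "snd (f z i) = x i" if "z \<in> ?U" for z i
    using that by (cases i) (auto simp: f_def labelled_def)
  have f_Suc: "f z (Suc i) = labelled (cone_type (snd (f z i))) (x (Suc i))" if "z \<in> ?U" for z i
    using snd_f[OF that, of i] by (simp add: f_def)
  have f_in: "i \<le> n \<Longrightarrow> f z i \<in> set_pmf \<nu>" if z: "z \<in> ?U" for z i
  proof (induction i)
    case 0
    then show ?case using z by (simp add: f_def)
  next
    case (Suc i)
    then show ?case unfolding f_Suc[OF z] using True snd_f[OF z, of i] by (intro support_words_successor(1)) auto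
  qed
  have f_trans: "hidden_trans (f z i) (f z (Suc i)) = q_long (x i) (x (Suc i))" if z: "z \<in> ?U" and i: "i < n" for z i
    unfolding f_Suc[OF z] using support_words_successor(2)[of "f z i" "x (Suc i)"] f_in[OF z, of i] snd_f[OF z, of i] True i x
    by (simp add: q_long_eq)
  have ev: "good_run \<omega> \<Longrightarrow> (\<forall>i\<le>n. V i \<omega> = x i) \<longleftrightarrow> (\<exists>z\<in>?U. \<forall>i\<le>n. Z (Suc i) \<omega> = f z i)" for \<omega>
  proof
    assume good: "good_run \<omega>" and V: "\<forall>i\<le>n. V i \<omega> = x i"
    have z: "Z (Suc 0) \<omega> \<in> ?U" using good_run_facts(1)[OF good, of 0] V by (auto simp: V_def)
    have "Z (Suc i) \<omega> = f (Z (Suc 0) \<omega>) i" if "i \<le> n" for i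
      using that good_run_facts(4)[OF good] V by (cases i) (auto simp: f_def)
    then show "\<exists>z\<in>?U. \<forall>i\<le>n. Z (Suc i) \<omega> = f z i" using z by blast
  next
    assume "\<exists>z\<in>?U. \<forall>i\<le>n. Z (Suc i) \<omega> = f z i"
    then show "\<forall>i\<le>n. V i \<omega> = x i" using snd_f by (auto simp: V_def)
  qed
  have "\<P>(\<omega> in N. \<forall>i\<le>n. V i \<omega> = x i) = N.prob (\<Union>z\<in>?U. {\<omega> \<in> space N. \<forall>i\<le>n. Z (Suc i) \<omega> = f z i})"
    by (intro N.finite_measure_eq_AE) (use AE_good_run ev in \<open>auto elim!: eventually_mono\<close>)
  also have "\<dots> = (\<Sum>z\<in>?U. \<P>(\<omega> in N. \<forall>i\<le>n. Z (Suc i) \<omega> = f z i))"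
  proof (intro N.finite_measure_finite_Union)
    have "z = z'" if "Z (Suc 0) \<omega> = f z 0" "Z (Suc 0) \<omega> = f z' 0" for z z' \<omega>
      using that by (simp add: f_def)
    then show "disjoint_family_on (\<lambda>z. {\<omega> \<in> space N. \<forall>i\<le>n. Z (Suc i) \<omega> = f z i}) ?U"
      unfolding disjoint_family_on_def by blast
  qed auto
  also have "\<dots> = (\<Sum>z\<in>?U. pmf \<nu> z * (\<Prod>i<n. q_long (x i) (x (Suc i))))"
  proof (intro sum.cong refl)
    fix z assume z: "z \<in> ?U"
    have "\<P>(\<omega> in N. \<forall>i\<le>n. Z (Suc i) \<omega> = f z i) = pmf \<nu> (f z 0) * (\<Prod>i<n. hidden_trans (f z i) (f z (Suc i)))"
      using f_in[OF z] set_\<nu> by (intro Z_cylinder) auto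
    also have "(\<Prod>i<n. hidden_trans (f z i) (f z (Suc i))) = (\<Prod>i<n. q_long (x i) (x (Suc i)))"
      by (intro prod.cong refl) (simp add: f_trans[OF z])
    finally show "\<P>(\<omega> in N. \<forall>i\<le>n. Z (Suc i) \<omega> = f z i) = pmf \<nu> z * (\<Prod>i<n. q_long (x i) (x (Suc i)))"
      by (simp add: f_def)
  qed
  finally show ?thesis by (simp add: \<mu>_support sum_distrib_right)
qed

lemma \<mu>_pos: assumes "x \<in> support_words" shows "\<mu> x > 0"
proof -
  obtain z where "z \<in> set_pmf \<nu>" "snd z = x" using assms by (auto simp: support_words_def)
  then show ?thesis unfolding \<mu>_support by (intro sum_pos2[of _ z]) (auto simp: pmf_positive)
qed

lemma sum_\<mu>: "(\<Sum>x\<in>support_words. \<mu> x * g x) = (\<Sum>z\<in>set_pmf \<nu>. pmf \<nu> z * g (snd z))"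
proof -
  have "(\<Sum>z\<in>set_pmf \<nu>. pmf \<nu> z * g (snd z)) = (\<Sum>x\<in>support_words. \<Sum>z\<in>{z \<in> set_pmf \<nu>. snd z = x}. pmf \<nu> z * g (snd z))"
    unfolding support_words_def by (rule sum.image_gen) simp
  also have "\<dots> = (\<Sum>x\<in>support_words. \<mu> x * g x)"
    unfolding \<mu>_support sum_distrib_right by (intro sum.cong refl) auto
  finally show ?thesis by simp
qed

text \<open>Of all labels on the word \<open>y\<close>, only the one with the type of the current
  word as middle component can be entered. This is the lumpability by which invariance passes from
  \<nu> to \<mu>.\<close>

lemma sum_hidden_trans:
  assumes z: "z \<in> set_pmf \<nu>"
  shows "(\<Sum>z'\<in>{z' \<in> hidden_states. snd z' = y}. hidden_trans z z') = q (snd z) y"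
proof -
  let ?n = "labelled (cone_type (snd z)) y"
  have l: "length (snd z) \<ge> 2" using support_words_facts(2)[of "snd z"] z by (simp add: support_words_def)
  have zero: "hidden_trans z z' = 0" if z': "z' \<in> hidden_states" "snd z' = y" "z' \<noteq> ?n" for z'
  proof -
    obtain m where m: "z = labelled m (snd z)" using z set_\<nu> hidden_state_facts by blast
    obtain m' where m': "z' = labelled m' y" using hidden_state_facts[OF z'(1)] z'(2) by metis
    have "hidden_trans (labelled m (snd z)) (labelled m' y) = 0"
      using z'(3) m' by (auto simp: trans_labelled)
    then show ?thesis using m m' by simp
  qed
  show ?thesis
  proof (cases "y \<in> \<S> (suffix2 (snd z))")
    case True
    have "?n \<in> {z' \<in> hidden_states. snd z' = y}"
      using support_words_successor(1)[OF z True] set_\<nu> by (auto simp: labelled_def)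
    then have "(\<Sum>z'\<in>{z' \<in> hidden_states. snd z' = y}. hidden_trans z z') = (\<Sum>z'\<in>{?n}. hidden_trans z z')"
      using finite_hidden_states zero by (intro sum.mono_neutral_right) auto
    then show ?thesis using support_words_successor(2)[OF z True] by simp
  next
    case False
    have "hidden_trans z z' = 0" if z': "z' \<in> hidden_states" "snd z' = y" for z'
    proof (rule ccontr)
      assume "hidden_trans z z' \<noteq> 0"
      then have "hidden_trans z z' > 0" using trans_nonneg[of z z'] z set_\<nu> z'(1) by force
      moreover have "z' = ?n" using zero[OF z'] \<open>hidden_trans z z' \<noteq> 0\<close> by blast
      moreover obtain m where "z = labelled m (snd z)" using z set_\<nu> hidden_state_facts by blast
      ultimately have "hidden_trans (labelled m (snd z)) ?n > 0" by metis
      then show False using False q_pos_iff[OF l] by (simp add: trans_labelled)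
    qed
    then show ?thesis using False by (simp add: q_def)
  qed
qed

lemma \<mu>_invariant: "(\<Sum>x\<in>support_words. \<mu> x * q_long x y) = \<mu> y"
proof -
  have "\<mu> y = (\<Sum>z'\<in>{z' \<in> hidden_states. snd z' = y}. \<Sum>z\<in>hidden_states. pmf \<nu> z * hidden_trans z z')"
    unfolding \<mu>_def by (intro sum.cong refl \<nu>_invariant) auto
  also have "\<dots> = (\<Sum>z\<in>hidden_states. pmf \<nu> z * (\<Sum>z'\<in>{z' \<in> hidden_states. snd z' = y}. hidden_trans z z'))"
    by (subst sum.swap) (simp add: sum_distrib_left)
  also have "\<dots> = (\<Sum>z\<in>set_pmf \<nu>. pmf \<nu> z * (\<Sum>z'\<in>{z' \<in> hidden_states. snd z' = y}. hidden_trans z z'))"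
    using finite_hidden_states set_\<nu> by (intro sum.mono_neutral_right) (auto simp: set_pmf_iff)
  also have "\<dots> = (\<Sum>z\<in>set_pmf \<nu>. pmf \<nu> z * q_long (snd z) y)"
    using sum_hidden_trans by (intro sum.cong refl) (simp add: q_long_eq support_words_def)
  finally show ?thesis using sum_\<mu>[of "\<lambda>x. q_long x y"] by simp
qed

text \<open>As \<open>x\<close> is on the boundary of its own cone, its last two letters are on the
  boundary of \<open>cone (suffix2 x)\<close>. If that cone is \<open>cone [a, b]\<close>, its
  boundary has only one element.\<close>

lemma unambiguous_type:
  assumes x: "length x \<ge> 2" "x \<in> boundary x"
  shows "cone_type x = cone_type [a, b] \<longleftrightarrow> suffix2 x = [a, b]"
proof
  assume "cone_type x = cone_type [a, b]"
  then have c: "cone (suffix2 x) = cone [a, b]" by (simp add: cone_type_def suffix2_id)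
  have l: "length (suffix2 x) = 2" using length_suffix2[OF x(1)] .
  have "boundary x = (@) (stem x) ` boundary (suffix2 x)"
    using boundary_append[of "suffix2 x" "stem x"] l by (simp add: stem_append_suffix2)
  then obtain u where u: "u \<in> boundary (suffix2 x)" "x = stem x @ u" using x(2) by blast
  have "u = suffix2 x" using u(2) stem_append_suffix2[of x] by (metis same_append_eq)
  moreover have "boundary (suffix2 x) = boundary [a, b]" unfolding boundary_def c using l by (simp add: numeral_2_eq_2)
  ultimately show "suffix2 x = [a, b]" using u(1) unambiguous by simp
qed (simp add: cone_type_def suffix2_id)

lemma A_iff: "x \<in> A \<longleftrightarrow> x \<in> support_words \<and> suffix2 x = [a, b]"
  using unambiguous_type[of x] support_words_facts(2,4)[of x] by (auto simp: A_def)

text \<open>Each step between types is realised by a boundary word of the corresponding subcone, and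
  the support is closed under such steps.\<close>

lemma support_words_reach:
  assumes x: "x \<in> support_words"
  shows "subtype\<^sup>+\<^sup>+ (cone_type x) j \<Longrightarrow> \<exists>y\<in>support_words. cone_type y = j \<and> (\<lambda>u v. u \<in> support_words \<and> v \<in> support_words \<and> q_long u v > 0)\<^sup>+\<^sup>+ x y"
proof (induction rule: tranclp_induct)
  have step: "\<exists>v\<in>support_words. cone_type v = j \<and> q_long u v > 0" if u: "u \<in> support_words" "subtype (cone_type u) j" for u j
  proof -
    have l: "length u \<ge> 2" using support_words_facts(2)[OF u(1)] by simp
    obtain v where "v \<in> \<S> (suffix2 u)" "cone_type v = j" using subtype_entry[OF l u(2)] by blast
    then show ?thesis using support_words_closed[OF u(1)] q_pos_iff[OF l] q_long_eq[OF u(1)] by auto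
  qed
  {
    case (base j)
    then show ?case using step[OF x] x by (blast intro: tranclp.r_into_trancl)
  next
    case (step j k)
    then show ?case
      using \<open>\<And>u j. u \<in> support_words \<Longrightarrow> subtype (cone_type u) j \<Longrightarrow> \<exists>v\<in>support_words. cone_type v = j \<and> q_long u v > 0\<close>
      by (blast intro: tranclp.trancl_into_trancl)
  }
qed

lemma V_in_support_words: "AE \<omega> in N. V n \<omega> \<in> support_words"
  using AE_good_run by eventually_elim (rule good_run_facts(2))

text \<open>The observation of a word is its cone. The state \<open>c\<close> is the pair
  \<open>[a, b]\<close>, which is too short to be a word of the chain but has the transition row of
  all words ending in it.\<close>

sublocale words: regenerative_chain N support_words A V \<mu> q_long cone cone_type "cone_type [a, b]" "[a, b]"
proof unfold_locales
  show "finite support_words" by (rule finite_support_words)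
  show "V n \<in> N \<rightarrow>\<^sub>M count_space UNIV" for n by (rule V_meas)
  show "AE \<omega> in N. V n \<omega> \<in> support_words" for n by (rule V_in_support_words)
  show "\<P>(\<omega> in N. \<forall>i\<le>n. V i \<omega> = x i) = \<mu> (x 0) * (\<Prod>i<n. q_long (x i) (x (Suc i)))" if "\<forall>i\<le>n. x i \<in> support_words" for n x
    using that by (rule V_cylinder)
  show "0 < \<mu> x" if "x \<in> support_words" for x using that by (rule \<mu>_pos)
  show "0 \<le> q_long x y" for x y using q_nonneg by (simp add: q_long_def)
  show "(\<Sum>x\<in>support_words. \<mu> x * q_long x y) = \<mu> y" for y by (rule \<mu>_invariant)
  show "A = {x \<in> support_words. cone_type x = cone_type [a, b]}" by (rule A_def)
  show "cone_type x = cone_type y" if "x \<in> support_words" "y \<in> support_words" "cone x = cone y" for x y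
    using cone_eq_imp(3)[OF that(3)] support_words_facts(2)[OF that(1)] by simp
  show "0 < q_long y z" if "x \<in> support_words" "y \<in> support_words" "z \<in> support_words" "cone_type x = cone_type y" "0 < q_long x z" for x y z
    using that q_pos_iff[of x z] q_pos_iff[of y z] \<S>_entry_set[of x] \<S>_entry_set[of y] support_words_facts(2)[of x] support_words_facts(2)[of y]
    by (simp add: q_long_eq)
  show "q_long x y = q_long [a, b] y" if "x \<in> A" "y \<in> support_words" for x y
    using that support_words_facts(2)[of x] q_suffix2[of x "[a, b]" y] by (simp add: A_iff q_long_def suffix2_id)
  show "\<exists>y\<in>A. (\<lambda>u v. u \<in> support_words \<and> v \<in> support_words \<and> 0 < q_long u v)\<^sup>+\<^sup>+ x y" if "x \<in> support_words" for x
    using support_words_reach[OF that subtype_reach[of x "[a, b]"]] support_words_facts(2)[OF that] by (auto simp: A_def)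
qed

section \<open>Observations as sequences of cones\<close>

lemma hidden_Y_eq:
  assumes good: "good_run \<omega>"
  shows "hidden_Y Z (Suc n) \<omega> = (cone_type (V n \<omega>), cone_type (V (Suc n) \<omega>), index (cone_type (V n \<omega>)) (V (Suc n) \<omega>))"
proof -
  have "Z (Suc n) \<omega> \<in> hidden_states" using good_run_facts(1)[OF good] set_\<nu> by blast
  then obtain m where "Z (Suc n) \<omega> = labelled m (V n \<omega>)" unfolding V_def using hidden_state_facts by blast
  then show ?thesis using good_run_facts(4)[OF good, of n] by (simp add: hidden_Y_def labelled_def)
qed

text \<open>The index names the subcone of the covering that has been entered, and a boundary word
  generates exactly that subcone.\<close>

lemma index_eq_iff:
  assumes m: "m \<in> cone_types" and y: "y \<in> entry_set m" and y': "y' \<in> entry_set m"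
    and t: "cone_type y = cone_type y'"
  shows "index m y = index m y' \<longleftrightarrow> cone y = cone y'"
proof
  have i: "y \<in> boundary (labelled_root m (cone_type y) (index m y))" "y' \<in> boundary (labelled_root m (cone_type y') (index m y'))"
    using theI'[OF entry_set_root[OF m y]] theI'[OF entry_set_root[OF m y']] by (auto simp: index_def)
  assume "index m y = index m y'"
  then show "cone y = cone y'" using i t boundary_cone(1) by metis
next
  assume c: "cone y = cone y'"
  have "length y \<ge> 2" using entry_set_length[OF m y] by simp
  then have l: "length y = length y'" using cone_eq_imp(1)[OF c] by simp
  have b: "boundary y = boundary y'" unfolding boundary_def c l ..
  have "y \<in> boundary v \<longleftrightarrow> y' \<in> boundary v" for v
  proof -
    obtain r r' where "y \<in> boundary r" "y' \<in> boundary r'" using y y' by (auto simp: entry_set_def)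
    then have "y \<in> boundary y" "y' \<in> boundary y'" using boundary_cone(2) by blast+
    then show ?thesis using b boundary_cone(2) by blast
  qed
  then show "index m y = index m y'" unfolding index_def t by simp
qed

text \<open>Given the preceding type, type and index of a word amount to its cone. The first word is
  seen only through its type, as the first component of the first observation, hence
  \<open>k > 0\<close>.\<close>

lemma observation_iff:
  assumes good: "good_run \<omega>" "good_run \<omega>'" and k: "k > 0"
  shows "(\<forall>l\<in>{1..k}. hidden_Y Z l \<omega>' = hidden_Y Z l \<omega>) \<longleftrightarrow>
    cone_type (V 0 \<omega>') = cone_type (V 0 \<omega>) \<and> (\<forall>i<k. cone (V (Suc i) \<omega>') = cone (V (Suc i) \<omega>))"
proof -
  have e: "V (Suc i) \<omega> \<in> entry_set (cone_type (V i \<omega>))" "cone_type (V i \<omega>) \<in> cone_types" "length (V i \<omega>) \<ge> 3"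
    if "good_run \<omega>" for \<omega> i
    using good_run_facts(2,3)[OF that, of i] support_words_facts(2)[of "V i \<omega>"] \<S>_entry_set[of "V i \<omega>"] cone_type_in[of "V i \<omega>"] by auto
  have "(\<forall>l\<in>{1..k}. hidden_Y Z l \<omega>' = hidden_Y Z l \<omega>) \<longleftrightarrow> (\<forall>i<k. hidden_Y Z (Suc i) \<omega>' = hidden_Y Z (Suc i) \<omega>)"
    by (auto simp: Ball_def) (metis Suc_le_D Suc_le_eq One_nat_def)
  also have "\<dots> \<longleftrightarrow> cone_type (V 0 \<omega>') = cone_type (V 0 \<omega>) \<and> (\<forall>i<k. cone (V (Suc i) \<omega>') = cone (V (Suc i) \<omega>))"
    (is "?L \<longleftrightarrow> ?R")
  proof
    assume L: ?L
    have "cone (V (Suc i) \<omega>') = cone (V (Suc i) \<omega>)" if "i < k" for i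
    proof -
      have t: "cone_type (V i \<omega>') = cone_type (V i \<omega>)" "cone_type (V (Suc i) \<omega>') = cone_type (V (Suc i) \<omega>)"
        and ix: "index (cone_type (V i \<omega>')) (V (Suc i) \<omega>') = index (cone_type (V i \<omega>)) (V (Suc i) \<omega>)"
        using L[rule_format, OF that] unfolding hidden_Y_eq[OF good(1)] hidden_Y_eq[OF good(2)] prod.inject by blast+
      show ?thesis
        using index_eq_iff[OF e(2)[OF good(1)] e(1)[OF good(2), of i, unfolded t(1)] e(1)[OF good(1)] t(2)]
          ix[unfolded t(1)] by blast
    qed
    moreover have "cone_type (V 0 \<omega>') = cone_type (V 0 \<omega>)" using L k by (auto simp: hidden_Y_eq good)
    ultimately show ?R by blast
  next
    assume R: ?R
    have t: "i \<le> k \<Longrightarrow> cone_type (V i \<omega>') = cone_type (V i \<omega>)" for i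
    proof (cases i)
      case (Suc j)
      assume "i \<le> k"
      then have "cone (V (Suc j) \<omega>') = cone (V (Suc j) \<omega>)" using R Suc by simp
      then have "cone_type (V (Suc j) \<omega>') = cone_type (V (Suc j) \<omega>)"
        by (rule cone_eq_imp(3)) (use e(3)[OF good(2), of "Suc j"] in simp)
      then show ?thesis using Suc by simp
    qed (use R in simp)
    show ?L
    proof (intro allI impI)
      fix i assume "i < k"
      then show "hidden_Y Z (Suc i) \<omega>' = hidden_Y Z (Suc i) \<omega>"
        using t[of i] t[of "Suc i"] R index_eq_iff[of "cone_type (V i \<omega>)" "V (Suc i) \<omega>'" "V (Suc i) \<omega>"]
        e[OF good(1), of i] e[OF good(2), of i] by (simp add: hidden_Y_eq good)
    qed
  qed
  finally show ?thesis .
qed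

lemma AE_entropy:
  "AE \<omega> in N. (\<lambda>k. - (1 / real k) * ln (\<P>(\<omega>' in N. \<forall>l\<in>{1..k}. hidden_Y Z l \<omega>' = hidden_Y Z l \<omega>)))
     \<longlonglongrightarrow> (\<Sum>x\<in>A. \<mu> x) * words.\<Psi> []"
  using words.observation_entropy AE_good_run AE_space
proof eventually_elim
  case (elim \<omega>)
  have "\<P>(\<omega>' in N. \<forall>l\<in>{1..k}. hidden_Y Z l \<omega>' = hidden_Y Z l \<omega>)
      = words.observation_prob (V 0 \<omega>) (map (\<lambda>i. V i \<omega>) [1..<Suc k])" if k: "k > 0" for k
  proof -
    let ?E = "\<lambda>\<omega>'. cone_type (V 0 \<omega>') = cone_type (V 0 \<omega>) \<and> (\<forall>i<k. cone (V (Suc i) \<omega>') = cone (V (Suc i) \<omega>))"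
    have nth: "map (\<lambda>i. V i \<omega>) [1..<Suc k] ! i = V (Suc i) \<omega>" if "i < k" for i
      using that by (simp del: upt_Suc)
    have [measurable]: "Measurable.pred N (\<lambda>\<omega>'. f (V i \<omega>') = y)" for f :: "'a list \<Rightarrow> 'a list set" and i y
      by (rule measurable_compose[OF V_meas]) simp
    have [measurable]: "Measurable.pred N (\<lambda>\<omega>'. hidden_Y Z (Suc i) \<omega>' = y)" for i y
    proof -
      have "hidden_Y Z (Suc i) \<omega>' = (\<lambda>z z'. (fst (fst z), fst (fst z'), snd (snd (fst z')))) (Z (Suc i) \<omega>') (Z (Suc (Suc i)) \<omega>')" for \<omega>'
        by (simp add: hidden_Y_def split: prod.split)
      then have "(hidden_Y Z (Suc i) \<omega>' = y) \<longleftrightarrow>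
         (\<exists>z\<in>hidden_states. \<exists>z'\<in>hidden_states. Z (Suc i) \<omega>' = z \<and> Z (Suc (Suc i)) \<omega>' = z' \<and>
            (fst (fst z), fst (fst z'), snd (snd (fst z'))) = y)" if "\<omega>' \<in> space N" for \<omega>'
        using Z_in[OF that] by auto
      then show ?thesis
        using finite_hidden_states by (subst measurable_cong) (assumption, measurable)
    qed
    have "(\<forall>l\<in>{1..k}. hidden_Y Z l \<omega>' = hidden_Y Z l \<omega>) \<longleftrightarrow> (\<forall>i<k. hidden_Y Z (Suc i) \<omega>' = hidden_Y Z (Suc i) \<omega>)" for \<omega>'
      by (auto simp: Ball_def) (metis Suc_le_D Suc_le_eq One_nat_def)
    then have "Measurable.pred N (\<lambda>\<omega>'. \<forall>l\<in>{1..k}. hidden_Y Z l \<omega>' = hidden_Y Z l \<omega>)" by simp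
    then have "\<P>(\<omega>' in N. \<forall>l\<in>{1..k}. hidden_Y Z l \<omega>' = hidden_Y Z l \<omega>) = \<P>(\<omega>' in N. ?E \<omega>')"
    proof (intro N.prob_eq_AE)
      show "AE \<omega>' in N. (\<forall>l\<in>{1..k}. hidden_Y Z l \<omega>' = hidden_Y Z l \<omega>) \<longleftrightarrow> ?E \<omega>'"
        using AE_good_run by eventually_elim (rule observation_iff[OF elim(2) _ k])
    qed auto
    also have "\<dots> = \<P>(\<omega>' in N. cone_type (V 0 \<omega>') = cone_type (V 0 \<omega>) \<and>
        (\<forall>i<k. cone (V (Suc i) \<omega>') = cone (map (\<lambda>i. V i \<omega>) [1..<Suc k] ! i)))"
      using nth by (intro arg_cong[where f = N.prob] Collect_cong conj_cong refl) simp
    also have "\<dots> = words.observation_prob (V 0 \<omega>) (map (\<lambda>i. V i \<omega>) [1..<Suc k])"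
      by (rule words.prob_observation) (simp del: upt_Suc)
    finally show ?thesis .
  qed
  then have "\<forall>\<^sub>F k in sequentially. - (1 / real k) * ln (words.observation_prob (V 0 \<omega>) (map (\<lambda>i. V i \<omega>) [1..<Suc k]))
      = - (1 / real k) * ln (\<P>(\<omega>' in N. \<forall>l\<in>{1..k}. hidden_Y Z l \<omega>' = hidden_Y Z l \<omega>))"
    by (intro eventually_mono[OF eventually_gt_at_top[of 0]]) (simp del: upt_Suc)
  with elim(1) show ?case by (rule Lim_transform_eventually)
qed

text \<open>The description in \<open>entropy_rate\<close> is unique because two almost sure limits
  agree on a set of probability 1, which is not empty.\<close>

lemma entropy_rate_eq: "entropy_rate N (hidden_Y Z) = (\<Sum>x\<in>A. \<mu> x) * words.\<Psi> []"
  unfolding entropy_rate_def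
proof (rule the_equality[where P = "\<lambda>h. AE \<omega> in N. _ \<omega> \<longlonglongrightarrow> h"])
  show "AE \<omega> in N. (\<lambda>k. - (1 / real k) * ln (\<P>(\<omega>' in N. \<forall>l\<in>{1..k}. hidden_Y Z l \<omega>' = hidden_Y Z l \<omega>)))
     \<longlonglongrightarrow> (\<Sum>x\<in>A. \<mu> x) * words.\<Psi> []" by (rule AE_entropy)
  fix h assume "AE \<omega> in N. (\<lambda>k. - (1 / real k) * ln (\<P>(\<omega>' in N. \<forall>l\<in>{1..k}. hidden_Y Z l \<omega>' = hidden_Y Z l \<omega>))) \<longlonglongrightarrow> h"
  with AE_entropy have "AE \<omega> in N. h = (\<Sum>x\<in>A. \<mu> x) * words.\<Psi> []"
    by eventually_elim (rule LIMSEQ_unique)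
  then show "h = (\<Sum>x\<in>A. \<mu> x) * words.\<Psi> []" by simp
qed

section \<open>From path weights to block weights\<close>

lemma \<nu>_mass_eq: "\<nu>_mass \<nu> [a, b] = (\<Sum>x\<in>A. \<mu> x)"
proof -
  have "(\<Sum>x\<in>A. \<mu> x) = (\<Sum>x\<in>support_words. \<mu> x * of_bool (suffix2 x = [a, b]))"
    using finite_support_words by (intro sum.mono_neutral_cong_left) (auto simp: A_iff)
  also have "\<dots> = (\<Sum>z\<in>set_pmf \<nu>. pmf \<nu> z * of_bool (suffix2 (snd z) = [a, b]))" by (rule sum_\<mu>)
  also have "\<dots> = \<nu>_mass \<nu> [a, b]"
    unfolding \<nu>_mass_def using finite_hidden_states set_\<nu>
    by (intro sum.mono_neutral_cong) (auto simp: set_pmf_iff)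
  finally show ?thesis ..
qed

text \<open>The support is closed under transitions, and from \<open>[a, b]\<close> one moves as
  from a word of \<open>A\<close>. So lists over \<open>W_values\<close> that leave the support have
  weight 0 and may be dropped from sums.\<close>

lemma path_prod_support_words:
  assumes "path_prod q x xs \<noteq> 0" "x \<in> support_words \<or> x = [a, b]" shows "set xs \<subseteq> support_words"
  using assms
proof (induction xs arbitrary: x)
  case (Cons y xs)
  obtain x' where x': "x' \<in> support_words" "suffix2 x' = suffix2 x"
  proof (cases "x \<in> support_words")
    case False
    obtain x' where "x' \<in> A" using words.A_nonempty by blast
    then show ?thesis using that[of x'] False Cons.prems(2) by (simp add: A_iff suffix2_id)
  qed (use that in blast)
  have "q x y \<noteq> 0" using Cons.prems by auto
  then have "y \<in> \<S> (suffix2 x')" using x'(2) by (auto simp: q_def split: if_splits)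
  then have "y \<in> support_words" using support_words_closed[OF x'(1)] by blast
  then show ?case using Cons.IH[of y] Cons.prems by auto
qed simp

lemma path_prod_q_long: "set xs \<subseteq> support_words \<Longrightarrow> length x \<ge> 2 \<Longrightarrow> path_prod q_long x xs = path_prod q x xs"
proof (induction xs arbitrary: x)
  case (Cons y xs)
  then show ?case using support_words_facts(2)[of y] by (simp add: q_long_def)
qed simp

lemma prob_suffix_pos: "\<P>(\<omega> in P []. suffix2 (W 1 \<omega>) = [a, b]) > 0"
proof -
  obtain x where "x \<in> A" using words.A_nonempty by blast
  then have x: "x \<in> W_values" "suffix2 x = [a, b]" using support_words_facts(1) by (auto simp: A_iff)
  have [measurable]: "Measurable.pred (P []) (\<lambda>\<omega>. suffix2 (W 1 \<omega>) = [a, b])"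
    by (rule measurable_compose[OF W_meas]) simp
  have "0 < \<P>(\<omega> in P []. W 1 \<omega> = x)" using x(1) by (simp add: W_values_def)
  also have "\<dots> \<le> \<P>(\<omega> in P []. suffix2 (W 1 \<omega>) = [a, b])"
    using x(2) by (intro P.finite_measure_mono) auto
  finally show ?thesis .
qed

lemma path_weight_q:
  assumes "xs \<noteq> []" "suffix2 (last xs) = [a, b]" shows "path_weight [a, b] xs = path_prod q [a, b] xs"
  using path_weight_eq[OF prob_suffix_pos _ assms] by (simp add: suffix2_id)

lemma boundary_iff_cone:
  assumes "x \<in> support_words" "y \<in> support_words" shows "y \<in> boundary x \<longleftrightarrow> cone y = cone x"
proof
  assume c: "cone y = cone x"
  have "length y = length x" using cone_eq_imp(1)[OF c] support_words_facts(2)[OF assms(2)] by simp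
  then have "boundary y = boundary x" unfolding boundary_def c by simp
  then show "y \<in> boundary x" using support_words_facts(4)[OF assms(2)] by simp
qed (rule boundary_cone(1))

text \<open>On the support, lying in the boundary of another word means having the same cone, so the
  lists summed over are those with the same observations, up to lists of weight 0.\<close>

lemma path_weight_tilde_eq:
  assumes xs: "xs \<noteq> []" "set xs \<subseteq> support_words" "suffix2 (last xs) = [a, b]"
  shows "path_weight_tilde [a, b] xs = words.block_weight xs"
proof -
  let ?T = "{ys. length ys = length xs \<and> set ys \<subseteq> W_values \<and> (\<forall>i<length xs. ys ! i \<in> boundary (xs ! i))}"
  have finT: "finite ?T"
    by (rule finite_subset[OF _ finite_lists_length_eq[OF finite_W_values, of "length xs"]]) auto
  have pw: "path_weight [a, b] ys = path_prod q [a, b] ys" if ys: "ys \<in> ?T" for ys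
  proof (rule path_weight_q)
    show ne: "ys \<noteq> []" using ys xs(1) by auto
    have last: "last xs \<in> support_words" using xs by auto
    have l: "length (last xs) \<ge> 2" using support_words_facts(2)[OF last] by simp
    \<comment> \<open>The last word ends in the unambiguous pair, so its boundary is a singleton and
      every competing list ends in the same word.\<close>
    have "boundary (last xs) = (@) (stem (last xs)) ` boundary (suffix2 (last xs))"
      using boundary_append[of "suffix2 (last xs)" "stem (last xs)"] length_suffix2[OF l] by (simp add: stem_append_suffix2)
    also have "\<dots> = {last xs}" using xs(3) unambiguous stem_append_suffix2[of "last xs"] by simp
    finally have "last ys = last xs"
      using ys ne xs(1) by (auto simp: last_conv_nth)
    then show "suffix2 (last ys) = [a, b]" using xs(3) by simp
  qed
  have Mt: "words.matches xs = {ys \<in> ?T. set ys \<subseteq> support_words}"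
  proof (intro equalityI subsetI)
    fix ys assume ys: "ys \<in> words.matches xs"
    then have s: "set ys \<subseteq> support_words" "map cone ys = map cone xs" by (auto simp: words.matches_def)
    have l: "length ys = length xs" using s(2) by (rule map_eq_imp_length_eq)
    have "ys ! i \<in> boundary (xs ! i)" if "i < length xs" for i
    proof -
      have "cone (ys ! i) = cone (xs ! i)" using s(2) l that by (metis nth_map)
      moreover have "ys ! i \<in> support_words" "xs ! i \<in> support_words" using s(1) xs(2) l that by (auto simp: subset_iff)
      ultimately show ?thesis using boundary_iff_cone by blast
    qed
    then show "ys \<in> {ys \<in> ?T. set ys \<subseteq> support_words}" using s l support_words_facts(1) by auto
  next
    fix ys assume "ys \<in> {ys \<in> ?T. set ys \<subseteq> support_words}"
    then show "ys \<in> words.matches xs"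
      using boundary_cone(1) by (auto simp: words.matches_def list_eq_iff_nth_eq)
  qed
  have "path_weight_tilde [a, b] xs = (\<Sum>ys\<in>?T. path_prod q [a, b] ys)"
    unfolding path_weight_tilde_def by (intro sum.cong refl pw)
  also have "\<dots> = (\<Sum>ys\<in>words.matches xs. path_prod q [a, b] ys)"
    unfolding Mt using finT path_prod_support_words by (intro sum.mono_neutral_right) auto
  also have "\<dots> = words.block_weight xs"
    unfolding words.block_weight_def by (intro sum.cong refl) (simp add: words.matches_def path_prod_q_long)
  finally show ?thesis .
qed

text \<open>The summand \<open>n = k + 2\<close> runs over lists of \<open>k + 1\<close> words,
  which are the blocks of length \<open>k + 1\<close>.\<close>

lemma first_return_sum:
  "(\<Sum>xs\<in>first_return_paths [a, b] (k + 2). path_weight [a, b] xs * ln (path_weight_tilde [a, b] xs))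
    = - (\<Sum>xs\<in>words.first_returns k. path_prod q_long [a, b] xs * words.info xs)"
proof -
  let ?F = "first_return_paths [a, b] (k + 2)"
  have fin: "finite ?F"
    by (rule finite_subset[OF _ finite_lists_length_eq[OF finite_W_values, of "k + 1"]])
      (auto simp: first_return_paths_def)
  have FR: "words.first_returns k = {xs \<in> ?F. set xs \<subseteq> support_words}"
  proof (intro set_eqI iffI)
    fix xs assume xs: "xs \<in> words.first_returns k"
    then have "xs \<noteq> []" "set xs \<subseteq> support_words" by (auto simp: words.first_returns_def words.state_lists_def)
    moreover have "suffix2 x \<noteq> [a, b]" if "x \<in> set (butlast xs)" for x
      using A_iff[of x] in_set_butlastD[OF that] that xs \<open>set xs \<subseteq> support_words\<close> by (auto simp: words.first_returns_def)
    ultimately show "xs \<in> {xs \<in> ?F. set xs \<subseteq> support_words}"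
      using xs support_words_facts(1) by (auto simp: words.first_returns_def words.state_lists_def first_return_paths_def A_iff)
  next
    fix xs assume xs: "xs \<in> {xs \<in> ?F. set xs \<subseteq> support_words}"
    then have "xs \<noteq> []" by (auto simp: first_return_paths_def)
    then have "last xs \<in> support_words" using xs by auto
    then show "xs \<in> words.first_returns k"
      using xs by (auto simp: words.first_returns_def words.state_lists_def first_return_paths_def A_iff)
  qed
  have ne: "xs \<noteq> [] \<and> suffix2 (last xs) = [a, b]" if "xs \<in> ?F" for xs
    using that by (auto simp: first_return_paths_def)
  have "(\<Sum>xs\<in>?F. path_weight [a, b] xs * ln (path_weight_tilde [a, b] xs))
      = (\<Sum>xs\<in>words.first_returns k. path_weight [a, b] xs * ln (path_weight_tilde [a, b] xs))"
  proof (intro sum.mono_neutral_right fin ballI)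
    show "words.first_returns k \<subseteq> ?F" using FR by blast
    \<comment> \<open>Outside the support the weight is 0, and the term vanishes whatever the value
      of the logarithm.\<close>
    fix xs assume xs: "xs \<in> ?F - words.first_returns k"
    then have "\<not> set xs \<subseteq> support_words" using FR by blast
    then have "path_prod q [a, b] xs = 0" using path_prod_support_words by blast
    then have "path_weight [a, b] xs = 0" using path_weight_q ne[of xs] xs by simp
    then show "path_weight [a, b] xs * ln (path_weight_tilde [a, b] xs) = 0" by simp
  qed
  also have "\<dots> = (\<Sum>xs\<in>words.first_returns k. - (path_prod q_long [a, b] xs * words.info xs))"
  proof (intro sum.cong refl)
    fix xs assume "xs \<in> words.first_returns k"
    then have xs: "xs \<in> ?F" "set xs \<subseteq> support_words" using FR by auto
    show "path_weight [a, b] xs * ln (path_weight_tilde [a, b] xs) = - (path_prod q_long [a, b] xs * words.info xs)"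
      using ne[OF xs(1)] path_weight_q path_weight_tilde_eq[OF _ xs(2)] path_prod_q_long[OF xs(2), of "[a, b]"]
      by (simp add: words.info_def)
  qed
  finally show ?thesis by (simp add: sum_negf)
qed

text \<open>Up to the sign the terms are nonnegative, so the convergent series is summable in the
  unconditional sense as well.\<close>

lemma first_return_has_sum:
  "((\<lambda>n. \<Sum>xs\<in>first_return_paths [a, b] n. path_weight [a, b] xs * ln (path_weight_tilde [a, b] xs))
     has_sum - words.\<Psi> []) {2..}"
proof -
  have "((\<lambda>k. \<Sum>xs\<in>words.first_returns k. path_prod q_long [a, b] xs * words.info xs) has_sum words.\<Psi> []) UNIV"
    by (rule sums_nonneg_imp_has_sum[OF words.\<Psi>_Nil_sums]) (intro sum_nonneg words.first_returns_term_nonneg)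
  then have "((\<lambda>k. - (\<Sum>xs\<in>words.first_returns k. path_prod q_long [a, b] xs * words.info xs)) has_sum - words.\<Psi> []) UNIV"
    by (simp add: has_sum_uminus)
  moreover have "bij_betw (\<lambda>k. k + 2) UNIV {2 :: nat..}"
    by (rule bij_betwI[where g = "\<lambda>n. n - 2"]) auto
  ultimately show ?thesis
    unfolding first_return_sum[symmetric] using has_sum_reindex_bij_betw by blast
qed

end

theorem theorem7p4:
  fixes K :: "'a::finite list \<Rightarrow> 'a list pmf"
    and P :: "'a list \<Rightarrow> 'w measure"
    and X :: "nat \<Rightarrow> 'w \<Rightarrow> 'a list"
    and cov :: "'a list set \<Rightarrow> 'a list list"
    and C0 :: "'a list list"
    and \<nu> :: "('a cone_label \<times> 'a list) pmf"
    and N :: "'b measure"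
    and Z :: "nat \<Rightarrow> 'b \<Rightarrow> 'a cone_label \<times> 'a list"
    and a b :: 'a
  assumes walk: "covered_walk K P X cov C0"
    and transient: "regular_language_walk.transient P X"
    and weakly_symmetric: "regular_language_walk.weakly_symmetric K"
    and suffix_irreducible: "regular_language_walk.suffix_irreducible P X"
    and invariant: "covered_walk.hidden_invariant K P X cov C0 \<nu>"
    and hidden_chain: "markov_chain N (covered_walk.hidden_states K P X cov C0) (pmf \<nu>)
                         (covered_walk.hidden_trans K P X cov) (\<lambda>k. Z (Suc k))"
    and unambiguous: "regular_language_walk.boundary K [a, b] = {[a, b]}"
  shows "(\<lambda>n. \<Sum>xs\<in>covered_walk.first_return_paths K P X cov C0 [a, b] n.
              covered_walk.path_weight K P X cov C0 [a, b] xs *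
              ln (covered_walk.path_weight_tilde K P X cov C0 [a, b] xs)) summable_on {2..} \<and>
         entropy_rate N (hidden_Y Z) =
           - covered_walk.\<nu>_mass K P X cov C0 \<nu> [a, b] *
             (\<Sum>\<^sub>\<infinity>n\<in>{2..}. \<Sum>xs\<in>covered_walk.first_return_paths K P X cov C0 [a, b] n.
                covered_walk.path_weight K P X cov C0 [a, b] xs *
                ln (covered_walk.path_weight_tilde K P X cov C0 [a, b] xs))"
proof -
  interpret covered_walk K P X cov C0 by (rule walk)
  interpret hidden_walk K P X cov C0 \<nu> N Z a b
    by unfold_locales (fact transient weakly_symmetric suffix_irreducible invariant hidden_chain unambiguous)+
  show ?thesis
    using first_return_has_sum entropy_rate_eq \<nu>_mass_eq
    by (auto simp: has_sum_imp_summable infsumI)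
qed

end
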